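(* Let $n\ge1$ and let $H:\mathbb{R}^n\times\mathbb{R}^n\to\mathbb{R}$ be continuous with $y\mapsto H(y,p)$ $\mathbb{Z}^n$-periodic for each $p$, $\lim_{|p|\to\infty}H(y,p)=+\infty$ uniformly in $y$, and $p\mapsto H(y,p)$ convex for each $y$. Let $g:\mathbb{R}^n\to\mathbb{R}$ be Lipschitz continuous and concave (not necessarily bounded). For $\varepsilon>0$ let $u^\varepsilon$ be the viscosity solution of $u^\varepsilon_t+H(x/\varepsilon,Du^\varepsilon)=0$ in $\mathbb{R}^n\times(0,\infty)$, $u^\varepsilon(\cdot,0)=g$, and let $u$ be the viscosity solution of $u_t+\overline H(Du)=0$ in $\mathbb{R}^n\times(0,\infty)$, $u(\cdot,0)=g$, where $\overline H$ is the effective Hamiltonian of $H$. Then there is a constant $C$ depending only on $H$ and $\|Dg\|_{L^\infty(\mathbb{R}^n)}$ such that for every $\varepsilon>0$ $$|u^\varepsilon(x,t)-u(x,t)|\le C\varepsilon\qquad\text{for all }(x,t)\in\mathbb{R}^n\times[0,\infty).$$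
   Context: $\mathbb{T}^n=\mathbb{R}^n/\mathbb{Z}^n$. The effective Hamiltonian $\overline H:\mathbb{R}^n\to\mathbb{R}$: for each $p\in\mathbb{R}^n$, $\overline H(p)$ is the unique constant such that the cell problem $H(y,p+Dv)=\overline H(p)$ in $\mathbb{T}^n$ has a continuous ($\mathbb{Z}^n$-periodic) viscosity solution $v$. "The viscosity solution" of each Cauchy problem means the unique viscosity solution that is Lipschitz continuous on $\mathbb{R}^n\times[0,\infty)$. *)

theory Defs
  imports "HOL-Analysis.Analysis"
begin

definition Zn_periodic :: "(real ^ 'n \<Rightarrow> 'b) \<Rightarrow> bool" where
  "Zn_periodic f \<longleftrightarrow> (\<forall>y k. (\<forall>i. k $ i \<in> \<int>) \<longrightarrow> f (y + k) = f y)"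

definition C1_with_gradient_on ::
  "'a::euclidean_space set \<Rightarrow> ('a \<Rightarrow> real) \<Rightarrow> ('a \<Rightarrow> 'a) \<Rightarrow> bool" where
  "C1_with_gradient_on \<Omega> \<phi> D\<phi> \<longleftrightarrow>
     (\<forall>z\<in>\<Omega>. GDERIV \<phi> z :> D\<phi> z) \<and> continuous_on \<Omega> D\<phi>"

text \<open>Viscosity sub- and supersolutions of \<open>F(z, Du(z)) = 0\<close>, for an open set \<open>\<Omega>\<close>.\<close>

definition viscosity_subsolution_on ::
  "'a::euclidean_space set \<Rightarrow> ('a \<Rightarrow> 'a \<Rightarrow> real) \<Rightarrow> ('a \<Rightarrow> real) \<Rightarrow> bool" where
  "viscosity_subsolution_on \<Omega> F u \<longleftrightarrow>
     (\<forall>\<phi> D\<phi> z. C1_with_gradient_on \<Omega> \<phi> D\<phi> \<longrightarrow> z \<in> \<Omega> \<longrightarrow>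
        (\<forall>\<^sub>F w in nhds z. u w - \<phi> w \<le> u z - \<phi> z) \<longrightarrow> F z (D\<phi> z) \<le> 0)"

definition viscosity_supersolution_on ::
  "'a::euclidean_space set \<Rightarrow> ('a \<Rightarrow> 'a \<Rightarrow> real) \<Rightarrow> ('a \<Rightarrow> real) \<Rightarrow> bool" where
  "viscosity_supersolution_on \<Omega> F u \<longleftrightarrow>
     (\<forall>\<phi> D\<phi> z. C1_with_gradient_on \<Omega> \<phi> D\<phi> \<longrightarrow> z \<in> \<Omega> \<longrightarrow>
        (\<forall>\<^sub>F w in nhds z. u w - \<phi> w \<ge> u z - \<phi> z) \<longrightarrow> F z (D\<phi> z) \<ge> 0)"

definition viscosity_solution_on ::
  "'a::euclidean_space set \<Rightarrow> ('a \<Rightarrow> 'a \<Rightarrow> real) \<Rightarrow> ('a \<Rightarrow> real) \<Rightarrow> bool" where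
  "viscosity_solution_on \<Omega> F u \<longleftrightarrow> continuous_on \<Omega> u \<and>
     viscosity_subsolution_on \<Omega> F u \<and> viscosity_supersolution_on \<Omega> F u"

text \<open>The cell problem \<open>H(y, p + Dv) = c\<close> on the torus; functions on the torus are
  \<open>\<int>\<^sup>n\<close>-periodic functions on the whole space.\<close>

definition cell_problem_solution ::
  "(real ^ 'n \<Rightarrow> real ^ 'n \<Rightarrow> real) \<Rightarrow> real ^ 'n \<Rightarrow> real \<Rightarrow> (real ^ 'n \<Rightarrow> real) \<Rightarrow> bool" where
  "cell_problem_solution H p c v \<longleftrightarrow>
     Zn_periodic v \<and> viscosity_solution_on UNIV (\<lambda>y q. H y (p + q) - c) v"

definition effective_Hamiltonian ::
  "(real ^ 'n \<Rightarrow> real ^ 'n \<Rightarrow> real) \<Rightarrow> real ^ 'n \<Rightarrow> real" where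
  "effective_Hamiltonian H p = (THE c. \<exists>v. cell_problem_solution H p c v)"

text \<open>Lipschitz viscosity solutions of \<open>u\<^sub>t + G(x, Du) = 0\<close> for positive times with initial
  datum \<open>g\<close>. Space-time points are pairs \<open>(x, t)\<close>, so the space-time gradient is the pair
  \<open>(Du, u\<^sub>t)\<close>. Values of \<open>u\<close> at negative times are irrelevant.\<close>

definition Cauchy_viscosity_solution ::
  "(real ^ 'n \<Rightarrow> real ^ 'n \<Rightarrow> real) \<Rightarrow> (real ^ 'n \<Rightarrow> real) \<Rightarrow> ((real ^ 'n) \<times> real \<Rightarrow> real) \<Rightarrow> bool" where
  "Cauchy_viscosity_solution G g u \<longleftrightarrow>
     (\<exists>M. M-lipschitz_on (UNIV \<times> {0..}) u) \<and>
     viscosity_solution_on (UNIV \<times> {0<..}) (\<lambda>(x, t) (q, \<tau>). \<tau> + G x q) u \<and>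
     (\<forall>x. u (x, 0) = g x)"

end

theory Submission
  imports Defs
begin

text \<open>A concave Lipschitz \<open>g\<close> is the infimum of its affine majorants \<open>a + p \<bullet> x\<close>, whose slopes
  are bounded by the Lipschitz constant. For affine data the effective solution is
  \<open>a + p \<bullet> x - c t\<close> with \<open>c\<close> the effective Hamiltonian at \<open>p\<close>, and adding the corrector
  \<open>\<epsilon> v\<^sub>p(x/\<epsilon>)\<close> gives an exact solution of the oscillating equation at distance \<open>O(\<epsilon>)\<close>. For a
  Hamiltonian that is convex in the gradient an infimum of subsolutions is a subsolution, so by
  comparison both Cauchy solutions are squeezed onto the infima of these families.

  Stability under infima, suprema and convex combinations all come from one fact: a Lipschitz
  function is a subsolution iff its Clarke directional derivatives are bounded by the support
  function of the sublevel set of the Hamiltonian.\<close>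

text \<open>The error \<open>C * \<epsilon>\<close> arises only at time zero. Correctors shifted to
  take values between 0 and \<open>C\<close> keep the corrected planes above \<open>g\<close> while
  raising their infimum by at most \<open>C * \<epsilon>\<close>; comparison carries this gap
  unchanged to every later time, whence the uniformity in \<open>t\<close>. The constant is the
  oscillation of the correctors, bounded uniformly over slopes of norm at most \<open>L\<close>.

  The other obstacle is the effective Hamiltonian: being a definite description, it says nothing
  until the cell problem is shown to be solvable at exactly one level. The level is taken as the
  least one that admits a periodic subsolution, and a critical subsolution that is also a
  supersolution is found by contradiction, from Perron bumps and averaging. The functions built
  there are again infima, suprema or averages of subsolutions, so the directional criterion serves
  the cell problem as well as the Cauchy problem. The criterion itself is proved with test functions
  alone.\<close>

section \<open>Subsolutions and directional derivatives\<close>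

text \<open>The test function is affine in the direction \<open>b - a\<close> up to a small multiple of a high power,
  which has the harmless sign and keeps the maximum off the far end of a thin tube around the segment.\<close>

lemma tube_bound:
  fixes u :: "'a::euclidean_space \<Rightarrow> real"
  assumes sub: "viscosity_subsolution_on \<Omega> F u" and cont: "continuous_on \<Omega> u"
    and ball: "ball z r \<subseteq> \<Omega>" and a: "a \<in> ball z r" and b: "b \<in> ball z r" and "a \<noteq> b"
    and F: "\<And>y q. y \<in> ball z r \<Longrightarrow> F y q \<le> 0 \<Longrightarrow> q \<bullet> (b - a) \<le> m"
  shows "u b \<le> u a + m"
proof (rule ccontr)
  assume "\<not> u b \<le> u a + m"
  define \<eta> where "\<eta> = (u b - u a - m) / 4"
  have \<eta>: "\<eta> > 0" and ub: "u b = u a + m + 4 * \<eta>"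
    using \<open>\<not> u b \<le> u a + m\<close> by (auto simp: \<eta>_def field_simps)
  \<comment> \<open>The segment is prolonged slightly beyond \<open>b\<close>, to a parameter
    \<beta> > 1, so that a high power of the parameter equals 1 at \<open>b\<close> and is huge at
    the far end.\<close>
  define e where "e = b - a"
  have e: "e \<noteq> 0" "e \<bullet> e > 0" using \<open>a \<noteq> b\<close> by (auto simp: e_def)
  have "((\<lambda>\<beta>. a + \<beta> *\<^sub>R e) \<longlongrightarrow> a + 1 *\<^sub>R e) (at_right 1)"
    by (intro tendsto_intros)
  moreover have "a + 1 *\<^sub>R e \<in> ball z r" using b by (simp add: e_def)
  ultimately have "\<forall>\<^sub>F \<beta> in at_right 1. a + \<beta> *\<^sub>R e \<in> ball z r"
    using topological_tendstoD open_ball by blast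
  then have "\<forall>\<^sub>F \<beta> in at_right 1. a + \<beta> *\<^sub>R e \<in> ball z r \<and> \<beta> > 1"
    using eventually_at_right_less[of "1::real"] by (rule eventually_conj)
  then obtain \<beta> :: real where \<beta>: "\<beta> > 1" "a + \<beta> *\<^sub>R e \<in> ball z r"
    using eventually_happens'[OF trivial_limit_at_right_real] by blast
  define r1 where "r1 = max (dist z a) (dist z (a + \<beta> *\<^sub>R e))"
  have r1: "r1 < r" using a \<beta> by (auto simp: r1_def)
  have seg: "a + s *\<^sub>R e + y \<in> ball z r" if "0 \<le> s" "s \<le> \<beta>" "norm y \<le> (r - r1) / 2" for s y
  proof -
    have "a + s *\<^sub>R e = (1 - s / \<beta>) *\<^sub>R a + (s / \<beta>) *\<^sub>R (a + \<beta> *\<^sub>R e)"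
      using \<beta> by (simp add: algebra_simps)
    moreover have "\<dots> \<in> cball z r1"
      by (rule convexD_alt[OF convex_cball]) (use that \<beta> in \<open>auto simp: r1_def algebra_simps\<close>)
    ultimately have "dist z (a + s *\<^sub>R e) \<le> r1" by simp
    moreover have "dist z (a + s *\<^sub>R e + y) \<le> dist z (a + s *\<^sub>R e) + norm y"
      by (metis add_diff_cancel_left' dist_commute dist_norm dist_triangle)
    ultimately show ?thesis using that r1 by simp
  qed
  obtain \<rho>' where \<rho>': "\<rho>' > 0" "\<And>x. x \<in> \<Omega> \<Longrightarrow> dist x a < \<rho>' \<Longrightarrow> dist (u x) (u a) < \<eta>"
    using cont[unfolded continuous_on_iff] a ball \<eta> by (meson subsetD)
  define \<rho> where "\<rho> = min (\<rho>' / 2) ((r - r1) / 2)"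
  have \<rho>: "\<rho> > 0" "\<rho> < \<rho>'" "\<rho> \<le> (r - r1) / 2" using \<rho>' r1 by (auto simp: \<rho>_def min_def)
  define s where "s x = (x - a) \<bullet> e / (e \<bullet> e)" for x
  define P where "P x = (x - a) - s x *\<^sub>R e" for x
  have dec: "x = a + s x *\<^sub>R e + P x" for x by (simp add: P_def)
  have Pe: "P x \<bullet> e = 0" for x using e by (simp add: P_def s_def inner_diff_left)
  have conts: "continuous_on A s" for A unfolding s_def by (intro continuous_intros) (use e in auto)
  have contP: "continuous_on A P" for A unfolding P_def by (intro continuous_intros conts)
  define K where "K = {x. 0 \<le> s x \<and> s x \<le> \<beta> \<and> norm (P x) \<le> \<rho>}"
  have K\<Omega>: "K \<subseteq> ball z r"
  proof
    fix x assume "x \<in> K"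
    then have "a + s x *\<^sub>R e + P x \<in> ball z r" by (intro seg) (use \<rho> in \<open>auto simp: K_def\<close>)
    then show "x \<in> ball z r" using dec[of x] by simp
  qed
  have "closed K" unfolding K_def
    by (intro closed_Collect_conj closed_Collect_le continuous_intros conts contP)
  moreover have "bounded K" using K\<Omega> bounded_ball bounded_subset by blast
  ultimately have "compact K" by (simp add: compact_eq_bounded_closed)
  have cK: "continuous_on K u" using cont K\<Omega> ball continuous_on_subset by blast
  obtain B where B: "\<And>x. x \<in> K \<Longrightarrow> \<bar>u x\<bar> \<le> B"
    using compact_imp_bounded[OF compact_continuous_image[OF cK \<open>compact K\<close>]]
    by (auto simp: bounded_iff)
  \<comment> \<open>As soon as one of the two penalties reaches \<open>J\<close>, the value of
    \<open>u - \<phi>\<close> falls below \<open>u a\<close>, whatever the linear part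
    contributes.\<close>
  define J where "J = 2 * B + \<bar>m + \<eta>\<bar> * \<beta> + 1"
  define \<Lambda> where "\<Lambda> = J / \<rho>\<^sup>2"
  have sa: "s a = 0" "P a = 0" by (auto simp: s_def P_def)
  have "b = a + e" by (simp add: e_def)
  then have sb: "s b = 1" "P b = 0" using e(1) by (simp_all add: s_def P_def)
  have aK: "a \<in> K" and bK: "b \<in> K" using sa sb \<beta> \<rho> by (auto simp: K_def)
  have "B \<ge> 0" using B[OF aK] by linarith
  then have J: "J > 0" using \<beta> by (simp add: J_def add_nonneg_pos)
  obtain N where N: "\<beta> ^ N > J / \<eta>" using real_arch_pow[OF \<beta>(1)] by blast
  define \<phi> where "\<phi> x = (m + \<eta>) * s x + \<eta> * s x ^ N + \<Lambda> * (P x \<bullet> P x)" for x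
  define D where "D x = ((m + \<eta> + \<eta> * (of_nat N * s x ^ (N - 1))) / (e \<bullet> e)) *\<^sub>R e + (2 * \<Lambda>) *\<^sub>R P x" for x
  have ders: "(s has_derivative (\<lambda>h. h \<bullet> e / (e \<bullet> e))) (at x)" for x
    unfolding s_def using e(1) by (auto intro!: derivative_eq_intros)
  have derP: "(P has_derivative (\<lambda>h. h - (h \<bullet> e / (e \<bullet> e)) *\<^sub>R e)) (at x)" for x
    unfolding P_def by (auto intro!: derivative_eq_intros ders)
  have G: "GDERIV \<phi> x :> D x" for x
    unfolding gderiv_def \<phi>_def
    apply (rule derivative_eq_intros ders derP refl)+
    apply (rule ext)
    using Pe[of x] by (simp add: D_def inner_diff_left inner_diff_right inner_add_right inner_commute add_divide_distrib field_simps)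
  have contD: "continuous_on A D" for A
    unfolding D_def using e by (intro continuous_intros conts contP) auto
  have C1: "C1_with_gradient_on \<Omega> \<phi> D"
    using G contD by (simp add: C1_with_gradient_on_def)
  have "continuous_on K (\<lambda>x. u x - \<phi> x)"
    unfolding \<phi>_def by (intro continuous_intros cK conts contP)
  then obtain x where x: "x \<in> K" "\<And>y. y \<in> K \<Longrightarrow> u y - \<phi> y \<le> u x - \<phi> x"
    using continuous_attains_sup[OF \<open>compact K\<close>] aK by blast
  \<comment> \<open>At \<open>b\<close> the test function uses up m + 2\<eta> of the excess m +
    4\<eta>. The remaining 2\<eta> cannot be matched on the face \<open>s x = 0\<close>, where
    \<open>u\<close> stays within \<eta> of \<open>u a\<close>.\<close>
  have val: "u x - \<phi> x \<ge> u a + 2 * \<eta>"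
    using x(2)[OF bK] by (simp add: \<phi>_def sb ub)
  have lin: "- ((m + \<eta>) * s x) \<le> \<bar>m + \<eta>\<bar> * \<beta>"
  proof -
    have "- ((m + \<eta>) * s x) = - (m + \<eta>) * s x" by (rule minus_mult_left)
    also have "\<dots> \<le> \<bar>m + \<eta>\<bar> * s x"
      by (rule mult_right_mono) (use x(1) in \<open>auto simp: K_def\<close>)
    also have "\<dots> \<le> \<bar>m + \<eta>\<bar> * \<beta>" using x(1) by (auto simp: K_def intro: mult_left_mono)
    finally show ?thesis .
  qed
  have \<Lambda>: "\<Lambda> \<ge> 0" using J by (simp add: \<Lambda>_def)
  have pos: "0 \<le> \<eta> * s x ^ N" "0 \<le> \<Lambda> * (P x \<bullet> P x)" using x(1) \<eta> \<Lambda> by (auto simp: K_def)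
  have uB: "u x \<le> B" "- B \<le> u a" using B[OF x(1)] B[OF aK] by auto
  have "s x \<noteq> 0"
  proof
    assume s0: "s x = 0"
    then have "x = a + P x" using dec[of x] by simp
    then have "dist x a \<le> \<rho>" using x(1) by (simp add: K_def dist_norm P_def s0)
    then have "dist (u x) (u a) < \<eta>" using \<rho>' \<rho> x(1) K\<Omega> ball by (meson order.strict_trans1 subsetD)
    then have "u x \<le> u a + \<eta>" by (simp add: dist_real_def)
    moreover have "\<phi> x \<ge> 0" using pos by (simp add: \<phi>_def s0)
    ultimately show False using val \<eta> by linarith
  qed
  moreover have "s x \<noteq> \<beta>"
  proof
    assume s1: "s x = \<beta>"
    have "\<eta> * \<beta> ^ N > J" using N \<eta> by (simp add: field_simps)
    then show False using val lin pos uB \<eta> by (simp add: \<phi>_def J_def s1)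
  qed
  moreover have "norm (P x) \<noteq> \<rho>"
  proof
    assume "norm (P x) = \<rho>"
    then have "\<Lambda> * (P x \<bullet> P x) = J" using \<rho> by (simp add: \<Lambda>_def dot_square_norm)
    then show False using val lin pos uB \<eta> by (simp add: \<phi>_def J_def)
  qed
  ultimately have s: "0 < s x" "s x < \<beta>" "norm (P x) < \<rho>" using x(1) by (auto simp: K_def)
  have "open {y. 0 < s y \<and> s y < \<beta> \<and> norm (P y) < \<rho>}"
    by (intro open_Collect_conj open_Collect_less continuous_intros conts contP)
  then have "\<forall>\<^sub>F y in nhds x. y \<in> {y. 0 < s y \<and> s y < \<beta> \<and> norm (P y) < \<rho>}"
    using s by (intro eventually_nhds_in_open) auto
  then have "\<forall>\<^sub>F y in nhds x. u y - \<phi> y \<le> u x - \<phi> x"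
    by eventually_elim (use x(2) in \<open>auto simp: K_def\<close>)
  then have "F x (D x) \<le> 0"
    using sub C1 x(1) K\<Omega> ball unfolding viscosity_subsolution_on_def by blast
  then have "D x \<bullet> e \<le> m" using F x(1) K\<Omega> by (auto simp: e_def)
  moreover have "D x \<bullet> e = m + \<eta> + \<eta> * (of_nat N * s x ^ (N - 1))"
    using e Pe[of x] by (simp add: D_def inner_add_left)
  moreover have "\<eta> * (of_nat N * s x ^ (N - 1)) \<ge> 0" using s \<eta> by simp
  ultimately show False using \<eta> by linarith
qed

lemma viscosity_subsolution_onD:
  assumes "viscosity_subsolution_on \<Omega> F u" "C1_with_gradient_on \<Omega> \<phi> D" "z \<in> \<Omega>"
    "\<forall>\<^sub>F w in nhds z. u w - \<phi> w \<le> u z - \<phi> z"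
  shows "F z (D z) \<le> 0"
  using assms unfolding viscosity_subsolution_on_def by blast

lemma gderiv_directional:
  assumes "GDERIV \<phi> z :> D"
  shows "((\<lambda>s. (\<phi> (z + s *\<^sub>R e) - \<phi> z) / s) \<longlongrightarrow> D \<bullet> e) (at 0)"
proof -
  have "((\<lambda>s. \<phi> (z + s *\<^sub>R e)) has_derivative (\<lambda>h. (h *\<^sub>R e) \<bullet> D)) (at 0)"
    by (rule has_derivative_eq_rhs, rule has_derivative_compose[of "\<lambda>s. z + s *\<^sub>R e" "\<lambda>h. h *\<^sub>R e" 0 UNIV \<phi> "\<lambda>h. h \<bullet> D"])
       (use assms in \<open>auto intro!: derivative_eq_intros simp: gderiv_def\<close>)
  then have "DERIV (\<lambda>s. \<phi> (z + s *\<^sub>R e)) 0 :> D \<bullet> e"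
    by (simp add: has_field_derivative_def inner_commute mult.commute[of _ "D \<bullet> e"])
  then show ?thesis by (simp add: DERIV_def)
qed

text \<open>Touching from above makes the increment of \<phi> from \<open>z - s e\<close> to
  \<open>z\<close> at most that of \<open>u\<close>. Bounds on backward increments that end at the
  contact point therefore suffice, which is why the converse criterion below asks only for
  those.\<close>

lemma gradient_le_of_touching:
  assumes "GDERIV \<phi> z :> D" "\<forall>\<^sub>F w in nhds z. u w - \<phi> w \<le> u z - \<phi> z"
    and "r > 0" "\<And>s. 0 < s \<Longrightarrow> s < r \<Longrightarrow> u z \<le> u (z - s *\<^sub>R e) + m * s"
  shows "D \<bullet> e \<le> (m::real)"
proof -
  have "((\<lambda>s::real. z + s *\<^sub>R e) \<longlongrightarrow> z + 0 *\<^sub>R e) (at_left 0)"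
    by (intro tendsto_intros)
  then have "filterlim (\<lambda>s::real. z + s *\<^sub>R e) (nhds z) (at_left 0)" by simp
  then have "\<forall>\<^sub>F s in at_left 0. u (z + s *\<^sub>R e) - \<phi> (z + s *\<^sub>R e) \<le> u z - \<phi> z"
    using assms(2) unfolding filterlim_iff by blast
  moreover have "\<forall>\<^sub>F s in at_left (0::real). -r < s"
    using assms(3) by (intro eventually_at_left_field[THEN iffD2] exI[of _ "-r"]) auto
  moreover have "\<forall>\<^sub>F s in at_left (0::real). s < 0"
    by (simp add: eventually_at_filter)
  ultimately have "\<forall>\<^sub>F s in at_left 0. (\<phi> (z + s *\<^sub>R e) - \<phi> z) / s \<le> m"
  proof eventually_elim
    case (elim s)
    have "u z \<le> u (z - (-s) *\<^sub>R e) + m * (-s)" by (rule assms(4)) (use elim in auto)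
    then have "m * s \<le> \<phi> (z + s *\<^sub>R e) - \<phi> z" using elim by simp
    then show ?case using elim by (simp add: field_simps)
  qed
  then show ?thesis
    using tendsto_upperbound[OF tendsto_within_subset[OF gderiv_directional[OF assms(1), of e]]]
    by (simp add: trivial_limit_at_left_real)
qed

text \<open>Choosing the gradient itself as direction turns the one-sided estimate into |D|^2 \<le>
  M |D|. With \<open>M = 0\<close> and a constant function this is the vanishing of the gradient at
  an extremum, the form in which it is often used later.\<close>

lemma lipschitz_touching_norm_le:
  assumes "M-lipschitz_on \<Omega> u" "open \<Omega>" "z \<in> \<Omega>" "GDERIV \<phi> z :> D"
    "\<forall>\<^sub>F w in nhds z. u w - \<phi> w \<le> u z - \<phi> z"
  shows "norm D \<le> M"
proof -
  obtain r where r: "r > 0" "ball z r \<subseteq> \<Omega>" using assms(2,3) open_contains_ball by blast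
  have "D \<bullet> D \<le> M * norm D"
  proof (rule gradient_le_of_touching[OF assms(4,5)])
    show "r / (norm D + 1) > 0" using r by (simp add: add_nonneg_pos)
    fix s assume s: "0 < s" "s < r / (norm D + 1)"
    then have "s * norm D < r"
      by (smt (verit) mult_less_cancel_left_pos norm_ge_zero pos_less_divide_eq)
    then have "z - s *\<^sub>R D \<in> \<Omega>" using r s by (auto simp: dist_norm subset_iff)
    then have "dist (u z) (u (z - s *\<^sub>R D)) \<le> M * dist z (z - s *\<^sub>R D)"
      by (rule lipschitz_onD[OF assms(1,3)])
    then show "u z \<le> u (z - s *\<^sub>R D) + M * norm D * s"
      using s by (simp add: dist_real_def dist_norm abs_le_iff algebra_simps)
  qed
  then have "norm D * norm D \<le> M * norm D" by (simp add: dot_square_norm power2_eq_square)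
  moreover have "M \<ge> 0" using assms(1) by (simp add: lipschitz_on_def)
  ultimately show ?thesis by (cases "norm D = 0") auto
qed

text \<open>The radius is uniform over all \<open>M\<close>-Lipschitz subsolutions, which is what makes the
  infima and suprema below work.\<close>

lemma subsolution_directional_bound:
  fixes z e :: "'a::euclidean_space"
  assumes "open \<Omega>" "z \<in> \<Omega>" and cont: "continuous_on (\<Omega> \<times> UNIV) (\<lambda>(z, q). F z q)" and "e \<noteq> 0"
    and m: "\<And>q. norm q \<le> M \<Longrightarrow> F z q \<le> 0 \<Longrightarrow> q \<bullet> e < m"
  obtains r where "r > 0" "ball z r \<subseteq> \<Omega>"
    "\<And>u a s. \<lbrakk>M-lipschitz_on \<Omega> u; viscosity_subsolution_on \<Omega> F u; 0 < s;
        a \<in> ball z r; a + s *\<^sub>R e \<in> ball z r\<rbrakk> \<Longrightarrow> u (a + s *\<^sub>R e) \<le> u a + m * s"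
proof -
  \<comment> \<open>\<open>C\<close> holds the gradients to be excluded. \<open>F\<close> is
    positive on {z} x \<open>C\<close>, hence by compactness on \<open>X\<close> x \<open>C\<close>
    for a neighbourhood \<open>X\<close> of \<open>z\<close>. Neither set depends on the
    subsolution, so neither does the radius.\<close>
  define C where "C = cball 0 M \<inter> {q. m \<le> q \<bullet> e}"
  have "compact C" unfolding C_def
    by (intro compact_Int_closed compact_cball closed_Collect_le continuous_intros)
  define W where "W = {x \<in> \<Omega> \<times> UNIV. F (fst x) (snd x) > 0}"
  have "open (\<Omega> \<times> (UNIV :: 'a set))" using assms(1) by (simp add: open_Times)
  then have "open {x \<in> \<Omega> \<times> UNIV. case x of (z, q) \<Rightarrow> F z q > 0}"
    using continuous_open_preimage[OF cont _ open_greaterThan[of 0]]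
    by (simp add: vimage_def Int_def case_prod_beta)
  then have "open W" by (simp add: W_def case_prod_beta)
  moreover have "{z} \<times> C \<subseteq> W" using assms(2) m by (force simp: C_def W_def not_le)
  ultimately obtain X where X: "open X" "z \<in> X" "X \<times> C \<subseteq> W"
    using Elementary_Topology.tube_lemma[OF \<open>compact C\<close>, of W z] by blast
  have "open (X \<inter> \<Omega>)" "z \<in> X \<inter> \<Omega>" using X assms by auto
  then obtain r where r: "r > 0" "ball z r \<subseteq> X \<inter> \<Omega>" by (meson open_contains_ball)
  show thesis
  proof
    show "r > 0" "ball z r \<subseteq> \<Omega>" using r by auto
    fix u a s assume u: "M-lipschitz_on \<Omega> u" "viscosity_subsolution_on \<Omega> F u"
      and s: "0 < s" and a: "a \<in> ball z r" and b: "a + s *\<^sub>R e \<in> ball z r"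
    \<comment> \<open>An \<open>M\<close>-Lipschitz function is touched from above only by gradients
      of norm at most \<open>M\<close>. Building this cap into the Hamiltonian confines the
      gradients that \<open>tube_bound\<close> has to consider to a compact ball.\<close>
    have sub: "viscosity_subsolution_on \<Omega> (\<lambda>z q. max (F z q) (norm q - M)) u"
      unfolding viscosity_subsolution_on_def
    proof (intro allI impI)
      fix \<phi> D y
      assume *: "C1_with_gradient_on \<Omega> \<phi> D" "y \<in> \<Omega>" "\<forall>\<^sub>F w in nhds y. u w - \<phi> w \<le> u y - \<phi> y"
      then have "norm (D y) \<le> M"
        using lipschitz_touching_norm_le[OF u(1) assms(1)] by (auto simp: C1_with_gradient_on_def)
      then show "max (F y (D y)) (norm (D y) - M) \<le> 0"
        using viscosity_subsolution_onD[OF u(2) *] by simp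
    qed
    show "u (a + s *\<^sub>R e) \<le> u a + m * s"
    proof (rule tube_bound[OF sub _ _ a b])
      show "continuous_on \<Omega> u" using u(1) by (rule lipschitz_on_continuous_on)
      show "a \<noteq> a + s *\<^sub>R e" using s \<open>e \<noteq> 0\<close> by simp
      fix y q assume y: "y \<in> ball z r" and q: "max (F y q) (norm q - M) \<le> 0"
      have "q \<bullet> e < m"
      proof (rule ccontr)
        assume "\<not> q \<bullet> e < m"
        then have "(y, q) \<in> X \<times> C" using y q r by (auto simp: C_def)
        then show False using X q by (force simp: W_def)
      qed
      then show "q \<bullet> (a + s *\<^sub>R e - a) \<le> m * s" using s by (simp add: mult.commute)
    qed (use r in auto)
  qed
qed

text \<open>A gradient at which the inequality fails lies outside the closed convex set of
  admissible gradients, and a separating direction contradicts the directional bound. Convexity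
  enters only through this separation. If the set is empty, every direction and every
  \<open>m\<close> are permitted, so any basis vector with \<open>m\<close> below its product with
  the gradient will do.\<close>

lemma subsolution_from_directional_bound:
  fixes u :: "'a::euclidean_space \<Rightarrow> real"
  assumes conv: "\<And>z. z \<in> \<Omega> \<Longrightarrow> convex {q. norm q \<le> M \<and> F z q \<le> 0}"
    and closed: "\<And>z. z \<in> \<Omega> \<Longrightarrow> closed {q. norm q \<le> M \<and> F z q \<le> 0}"
    and bound: "\<And>z e m. \<lbrakk>z \<in> \<Omega>; e \<noteq> 0; \<And>q. norm q \<le> M \<Longrightarrow> F z q \<le> 0 \<Longrightarrow> q \<bullet> e < m\<rbrakk> \<Longrightarrow>
       \<exists>r>0. \<forall>s. 0 < s \<longrightarrow> s < r \<longrightarrow> u z \<le> u (z - s *\<^sub>R e) + m * s"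
  shows "viscosity_subsolution_on \<Omega> F u"
  unfolding viscosity_subsolution_on_def
proof (intro allI impI)
  fix \<phi> D z
  assume *: "C1_with_gradient_on \<Omega> \<phi> D" "z \<in> \<Omega>" "\<forall>\<^sub>F w in nhds z. u w - \<phi> w \<le> u z - \<phi> z"
  let ?S = "{q. norm q \<le> M \<and> F z q \<le> 0}"
  show "F z (D z) \<le> 0"
  proof (rule ccontr)
    assume "\<not> F z (D z) \<le> 0"
    then have "D z \<notin> ?S" by simp
    obtain e m where e: "e \<noteq> 0" "m < D z \<bullet> e" and m: "\<And>q. q \<in> ?S \<Longrightarrow> q \<bullet> e < m"
    proof (cases "?S = {}")
      case True
      obtain b :: 'a where "b \<in> Basis" using nonempty_Basis by blast
      with True that[of b "D z \<bullet> b - 1"] show ?thesis by force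
    next
      case False
      obtain a b where ab: "a \<bullet> D z < b" "\<And>x. x \<in> ?S \<Longrightarrow> b < a \<bullet> x"
        using separating_hyperplane_closed_point[OF conv[OF *(2)] closed[OF *(2)] \<open>D z \<notin> ?S\<close>] by blast
      with False have "a \<noteq> 0" by force
      with ab that[of "-a" "-b"] show ?thesis by (simp add: inner_commute)
    qed
    obtain r where "r > 0" "\<And>s. 0 < s \<Longrightarrow> s < r \<Longrightarrow> u z \<le> u (z - s *\<^sub>R e) + m * s"
      using bound[OF *(2) e(1), of m] m by blast
    then have "D z \<bullet> e \<le> m"
      using gradient_le_of_touching[of \<phi> z "D z" u r e m] * by (auto simp: C1_with_gradient_on_def)
    then show False using e by simp
  qed
qed

section \<open>Stability under infima, suprema and convex combinations\<close>

lemma ball_pullback: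
  assumes "r > 0" "(e::'a::real_normed_vector) \<noteq> 0" "0 < s" "s < r / norm e"
  shows "z - s *\<^sub>R e \<in> ball z r"
  using assms by (simp add: dist_norm field_simps)

text \<open>On a backward step each member obeys the same increment bound on the same radius, so the
  bound survives the infimum. Convexity is what allows the resulting increment bound to be read back
  as a subsolution property; without it an infimum of subsolutions can fail.\<close>

lemma subsolution_INF:
  fixes u :: "'i \<Rightarrow> 'a::euclidean_space \<Rightarrow> real"
  assumes "open \<Omega>" and cont: "continuous_on (\<Omega> \<times> UNIV) (\<lambda>(z, q). F z q)"
    and conv: "\<And>z. z \<in> \<Omega> \<Longrightarrow> convex {q. norm q \<le> M \<and> F z q \<le> 0}"
    and lip: "\<And>i. i \<in> I \<Longrightarrow> M-lipschitz_on \<Omega> (u i)"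
    and sub: "\<And>i. i \<in> I \<Longrightarrow> viscosity_subsolution_on \<Omega> F (u i)"
    and "I \<noteq> {}" and bdd: "\<And>z. z \<in> \<Omega> \<Longrightarrow> bdd_below ((\<lambda>i. u i z) ` I)"
  shows "viscosity_subsolution_on \<Omega> F (\<lambda>z. INF i\<in>I. u i z)"
proof (rule subsolution_from_directional_bound[OF conv])
  fix z assume z: "z \<in> \<Omega>"
  have "continuous_on UNIV (F z)"
    using z by (intro continuous_on_compose2[OF cont, of UNIV "\<lambda>q. (z, q)", simplified] continuous_intros) auto
  then show "closed {q. norm q \<le> M \<and> F z q \<le> 0}"
    by (intro closed_Collect_conj closed_Collect_le continuous_intros)
  fix e m assume e: "e \<noteq> 0" and m: "\<And>q. norm q \<le> M \<Longrightarrow> F z q \<le> 0 \<Longrightarrow> q \<bullet> e < m"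
  obtain r where r: "r > 0" "ball z r \<subseteq> \<Omega>"
    "\<And>u a s. \<lbrakk>M-lipschitz_on \<Omega> u; viscosity_subsolution_on \<Omega> F u; 0 < s;
        a \<in> ball z r; a + s *\<^sub>R e \<in> ball z r\<rbrakk> \<Longrightarrow> u (a + s *\<^sub>R e) \<le> u a + m * s"
    using subsolution_directional_bound[OF assms(1) z cont e m] by metis
  show "\<exists>r>0. \<forall>s. 0 < s \<longrightarrow> s < r \<longrightarrow> (INF i\<in>I. u i z) \<le> (INF i\<in>I. u i (z - s *\<^sub>R e)) + m * s"
  proof (intro exI conjI allI impI)
    show "r / norm e > 0" using r e by simp
    fix s assume s: "0 < s" "s < r / norm e"
    have b: "z - s *\<^sub>R e \<in> ball z r" using ball_pullback r e s by blast
    have "(INF i\<in>I. u i z) - m * s \<le> u i (z - s *\<^sub>R e)" if i: "i \<in> I" for i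
    proof -
      have "(INF i\<in>I. u i z) \<le> u i z" using bdd[OF z] i by (rule cINF_lower)
      also have "\<dots> \<le> u i (z - s *\<^sub>R e) + m * s"
        using r(3)[OF lip[OF i] sub[OF i] s(1) b] r(1) by simp
      finally show ?thesis by simp
    qed
    then have "(INF i\<in>I. u i z) - m * s \<le> (INF i\<in>I. u i (z - s *\<^sub>R e))"
      using \<open>I \<noteq> {}\<close> by (intro cINF_greatest)
    then show "(INF i\<in>I. u i z) \<le> (INF i\<in>I. u i (z - s *\<^sub>R e)) + m * s" by simp
  qed
qed

lemma subsolution_SUP:
  fixes u :: "'i \<Rightarrow> 'a::euclidean_space \<Rightarrow> real"
  assumes "open \<Omega>" and cont: "continuous_on (\<Omega> \<times> UNIV) (\<lambda>(z, q). F z q)"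
    and conv: "\<And>z. z \<in> \<Omega> \<Longrightarrow> convex {q. norm q \<le> M \<and> F z q \<le> 0}"
    and lip: "\<And>i. i \<in> I \<Longrightarrow> M-lipschitz_on \<Omega> (u i)"
    and sub: "\<And>i. i \<in> I \<Longrightarrow> viscosity_subsolution_on \<Omega> F (u i)"
    and "I \<noteq> {}" and bdd: "\<And>z. z \<in> \<Omega> \<Longrightarrow> bdd_above ((\<lambda>i. u i z) ` I)"
  shows "viscosity_subsolution_on \<Omega> F (\<lambda>z. SUP i\<in>I. u i z)"
proof (rule subsolution_from_directional_bound[OF conv])
  fix z assume z: "z \<in> \<Omega>"
  have "continuous_on UNIV (F z)"
    using z by (intro continuous_on_compose2[OF cont, of UNIV "\<lambda>q. (z, q)", simplified] continuous_intros) auto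
  then show "closed {q. norm q \<le> M \<and> F z q \<le> 0}"
    by (intro closed_Collect_conj closed_Collect_le continuous_intros)
  fix e m assume e: "e \<noteq> 0" and m: "\<And>q. norm q \<le> M \<Longrightarrow> F z q \<le> 0 \<Longrightarrow> q \<bullet> e < m"
  obtain r where r: "r > 0" "ball z r \<subseteq> \<Omega>"
    "\<And>u a s. \<lbrakk>M-lipschitz_on \<Omega> u; viscosity_subsolution_on \<Omega> F u; 0 < s;
        a \<in> ball z r; a + s *\<^sub>R e \<in> ball z r\<rbrakk> \<Longrightarrow> u (a + s *\<^sub>R e) \<le> u a + m * s"
    using subsolution_directional_bound[OF assms(1) z cont e m] by metis
  show "\<exists>r>0. \<forall>s. 0 < s \<longrightarrow> s < r \<longrightarrow> (SUP i\<in>I. u i z) \<le> (SUP i\<in>I. u i (z - s *\<^sub>R e)) + m * s"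
  proof (intro exI conjI allI impI)
    show "r / norm e > 0" using r e by simp
    fix s assume s: "0 < s" "s < r / norm e"
    have b: "z - s *\<^sub>R e \<in> ball z r" using ball_pullback r e s by blast
    show "(SUP i\<in>I. u i z) \<le> (SUP i\<in>I. u i (z - s *\<^sub>R e)) + m * s"
    proof (rule cSUP_least[OF \<open>I \<noteq> {}\<close>])
      fix i assume i: "i \<in> I"
      have "u i z \<le> u i (z - s *\<^sub>R e) + m * s"
        using r(3)[OF lip[OF i] sub[OF i] s(1) b] r(1) by simp
      also have "u i (z - s *\<^sub>R e) \<le> (SUP i\<in>I. u i (z - s *\<^sub>R e))"
        by (rule cSUP_upper[OF i bdd]) (use b r(2) in blast)
      finally show "u i z \<le> (SUP i\<in>I. u i (z - s *\<^sub>R e)) + m * s" by simp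
    qed
  qed
qed

text \<open>Support functions are additive: the bound \<open>m\<close> for the averaged sublevel
  sets splits as \<theta> m1 + (1 - \<theta>) m2, with m1 and m2 strict bounds for the two sets
  separately. The three Hamiltonians are kept distinct so that two right-hand sides, or two slopes,
  can be averaged along with the functions.\<close>

lemma subsolution_convex_combination:
  fixes u v :: "'a::euclidean_space \<Rightarrow> real"
  assumes "open \<Omega>"
    and cont1: "continuous_on (\<Omega> \<times> UNIV) (\<lambda>(z, q). F1 z q)"
    and cont2: "continuous_on (\<Omega> \<times> UNIV) (\<lambda>(z, q). F2 z q)"
    and conv: "\<And>z. z \<in> \<Omega> \<Longrightarrow> convex {q. norm q \<le> M \<and> F z q \<le> 0}"
    and closed: "\<And>z. z \<in> \<Omega> \<Longrightarrow> closed {q. norm q \<le> M \<and> F z q \<le> 0}"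
    and lip: "M-lipschitz_on \<Omega> u" "M-lipschitz_on \<Omega> v"
    and sub: "viscosity_subsolution_on \<Omega> F1 u" "viscosity_subsolution_on \<Omega> F2 v"
    and \<theta>: "0 < \<theta>" "\<theta> < 1"
    and comb: "\<And>z p q. z \<in> \<Omega> \<Longrightarrow> F1 z p \<le> 0 \<Longrightarrow> F2 z q \<le> 0 \<Longrightarrow> F z (\<theta> *\<^sub>R p + (1 - \<theta>) *\<^sub>R q) \<le> 0"
  shows "viscosity_subsolution_on \<Omega> F (\<lambda>z. \<theta> * u z + (1 - \<theta>) * v z)"
proof (rule subsolution_from_directional_bound[OF conv closed])
  fix z e m
  assume z: "z \<in> \<Omega>" and e: "e \<noteq> 0" and m: "\<And>q. norm q \<le> M \<Longrightarrow> F z q \<le> 0 \<Longrightarrow> q \<bullet> e < m"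
  have "M \<ge> 0" using lip by (simp add: lipschitz_on_def)
  define S where "S G = {q. norm q \<le> M \<and> G z q \<le> 0}" for G :: "'a \<Rightarrow> 'a \<Rightarrow> real"
  have compactS: "compact (S G)" if "continuous_on (\<Omega> \<times> UNIV) (\<lambda>(z, q). G z q)" for G
  proof -
    have "continuous_on UNIV (G z)"
      using z by (intro continuous_on_compose2[OF that, of UNIV "\<lambda>q. (z, q)", simplified] continuous_intros) auto
    then have "compact (cball 0 M \<inter> {q. G z q \<le> 0})"
      by (intro compact_Int_closed closed_Collect_le continuous_intros compact_cball)
    also have "cball 0 M \<inter> {q. G z q \<le> 0} = S G" by (auto simp: S_def)
    finally show ?thesis .
  qed
  have comb': "\<theta> * (p \<bullet> e) + (1 - \<theta>) * (q \<bullet> e) < m" if "p \<in> S F1" "q \<in> S F2" for p q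
  proof -
    have "norm (\<theta> *\<^sub>R p + (1 - \<theta>) *\<^sub>R q) \<le> \<theta> * norm p + (1 - \<theta>) * norm q"
      using \<theta> by (intro norm_triangle_le) auto
    also have "\<dots> \<le> \<theta> * M + (1 - \<theta>) * M"
      using that \<theta> by (intro add_mono mult_left_mono) (auto simp: S_def)
    finally have "norm (\<theta> *\<^sub>R p + (1 - \<theta>) *\<^sub>R q) \<le> M" by (simp add: algebra_simps)
    moreover have "F z (\<theta> *\<^sub>R p + (1 - \<theta>) *\<^sub>R q) \<le> 0" using comb[OF z] that by (auto simp: S_def)
    ultimately have "(\<theta> *\<^sub>R p + (1 - \<theta>) *\<^sub>R q) \<bullet> e < m" by (rule m)
    then show ?thesis by (simp add: inner_add_left)
  qed
  \<comment> \<open>If both sets are nonempty, \<open>m2\<close> exceeds the maximum over the second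
    set by \<open>g\<close>, half the slack at the two maximisers. If the first is empty,
    \<open>m2\<close> may be taken large; if the second is empty, it is taken low enough to leave
    room for the maximum over the first.\<close>
  obtain m2 where m2: "\<And>q. q \<in> S F2 \<Longrightarrow> q \<bullet> e < m2"
    and m2': "\<And>p. p \<in> S F1 \<Longrightarrow> \<theta> * (p \<bullet> e) + (1 - \<theta>) * m2 < m"
  proof (cases "S F1 = {}")
    case True
    have "bounded ((\<lambda>q. q \<bullet> e) ` S F2)"
      by (intro compact_imp_bounded compact_continuous_image compactS cont2 continuous_intros)
    then obtain B where "\<And>q. q \<in> S F2 \<Longrightarrow> q \<bullet> e \<le> B"
      unfolding bounded_iff by (metis abs_le_D1 image_eqI real_norm_def)
    with True that[of "B + 1"] show ?thesis by (metis add.commute empty_iff less_add_one order_le_less_trans)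
  next
    case False
    obtain p where p: "p \<in> S F1" "\<And>p'. p' \<in> S F1 \<Longrightarrow> p' \<bullet> e \<le> p \<bullet> e"
      using continuous_attains_sup[OF compactS[OF cont1] False, of "\<lambda>q. q \<bullet> e"]
      by (force intro: continuous_intros)
    show ?thesis
    proof (cases "S F2 = {}")
      case True
      have "\<theta> * (p' \<bullet> e) + (1 - \<theta>) * ((m - \<theta> * (p \<bullet> e)) / (1 - \<theta>) - 1) < m" if "p' \<in> S F1" for p'
      proof -
        have "(1 - \<theta>) * ((m - \<theta> * (p \<bullet> e)) / (1 - \<theta>) - 1) = m - \<theta> * (p \<bullet> e) - (1 - \<theta>)"
          unfolding right_diff_distrib[of "1 - \<theta>" _ 1] using \<theta> by simp
        moreover have "\<theta> * (p' \<bullet> e) \<le> \<theta> * (p \<bullet> e)" using p(2)[OF that] \<theta> by simp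
        ultimately show ?thesis using \<theta> by linarith
      qed
      with True that show ?thesis by blast
    next
      case False
      obtain q where q: "q \<in> S F2" "\<And>q'. q' \<in> S F2 \<Longrightarrow> q' \<bullet> e \<le> q \<bullet> e"
        using continuous_attains_sup[OF compactS[OF cont2] False, of "\<lambda>q. q \<bullet> e"]
        by (force intro: continuous_intros)
      define g where "g = (m - (\<theta> * (p \<bullet> e) + (1 - \<theta>) * (q \<bullet> e))) / 2"
      have g: "g > 0" using comb'[OF p(1) q(1)] by (simp add: g_def)
      show ?thesis
      proof (rule that[of "q \<bullet> e + g"])
        fix q' assume "q' \<in> S F2" then show "q' \<bullet> e < q \<bullet> e + g" using q g by fastforce
      next
        fix p' assume "p' \<in> S F1"
        then have "\<theta> * (p' \<bullet> e) \<le> \<theta> * (p \<bullet> e)" using p \<theta> by simp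
        moreover have "(1 - \<theta>) * g \<le> g" using \<theta> g by (simp add: algebra_simps)
        moreover have "2 * g = m - (\<theta> * (p \<bullet> e) + (1 - \<theta>) * (q \<bullet> e))" by (simp add: g_def)
        ultimately show "\<theta> * (p' \<bullet> e) + (1 - \<theta>) * (q \<bullet> e + g) < m"
          using g unfolding distrib_left by linarith
      qed
    qed
  qed
  define m1 where "m1 = (m - (1 - \<theta>) * m2) / \<theta>"
  have mm: "\<theta> * m1 + (1 - \<theta>) * m2 = m" using \<theta> by (simp add: m1_def)
  have m1: "p \<bullet> e < m1" if "p \<in> S F1" for p
    using m2'[OF that] \<theta> by (simp add: m1_def field_simps)
  obtain r1 where r1: "r1 > 0" "ball z r1 \<subseteq> \<Omega>"
    "\<And>u a s. \<lbrakk>M-lipschitz_on \<Omega> u; viscosity_subsolution_on \<Omega> F1 u; 0 < s;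
        a \<in> ball z r1; a + s *\<^sub>R e \<in> ball z r1\<rbrakk> \<Longrightarrow> u (a + s *\<^sub>R e) \<le> u a + m1 * s"
    using subsolution_directional_bound[OF assms(1) z cont1 e, of M m1] m1 unfolding S_def by auto
  obtain r2 where r2: "r2 > 0" "ball z r2 \<subseteq> \<Omega>"
    "\<And>u a s. \<lbrakk>M-lipschitz_on \<Omega> u; viscosity_subsolution_on \<Omega> F2 u; 0 < s;
        a \<in> ball z r2; a + s *\<^sub>R e \<in> ball z r2\<rbrakk> \<Longrightarrow> u (a + s *\<^sub>R e) \<le> u a + m2 * s"
    using subsolution_directional_bound[OF assms(1) z cont2 e, of M m2] m2 unfolding S_def by auto
  define r where "r = min r1 r2"
  have r: "r > 0" using r1 r2 by (simp add: r_def)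
  show "\<exists>r>0. \<forall>s. 0 < s \<longrightarrow> s < r \<longrightarrow>
    \<theta> * u z + (1 - \<theta>) * v z \<le> \<theta> * u (z - s *\<^sub>R e) + (1 - \<theta>) * v (z - s *\<^sub>R e) + m * s"
  proof (intro exI conjI allI impI)
    show "r / norm e > 0" using r e by simp
    fix s assume s: "0 < s" "s < r / norm e"
    have b: "z - s *\<^sub>R e \<in> ball z r" using ball_pullback r e s by blast
    have "u z \<le> u (z - s *\<^sub>R e) + m1 * s"
      using r1(3)[OF lip(1) sub(1) s(1), of "z - s *\<^sub>R e"] b r1(1) by (simp add: r_def)
    moreover have "v z \<le> v (z - s *\<^sub>R e) + m2 * s"
      using r2(3)[OF lip(2) sub(2) s(1), of "z - s *\<^sub>R e"] b r2(1) by (simp add: r_def)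
    ultimately have "\<theta> * u z + (1 - \<theta>) * v z \<le>
        \<theta> * (u (z - s *\<^sub>R e) + m1 * s) + (1 - \<theta>) * (v (z - s *\<^sub>R e) + m2 * s)"
      using \<theta> by (intro add_mono mult_left_mono) auto
    also have "\<dots> = \<theta> * u (z - s *\<^sub>R e) + (1 - \<theta>) * v (z - s *\<^sub>R e) + (\<theta> * m1 + (1 - \<theta>) * m2) * s"
      by (simp add: algebra_simps)
    finally show "\<theta> * u z + (1 - \<theta>) * v z \<le> \<theta> * u (z - s *\<^sub>R e) + (1 - \<theta>) * v (z - s *\<^sub>R e) + m * s"
      by (simp add: mm)
  qed
qed

section \<open>Comparison for the Cauchy problem\<close>

lemma viscosity_supersolution_onD:
  assumes "viscosity_supersolution_on \<Omega> F u" "C1_with_gradient_on \<Omega> \<phi> D" "z \<in> \<Omega>"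
    "\<forall>\<^sub>F w in nhds z. u w - \<phi> w \<ge> u z - \<phi> z"
  shows "F z (D z) \<ge> 0"
  using assms unfolding viscosity_supersolution_on_def by blast

text \<open>Doubling of variables. The quadratic penalty in time with a coefficient fixed in advance bounds
  the difference of two functions of linear growth, so that the gradient of the spatial penalty
  tends to zero with its coefficient.\<close>

theorem Cauchy_comparison:
  fixes G :: "'a::euclidean_space \<Rightarrow> 'a \<Rightarrow> real" and w u :: "'a \<times> real \<Rightarrow> real"
  assumes G: "\<And>R. uniformly_continuous_on (UNIV \<times> cball 0 R) (\<lambda>(x, q). G x q)"
    and lipw: "M-lipschitz_on (UNIV \<times> {0..}) w" and lipu: "M-lipschitz_on (UNIV \<times> {0..}) u"
    and sub: "viscosity_subsolution_on (UNIV \<times> {0<..}) (\<lambda>(x, t) (q, \<tau>). \<tau> + G x q) w"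
    and super: "viscosity_supersolution_on (UNIV \<times> {0<..}) (\<lambda>(x, t) (q, \<tau>). \<tau> + G x q) u"
    and init: "\<And>x. w (x, 0) \<le> u (x, 0)"
    and "0 \<le> t"
  shows "w (x, t) \<le> u (x, t)"
proof (rule ccontr)
  assume neg: "\<not> w (x, t) \<le> u (x, t)"
  define X T where "X = x" and "T = t"
  \<comment> \<open>Of the excess 3\<sigma> at \<open>(X, T)\<close> the penalties in time and in
    space take at most \<sigma>/2 each. The 2\<sigma> left over must beat the error below \<sigma>
    made by identifying the two doubled points.\<close>
  define \<sigma> where "\<sigma> = (w (X, T) - u (X, T)) / 3"
  have \<sigma>: "\<sigma> > 0" "w (X, T) - u (X, T) = 3 * \<sigma>" and T: "T \<ge> 0"
    using neg \<open>0 \<le> t\<close> by (auto simp: \<sigma>_def X_def T_def)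
  have M: "M \<ge> 0" using lipw by (simp add: lipschitz_on_def)
  \<comment> \<open>\<open>l\<close> multiplies \<open>t + t\<^sup>2\<close>: the linear term makes
    the subsolution inequality strict by \<open>l\<close>, and the square absorbs the linear growth
    of the difference in time.\<close>
  define l where "l = \<sigma> / (2 * (T + T\<^sup>2 + 1))"
  have TT: "T + T\<^sup>2 + 1 > 0" using T by (simp add: add_nonneg_pos)
  have l: "l > 0" using \<sigma> TT by (simp add: l_def)
  have lT: "l * (T + T\<^sup>2) \<le> \<sigma> / 2"
    using \<sigma> TT T by (simp add: l_def field_simps)
  obtain \<rho> where \<rho>: "\<rho> > 0" "\<And>a b. a \<in> UNIV \<times> cball 0 (2 * M + 1) \<Longrightarrow> b \<in> UNIV \<times> cball 0 (2 * M + 1) \<Longrightarrow>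
      dist b a < \<rho> \<Longrightarrow> dist (case b of (x, q) \<Rightarrow> G x q) (case a of (x, q) \<Rightarrow> G x q) < l"
    using G[of "2 * M + 1"] l unfolding uniformly_continuous_on_def by metis
  \<comment> \<open>\<open>A\<close> bounds the penalised difference independently of \<kappa> and
    of \<delta> \<le> 1, so \<kappa> may be chosen after it. At the maximum \<kappa>|x|^2 \<le> A,
    and the penalty gradient then satisfies |2\<kappa>x|^2 \<le> 4\<kappa>A < c^2.\<close>
  define A where "A = 2 * M\<^sup>2 / l + M\<^sup>2"
  have A: "A \<ge> 0" using l by (simp add: A_def)
  define c where "c = min (\<rho> / 2) 1"
  have c: "c > 0" "c \<le> \<rho> / 2" "c \<le> 1" using \<rho> by (auto simp: c_def)
  define \<kappa> where "\<kappa> = min (\<sigma> / (2 * ((norm X)\<^sup>2 + 1))) (c\<^sup>2 / (8 * (A + 1)))"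
  have X1: "(norm X)\<^sup>2 + 1 > 0" by (simp add: add_nonneg_pos)
  have \<kappa>: "\<kappa> > 0" using \<sigma> c A X1 by (simp add: \<kappa>_def)
  have "\<kappa> * (norm X)\<^sup>2 \<le> \<sigma> / (2 * ((norm X)\<^sup>2 + 1)) * (norm X)\<^sup>2"
    by (intro mult_right_mono) (auto simp: \<kappa>_def)
  also have "\<dots> \<le> \<sigma> / 2" using \<sigma> X1 by (simp add: field_simps)
  finally have \<kappa>X: "\<kappa> * (norm X)\<^sup>2 \<le> \<sigma> / 2" .
  have "4 * \<kappa> * A \<le> 4 * (c\<^sup>2 / (8 * (A + 1))) * A"
    using A by (intro mult_right_mono mult_left_mono) (auto simp: \<kappa>_def)
  also have "\<dots> < c\<^sup>2" using A c by (simp add: field_simps add_pos_nonneg)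
  finally have \<kappa>A: "4 * \<kappa> * A < c\<^sup>2" .
  \<comment> \<open>The doubled points will be at most 2M\<delta> apart. This \<delta> makes that
    distance smaller than \<open>c\<close>, and makes the resulting change of \<open>u\<close> or
    \<open>w\<close>, at most 2M^2\<delta>, smaller than \<sigma>.\<close>
  define \<delta> where "\<delta> = min 1 (min (c / (2 * (2 * M + 1))) (\<sigma> / (2 * (2 * M\<^sup>2 + 1))))"
  have M1: "2 * M + 1 > 0" "2 * M\<^sup>2 + 1 > 0" using M by (auto simp: add_nonneg_pos)
  have \<delta>: "\<delta> > 0" "\<delta> \<le> 1" using \<sigma> c M1 by (auto simp: \<delta>_def)
  then have \<delta>2: "2 * \<delta> \<noteq> 0" by simp
  then have \<delta>2: "2 * \<delta> \<noteq> 0" by simp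
  have "2 * M * \<delta> \<le> (2 * M + 1) * (c / (2 * (2 * M + 1)))"
    using M \<delta> by (intro mult_mono) (auto simp: \<delta>_def)
  also have "\<dots> < c" using c M M1 by (simp add: field_simps add_pos_nonneg)
  finally have \<delta>M: "2 * M * \<delta> < c" .
  have "2 * M\<^sup>2 * \<delta> \<le> (2 * M\<^sup>2 + 1) * (\<sigma> / (2 * (2 * M\<^sup>2 + 1)))"
    using M \<delta> by (intro mult_mono) (auto simp: \<delta>_def)
  also have "\<dots> < \<sigma>" using \<sigma> M M1 by (simp add: field_simps add_pos_nonneg)
  finally have \<delta>\<sigma>: "2 * M\<^sup>2 * \<delta> < \<sigma>" .
  let ?S = "UNIV \<times> {0..} :: ('a \<times> real) set"
  have w_le: "w a \<le> w b + M * norm (a - b)" if "a \<in> ?S" "b \<in> ?S" for a b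
    using lipschitz_onD[OF lipw that] by (simp add: dist_real_def dist_norm abs_le_iff)
  have u_le: "u a \<le> u b + M * norm (a - b)" if "a \<in> ?S" "b \<in> ?S" for a b
    using lipschitz_onD[OF lipu that] by (simp add: dist_real_def dist_norm abs_le_iff)
  define \<Phi> where "\<Phi> a = w (fst a) - u (snd a) - (norm (fst a - snd a))\<^sup>2 / (2 * \<delta>)
      - l * (snd (fst a) + (snd (fst a))\<^sup>2) - \<kappa> * (norm (fst (fst a)))\<^sup>2"
    for a :: "('a \<times> real) \<times> ('a \<times> real)"
  have \<Phi>0: "\<Phi> ((X, T), (X, T)) \<ge> 2 * \<sigma>" using \<sigma> lT \<kappa>X by (simp add: \<Phi>_def)
  have \<Phi>b: "\<Phi> (z, z') \<le> A - l * (snd z)\<^sup>2 / 2 - (norm (z - z'))\<^sup>2 / (4 * \<delta>) - \<kappa> * (norm (fst z))\<^sup>2"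
    if z: "z \<in> ?S" "z' \<in> ?S" for z z'
  proof -
    obtain x t where [simp]: "z = (x, t)" by (cases z)
    have t: "t \<ge> 0" using z by simp
    have "w (x, t) \<le> w (x, 0) + M * t"
      using w_le[of "(x, t)" "(x, 0)"] t by (simp add: norm_Pair)
    moreover have "u (x, 0) \<le> u (x, t) + M * t"
      using u_le[of "(x, 0)" "(x, t)"] t by (simp add: norm_Pair)
    moreover have "u (x, t) \<le> u z' + M * norm (z - z')" using u_le[of z z'] z by simp
    ultimately have "w z - u z' \<le> 2 * M * t + M * norm (z - z')" using init[of x] by simp
    moreover have "2 * M * t \<le> 2 * M\<^sup>2 / l + l * t\<^sup>2 / 2"
    proof -
      have "0 \<le> (l / 2) * (t - 2 * M / l)\<^sup>2" using l by simp
      also have "\<dots> = l * t\<^sup>2 / 2 - 2 * M * t + 2 * M\<^sup>2 / l"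
        using l by (simp add: power2_eq_square field_simps)
      finally show ?thesis by simp
    qed
    moreover have "M * norm (z - z') \<le> M\<^sup>2 + (norm (z - z'))\<^sup>2 / (4 * \<delta>)"
    proof -
      have "0 \<le> (norm (z - z') - 2 * M * \<delta>)\<^sup>2 / (4 * \<delta>)" using \<delta> by simp
      also have "\<dots> = (norm (z - z'))\<^sup>2 / (4 * \<delta>) - M * norm (z - z') + M\<^sup>2 * \<delta>"
        using \<delta> by (simp add: power2_eq_square field_simps)
      also have "M\<^sup>2 * \<delta> \<le> M\<^sup>2" using \<delta> by (simp add: mult_left_le)
      finally show ?thesis by simp
    qed
    moreover have "(norm (z - z'))\<^sup>2 / (2 * \<delta>) = (norm (z - z'))\<^sup>2 / (4 * \<delta>) + (norm (z - z'))\<^sup>2 / (4 * \<delta>)"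
      using \<delta> by (simp add: field_simps)
    moreover have "l * t \<ge> 0" using l t by simp
    ultimately show ?thesis by (simp add: \<Phi>_def A_def distrib_left)
  qed
  \<comment> \<open>Where \<open>\<Phi>\<close> is nonnegative, each of the three subtracted terms
    in \<open>\<Phi>b\<close> is at most \<open>A\<close>. The three square roots bound position,
    time and separation, so the supremum can be sought on a compact set.\<close>
  define R where "R = sqrt (A / \<kappa>) + sqrt (2 * A / l) + sqrt (4 * \<delta> * A)"
  define K where "K = (cball 0 R \<times> cball 0 R) \<inter> (?S \<times> ?S)"
  have inK: "(z, z') \<in> K" if z: "z \<in> ?S" "z' \<in> ?S" and nn: "\<Phi> (z, z') \<ge> 0" for z z'
  proof -
    have ge: "0 \<le> l * (snd z)\<^sup>2 / 2" "0 \<le> (norm (z - z'))\<^sup>2 / (4 * \<delta>)" "0 \<le> \<kappa> * (norm (fst z))\<^sup>2"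
      using l \<delta> \<kappa> by auto
    have "\<kappa> * (norm (fst z))\<^sup>2 \<le> A" "l * (snd z)\<^sup>2 / 2 \<le> A" "(norm (z - z'))\<^sup>2 / (4 * \<delta>) \<le> A"
      using ge \<Phi>b[OF z] nn by linarith+
    then have "(norm (fst z))\<^sup>2 \<le> A / \<kappa>" "(snd z)\<^sup>2 \<le> 2 * A / l" "(norm (z - z'))\<^sup>2 \<le> 4 * \<delta> * A"
      using l \<delta> \<kappa> by (auto simp: field_simps)
    then have *: "norm (fst z) \<le> sqrt (A / \<kappa>)" "\<bar>snd z\<bar> \<le> sqrt (2 * A / l)" "norm (z - z') \<le> sqrt (4 * \<delta> * A)"
      by (auto intro: real_le_rsqrt)
    have "norm z \<le> norm (fst z) + \<bar>snd z\<bar>"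
      using norm_Pair_le[of "fst z" "snd z"] by simp
    moreover have "norm z' \<le> norm z + norm (z - z')"
      using norm_triangle_ineq4[of z "z - z'"] by simp
    moreover have "0 \<le> sqrt (4 * \<delta> * A)" using \<delta> A by simp
    ultimately have "norm z \<le> R" "norm z' \<le> R" using * unfolding R_def by linarith+
    then show ?thesis using z by (simp add: K_def)
  qed
  have "closed ?S" by (intro closed_Times) auto
  then have "compact K" unfolding K_def
    by (intro compact_Int_closed compact_Times compact_cball closed_Times closed_UNIV closed_atLeast)
  have cw: "continuous_on ?S w" "continuous_on ?S u"
    using lipw lipu lipschitz_on_continuous_on by blast+
  have "continuous_on K \<Phi>"
    unfolding \<Phi>_def
    by (intro continuous_intros continuous_on_compose2[OF cw(1)] continuous_on_compose2[OF cw(2)])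
       (use \<delta> in \<open>auto simp: K_def\<close>)
  moreover have "((X, T), (X, T)) \<in> K" using \<Phi>0 \<sigma> T by (intro inK) auto
  ultimately obtain a where a: "a \<in> K" "\<And>b. b \<in> K \<Longrightarrow> \<Phi> b \<le> \<Phi> a"
    using continuous_attains_sup[OF \<open>compact K\<close>] by blast
  obtain x t x' t' where a_eq: "a = ((x, t), (x', t'))" by (metis surj_pair)
  define z z' where "z = (x, t)" and "z' = (x', t')"
  have zS: "z \<in> ?S" "z' \<in> ?S" using a by (auto simp: K_def a_eq z_def z'_def)
  have max: "\<Phi> b \<le> \<Phi> (z, z')" if "b \<in> ?S \<times> ?S" for b
  proof (cases "\<Phi> b \<ge> 0")
    case True
    then show ?thesis using inK[of "fst b" "snd b"] that a(2) by (auto simp: a_eq z_def z'_def)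
  next
    case False
    have "0 \<le> \<Phi> (z, z')"
      using a(2)[OF \<open>((X, T), (X, T)) \<in> K\<close>] \<Phi>0 \<sigma> by (simp add: a_eq z_def z'_def)
    then show ?thesis using False by simp
  qed
  have big: "\<Phi> (z, z') \<ge> 2 * \<sigma>" using max[of "((X, T), (X, T))"] \<Phi>0 T by simp
  have t: "0 \<le> t" "0 \<le> t'" using zS by (auto simp: z_def z'_def)
  have nonneg: "0 \<le> l * (t + t\<^sup>2)" "0 \<le> \<kappa> * (norm x)\<^sup>2" "0 \<le> (norm (z - z'))\<^sup>2 / (2 * \<delta>)"
    using l \<kappa> \<delta> t by auto
  \<comment> \<open>Comparing the maximum with the diagonal pair \<open>(z, z)\<close> cancels every
    term except the coupling penalty and an increment of \<open>u\<close>, so a quadratic is bounded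
    by a linear term.\<close>
  have d: "norm (z - z') \<le> 2 * M * \<delta>"
  proof -
    have "(norm (z - z'))\<^sup>2 / (2 * \<delta>) \<le> u z - u z'"
      using max[of "(z, z)"] zS by (simp add: \<Phi>_def)
    also have "\<dots> \<le> M * norm (z - z')" using u_le[OF zS] by simp
    finally have "norm (z - z') * norm (z - z') \<le> norm (z - z') * (2 * M * \<delta>)"
      using \<delta> by (simp add: power2_eq_square field_simps)
    then show ?thesis using M \<delta> by (cases "norm (z - z') = 0") auto
  qed
  then have "M * norm (z - z') \<le> M * (2 * M * \<delta>)" using M by (rule mult_left_mono)
  then have Md: "M * norm (z - z') < \<sigma>" using \<delta>\<sigma> by (simp add: power2_eq_square mult_ac)
  have \<Phi>wu: "\<Phi> (z, z') \<le> w z - u z'" using nonneg by (simp add: \<Phi>_def z_def)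
  \<comment> \<open>If either point were at time zero, the initial inequality would leave a
    difference of at most \<open>M * norm (z - z')\<close>, which is less than \<sigma>, against the
    2\<sigma> retained at the maximum.\<close>
  have "t \<noteq> 0"
  proof
    assume "t = 0"
    then have "w z \<le> u z" using init by (simp add: z_def)
    then show False using \<Phi>wu u_le[OF zS] Md big \<sigma> by linarith
  qed
  moreover have "t' \<noteq> 0"
  proof
    assume "t' = 0"
    then have "w z' \<le> u z'" using init by (simp add: z'_def)
    then show False using \<Phi>wu w_le[OF zS] Md big \<sigma> by linarith
  qed
  ultimately have tpos: "t > 0" "t' > 0" using t by auto
  let ?\<Omega> = "UNIV \<times> {0<..} :: ('a \<times> real) set"
  have open\<Omega>: "open ?\<Omega>" by (intro open_Times) auto
  have ev\<Omega>: "\<forall>\<^sub>F y in nhds z. y \<in> ?\<Omega>" "\<forall>\<^sub>F y in nhds z'. y \<in> ?\<Omega>"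
    using tpos by (auto intro!: eventually_nhds_in_open[OF open\<Omega>] simp: z_def z'_def)
  define \<phi> where "\<phi> y = (y - z') \<bullet> (y - z') / (2 * \<delta>) + l * (snd y + (snd y)\<^sup>2) + \<kappa> * (fst y \<bullet> fst y)" for y
  define D\<phi> where "D\<phi> y = (1 / \<delta>) *\<^sub>R (y - z') + ((2 * \<kappa>) *\<^sub>R fst y, l * (1 + 2 * snd y))" for y
  have "GDERIV \<phi> y :> D\<phi> y" for y
    unfolding gderiv_def \<phi>_def D\<phi>_def
    apply (rule derivative_eq_intros refl \<delta>2)+
    apply (rule ext)
    using \<delta> by (auto simp: inner_prod_def inner_simps inner_commute field_simps)
  moreover have "continuous_on ?\<Omega> D\<phi>" unfolding D\<phi>_def by (intro continuous_intros)
  ultimately have "C1_with_gradient_on ?\<Omega> \<phi> D\<phi>" by (simp add: C1_with_gradient_on_def)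
  moreover have "z \<in> ?\<Omega>" using tpos by (simp add: z_def)
  moreover have "\<forall>\<^sub>F y in nhds z. w y - \<phi> y \<le> w z - \<phi> z"
    using ev\<Omega>(1)
  proof eventually_elim
    case (elim y)
    then have "\<Phi> (y, z') \<le> \<Phi> (z, z')" using zS by (intro max) auto
    then show ?case by (simp add: \<Phi>_def \<phi>_def power2_norm_eq_inner)
  qed
  ultimately have "(case z of (x, t) \<Rightarrow> \<lambda>(q, \<tau>). \<tau> + G x q) (D\<phi> z) \<le> 0"
    using viscosity_subsolution_onD[OF sub] by blast
  then have sub_ineq: "(t - t') / \<delta> + l * (1 + 2 * t) + G x ((1 / \<delta>) *\<^sub>R (x - x') + (2 * \<kappa>) *\<^sub>R x) \<le> 0"
    by (simp add: D\<phi>_def z_def z'_def)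
  define \<psi> where "\<psi> y = - ((y - z) \<bullet> (y - z) / (2 * \<delta>))" for y
  define D\<psi> where "D\<psi> y = (1 / \<delta>) *\<^sub>R (z - y)" for y
  have "GDERIV \<psi> y :> D\<psi> y" for y
    unfolding gderiv_def \<psi>_def D\<psi>_def
    apply (rule derivative_eq_intros refl \<delta>2)+
    apply (rule ext)
    using \<delta> by (auto simp: inner_simps inner_commute field_simps)
  moreover have "continuous_on ?\<Omega> D\<psi>" unfolding D\<psi>_def by (intro continuous_intros)
  ultimately have "C1_with_gradient_on ?\<Omega> \<psi> D\<psi>" by (simp add: C1_with_gradient_on_def)
  moreover have "z' \<in> ?\<Omega>" using tpos by (simp add: z'_def)
  moreover have "\<forall>\<^sub>F y in nhds z'. u y - \<psi> y \<ge> u z' - \<psi> z'"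
    using ev\<Omega>(2)
  proof eventually_elim
    case (elim y)
    then have "\<Phi> (z, y) \<le> \<Phi> (z, z')" using zS by (intro max) auto
    then show ?case by (simp add: \<Phi>_def \<psi>_def power2_norm_eq_inner inner_diff inner_commute algebra_simps)
  qed
  ultimately have "(case z' of (x, t) \<Rightarrow> \<lambda>(q, \<tau>). \<tau> + G x q) (D\<psi> z') \<ge> 0"
    using viscosity_supersolution_onD[OF super] by blast
  then have super_ineq: "(t - t') / \<delta> + G x' ((1 / \<delta>) *\<^sub>R (x - x')) \<ge> 0"
    by (simp add: D\<psi>_def z_def z'_def)
  have lt: "l * t > 0" using l tpos by simp
  have nx: "norm (x - x') \<le> 2 * M * \<delta>"
    using d norm_fst_le[of "x - x'" "t - t'"] by (simp add: z_def z'_def)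
  then have np: "norm ((1 / \<delta>) *\<^sub>R (x - x')) \<le> 2 * M"
    using \<delta> by (simp add: pos_divide_le_eq mult_ac del: scaleR_right_diff_distrib)
  have "\<kappa> * (norm x)\<^sup>2 \<le> A"
  proof -
    have "0 \<le> l * t\<^sup>2 / 2" "0 \<le> (norm (z - z'))\<^sup>2 / (4 * \<delta>)" using l \<delta> by auto
    then show ?thesis using \<Phi>b[OF zS] big \<sigma> by (simp add: z_def)
  qed
  then have "4 * \<kappa> * (\<kappa> * (norm x)\<^sup>2) \<le> 4 * \<kappa> * A" using \<kappa> by (intro mult_left_mono) auto
  then have "(norm ((2 * \<kappa>) *\<^sub>R x))\<^sup>2 < c\<^sup>2"
    using \<kappa>A by (simp add: power_mult_distrib power2_eq_square mult_ac)
  then have nk: "norm ((2 * \<kappa>) *\<^sub>R x) < c" using c by (simp add: power2_less_imp_less)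
  \<comment> \<open>The arguments of \<open>G\<close> in the two inequalities differ by the small
    distance between the points and by the gradient of the spatial penalty. Uniform continuity makes
    the change of \<open>G\<close> less than \<open>l\<close>, whereas subtracting the inequalities
    would require at least \<open>l\<close>.\<close>
  have "dist (case (x, (1 / \<delta>) *\<^sub>R (x - x') + (2 * \<kappa>) *\<^sub>R x) of (x, q) \<Rightarrow> G x q)
             (case (x', (1 / \<delta>) *\<^sub>R (x - x')) of (x, q) \<Rightarrow> G x q) < l"
  proof (rule \<rho>(2))
    show "(x', (1 / \<delta>) *\<^sub>R (x - x')) \<in> UNIV \<times> cball 0 (2 * M + 1)" using np by simp
    show "(x, (1 / \<delta>) *\<^sub>R (x - x') + (2 * \<kappa>) *\<^sub>R x) \<in> UNIV \<times> cball 0 (2 * M + 1)"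
      using norm_triangle_ineq[of "(1 / \<delta>) *\<^sub>R (x - x')" "(2 * \<kappa>) *\<^sub>R x"] np nk c by simp
    have "dist (x, (1 / \<delta>) *\<^sub>R (x - x') + (2 * \<kappa>) *\<^sub>R x) (x', (1 / \<delta>) *\<^sub>R (x - x'))
        \<le> norm (x - x') + norm ((2 * \<kappa>) *\<^sub>R x)"
      using norm_Pair_le[of "x - x'" "(2 * \<kappa>) *\<^sub>R x"] by (simp add: dist_norm)
    then show "dist (x, (1 / \<delta>) *\<^sub>R (x - x') + (2 * \<kappa>) *\<^sub>R x) (x', (1 / \<delta>) *\<^sub>R (x - x')) < \<rho>"
      using nx nk \<delta>M c by linarith
  qed
  then have "G x' ((1 / \<delta>) *\<^sub>R (x - x')) - G x ((1 / \<delta>) *\<^sub>R (x - x') + (2 * \<kappa>) *\<^sub>R x) < l"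
    by (simp only: dist_real_def prod.case abs_less_iff) linarith
  then show False using sub_ineq super_ineq lt by (simp add: distrib_left)
qed

section \<open>Periodic subsolutions and the critical value\<close>

lemma lipschitz_on_INF:
  fixes u :: "'i \<Rightarrow> 'a::metric_space \<Rightarrow> real"
  assumes lip: "\<And>i. i \<in> I \<Longrightarrow> M-lipschitz_on S (u i)" and "I \<noteq> {}"
    and bdd: "\<And>z. z \<in> S \<Longrightarrow> bdd_below ((\<lambda>i. u i z) ` I)"
  shows "M-lipschitz_on S (\<lambda>z. INF i\<in>I. u i z)"
proof (rule lipschitz_onI)
  show "0 \<le> M" using lip \<open>I \<noteq> {}\<close> by (auto simp: lipschitz_on_def)
  have *: "(INF i\<in>I. u i x) \<le> (INF i\<in>I. u i y) + M * dist x y" if xy: "x \<in> S" "y \<in> S" for x y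
  proof -
    have "(INF i\<in>I. u i x) - M * dist x y \<le> u i y" if i: "i \<in> I" for i
    proof -
      have "(INF i\<in>I. u i x) \<le> u i x" using bdd[OF xy(1)] i by (rule cINF_lower)
      also have "\<dots> \<le> u i y + M * dist x y"
        using lipschitz_onD[OF lip[OF i] xy] by (simp add: dist_real_def abs_le_iff)
      finally show ?thesis by simp
    qed
    then have "(INF i\<in>I. u i x) - M * dist x y \<le> (INF i\<in>I. u i y)"
      using \<open>I \<noteq> {}\<close> by (intro cINF_greatest)
    then show ?thesis by simp
  qed
  show "dist (INF i\<in>I. u i x) (INF i\<in>I. u i y) \<le> M * dist x y" if "x \<in> S" "y \<in> S" for x y
    using *[OF that] *[OF that(2,1)] by (simp add: dist_real_def abs_le_iff dist_commute)
qed

lemma lipschitz_on_SUP: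
  fixes u :: "'i \<Rightarrow> 'a::metric_space \<Rightarrow> real"
  assumes lip: "\<And>i. i \<in> I \<Longrightarrow> M-lipschitz_on S (u i)" and "I \<noteq> {}"
    and bdd: "\<And>z. z \<in> S \<Longrightarrow> bdd_above ((\<lambda>i. u i z) ` I)"
  shows "M-lipschitz_on S (\<lambda>z. SUP i\<in>I. u i z)"
proof (rule lipschitz_onI)
  show "0 \<le> M" using lip \<open>I \<noteq> {}\<close> by (auto simp: lipschitz_on_def)
  have *: "(SUP i\<in>I. u i x) \<le> (SUP i\<in>I. u i y) + M * dist x y" if xy: "x \<in> S" "y \<in> S" for x y
  proof (rule cSUP_least[OF \<open>I \<noteq> {}\<close>])
    fix i assume i: "i \<in> I"
    have "u i x \<le> u i y + M * dist x y"
      using lipschitz_onD[OF lip[OF i] xy] by (simp add: dist_real_def abs_le_iff)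
    moreover have "u i y \<le> (SUP i\<in>I. u i y)" by (rule cSUP_upper[OF i bdd[OF xy(2)]])
    ultimately show "u i x \<le> (SUP i\<in>I. u i y) + M * dist x y" by simp
  qed
  show "dist (SUP i\<in>I. u i x) (SUP i\<in>I. u i y) \<le> M * dist x y" if "x \<in> S" "y \<in> S" for x y
    using *[OF that] *[OF that(2,1)] by (simp add: dist_real_def abs_le_iff dist_commute)
qed

text \<open>\<open>tube_bound\<close> asks only for continuity, and on the whole space a ball can
  contain any two points. This brings the merely continuous solutions of the cell problem into the
  Lipschitz setting of the stability lemmas.\<close>

lemma coercive_subsolution_lipschitz:
  fixes u :: "'a::euclidean_space \<Rightarrow> real"
  assumes sub: "viscosity_subsolution_on UNIV F u" and cont: "continuous_on UNIV u"
    and R: "0 \<le> R" "\<And>y q. F y q \<le> 0 \<Longrightarrow> norm q \<le> R"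
  shows "R-lipschitz_on UNIV u"
proof (rule lipschitz_onI[OF _ R(1)])
  have *: "u b \<le> u a + R * dist a b" for a b
  proof (cases "a = b")
    case False
    show ?thesis
    proof (rule tube_bound[OF sub cont _ _ _ False])
      show "a \<in> ball a (dist a b + 1)" "b \<in> ball a (dist a b + 1)"
        by (auto simp: add_nonneg_pos)
      fix y q assume "F y q \<le> 0"
      then have "norm q \<le> R" by (rule R)
      have "q \<bullet> (b - a) \<le> norm q * norm (b - a)" by (rule norm_cauchy_schwarz)
      also have "\<dots> \<le> R * norm (b - a)" using \<open>norm q \<le> R\<close> by (intro mult_right_mono) auto
      finally show "q \<bullet> (b - a) \<le> R * dist a b" by (simp add: dist_norm norm_minus_commute)
    qed auto
  qed simp
  show "dist (u x) (u y) \<le> R * dist x y" for x y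
    using *[of x y] *[of y x] by (simp add: dist_real_def abs_le_iff dist_commute)
qed

section \<open>Translations, sublevel sets and lattice periodicity\<close>

lemma C1_with_gradient_on_translate:
  assumes "C1_with_gradient_on UNIV \<phi> D"
  shows "C1_with_gradient_on UNIV (\<lambda>z. \<phi> (z + k)) (\<lambda>z. D (z + k))"
proof -
  have "GDERIV (\<lambda>z. \<phi> (z + k)) z :> D (z + k)" for z
  proof -
    have 1: "((\<lambda>z. z + k) has_derivative (\<lambda>h. h)) (at z)" by (auto intro!: derivative_eq_intros)
    have 2: "(\<phi> has_derivative (\<lambda>h. h \<bullet> D (z + k))) (at (z + k))"
      using assms by (simp add: gderiv_def C1_with_gradient_on_def)
    have "((\<lambda>z. \<phi> (z + k)) has_derivative (\<lambda>h. h \<bullet> D (z + k))) (at z)"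
      using diff_chain_at[OF 1 2] by (simp add: o_def)
    then show ?thesis by (simp add: gderiv_def)
  qed
  moreover have "continuous_on UNIV (\<lambda>z. D (z + k))"
    by (rule continuous_on_compose2[of UNIV D UNIV "\<lambda>z. z + k"])
      (use assms in \<open>auto simp: C1_with_gradient_on_def intro: continuous_intros\<close>)
  ultimately show ?thesis by (simp add: C1_with_gradient_on_def)
qed

lemma viscosity_subsolution_on_translate:
  assumes "viscosity_subsolution_on UNIV F u"
  shows "viscosity_subsolution_on UNIV (\<lambda>z. F (z + k)) (\<lambda>z. u (z + k))"
  unfolding viscosity_subsolution_on_def
proof (intro allI impI)
  fix \<phi> D z
  assume *: "C1_with_gradient_on UNIV \<phi> D" and ev: "\<forall>\<^sub>F w in nhds z. u (w + k) - \<phi> w \<le> u (z + k) - \<phi> z"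
  have "F (z + k) (D (z + k + - k)) \<le> 0"
  proof (rule viscosity_subsolution_onD[OF assms C1_with_gradient_on_translate[OF *]])
    have "filterlim (\<lambda>w. w + - k) (nhds (z + k + -k)) (nhds (z + k))"
      by (intro tendsto_intros filterlim_ident)
    then have "filterlim (\<lambda>w. w + - k) (nhds z) (nhds (z + k))" by simp
    then show "\<forall>\<^sub>F w in nhds (z + k). u w - \<phi> (w + - k) \<le> u (z + k) - \<phi> (z + k + - k)"
      using ev unfolding filterlim_iff by force
  qed auto
  then show "F (z + k) (D z) \<le> 0" by simp
qed

lemma viscosity_subsolution_on_add_const:
  "viscosity_subsolution_on \<Omega> F (\<lambda>z. u z + c) \<longleftrightarrow> viscosity_subsolution_on \<Omega> F u"
  unfolding viscosity_subsolution_on_def by (simp add: algebra_simps)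

lemma viscosity_subsolution_on_mono:
  assumes "viscosity_subsolution_on \<Omega> F u" "\<And>z q. z \<in> \<Omega> \<Longrightarrow> F z q \<le> 0 \<Longrightarrow> F' z q \<le> 0"
  shows "viscosity_subsolution_on \<Omega> F' u"
  using assms unfolding viscosity_subsolution_on_def by blast

lemma convex_bounded_sublevel:
  assumes "convex_on UNIV f"
  shows "convex {q. norm q \<le> M \<and> f q \<le> (c::real)}"
proof -
  have "convex {q. f q \<le> c}"
  proof (rule convexI, simp)
    fix x y and s t :: real
    assume "f x \<le> c" "f y \<le> c" and st: "0 \<le> s" "0 \<le> t" "s + t = 1"
    then have "s * f x + t * f y \<le> s * c + t * c" by (intro add_mono mult_left_mono)
    moreover have "f (s *\<^sub>R x + t *\<^sub>R y) \<le> s * f x + t * f y"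
      proof -
      have "s = 1 - t" using st by simp
      then show ?thesis using convex_onD[OF assms, of t x y] st(1,2) by simp
    qed
    ultimately show "f (s *\<^sub>R x + t *\<^sub>R y) \<le> c" using st by (simp flip: distrib_right)
  qed
  then have "convex (cball 0 M \<inter> {q. f q \<le> c})" by (intro convex_Int convex_cball)
  then show ?thesis by (simp add: Int_def)
qed

text \<open>Subtracting integer parts moves \<open>x\<close> into the unit cube, whose points have
  l1 norm at most the dimension. The closed ball of radius \<open>CARD('n)\<close> thus serves as a
  compact substitute for the torus.\<close>

lemma lattice_point_near:
  fixes x :: "real ^ 'n"
  obtains k :: "real ^ 'n" where "\<And>i. k $ i \<in> \<int>" "norm (x + k) \<le> CARD('n)"
proof
  define k :: "real ^ 'n" where "k = (\<chi> i. - of_int \<lfloor>x $ i\<rfloor>)"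
  show "k $ i \<in> \<int>" for i by (simp add: k_def)
  have "norm (x + k) \<le> (\<Sum>i\<in>UNIV. \<bar>(x + k) $ i\<bar>)" by (rule norm_le_l1_cart)
  also have "\<dots> \<le> (\<Sum>i\<in>(UNIV :: 'n set). 1)"
    by (rule sum_mono) (simp add: k_def abs_le_iff, linarith)
  finally show "norm (x + k) \<le> CARD('n)" by simp
qed

lemma Zn_periodicD: "Zn_periodic f \<Longrightarrow> (\<And>i. k $ i \<in> \<int>) \<Longrightarrow> f (y + k) = f y"
  by (simp add: Zn_periodic_def)

lemma Zn_periodic_attains_sup:
  fixes v :: "real ^ 'n \<Rightarrow> real"
  assumes "Zn_periodic v" "continuous_on UNIV v"
  obtains y where "\<And>x. v x \<le> v y"
proof -
  obtain y where y: "\<And>x. x \<in> cball 0 (real CARD('n)) \<Longrightarrow> v x \<le> v y"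
    using continuous_attains_sup[OF compact_cball, of 0 "real CARD('n)" v] assms(2)
    by (metis cball_eq_empty continuous_on_subset not_less of_nat_0_le_iff subset_UNIV)
  have "v x \<le> v y" for x
  proof -
    obtain k where "\<And>i. k $ i \<in> \<int>" "norm (x + k) \<le> CARD('n)" using lattice_point_near by blast
    then show ?thesis using y[of "x + k"] Zn_periodicD[OF assms(1), of k x] by simp
  qed
  then show thesis by (rule that)
qed

lemma Zn_periodic_attains_inf:
  fixes v :: "real ^ 'n \<Rightarrow> real"
  assumes "Zn_periodic v" "continuous_on UNIV v"
  obtains y where "\<And>x. v y \<le> v x"
  using Zn_periodic_attains_sup[of "\<lambda>x. - v x"] assms
  by (auto simp: Zn_periodic_def intro: continuous_intros)

text \<open>Some lattice translate of \<open>x\<close> lies within \<open>CARD('n)\<close> of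
  \<open>y\<close>. This is the origin of the dimensional factor in the final constant.\<close>

lemma Zn_periodic_lipschitz_osc:
  fixes v :: "real ^ 'n \<Rightarrow> real"
  assumes "Zn_periodic v" "M-lipschitz_on UNIV v"
  shows "v x \<le> v y + M * CARD('n)"
proof -
  obtain k where k: "\<And>i. k $ i \<in> \<int>" "norm (x - y + k) \<le> CARD('n)" using lattice_point_near by blast
  have "v x = v (x + k)" using Zn_periodicD[OF assms(1) k(1)] by simp
  also have "\<dots> \<le> v y + M * norm (x - y + k)"
    using lipschitz_onD[OF assms(2), of "x + k" y]
    by (simp add: dist_real_def dist_norm abs_le_iff algebra_simps)
  also have "M * norm (x - y + k) \<le> M * CARD('n)"
    using k assms(2) by (intro mult_left_mono) (auto simp: lipschitz_on_def)
  finally show ?thesis by simp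
qed

lemma C1_with_gradient_on_const: "C1_with_gradient_on \<Omega> (\<lambda>_. c) (\<lambda>_. 0)"
  by (simp add: C1_with_gradient_on_def gderiv_def)

text \<open>No slope appears: it is absorbed into the Hamiltonian, the theory is developed at slope
  zero, and \<open>shift\<close> transfers it to every \<open>p\<close>.\<close>

definition cell_subsolution ::
  "(real ^ 'n \<Rightarrow> real ^ 'n \<Rightarrow> real) \<Rightarrow> real \<Rightarrow> (real ^ 'n \<Rightarrow> real) \<Rightarrow> bool" where
  "cell_subsolution H c v \<longleftrightarrow> Zn_periodic v \<and> continuous_on UNIV v \<and>
     viscosity_subsolution_on UNIV (\<lambda>y q. H y q - c) v"

section \<open>Periodic coercive Hamiltonians and envelopes of cell subsolutions\<close>

locale coercive_Hamiltonian =
  fixes H :: "real ^ 'n \<Rightarrow> real ^ 'n \<Rightarrow> real"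
  assumes continuous: "continuous_on UNIV (\<lambda>(y, p). H y p)"
    and periodic: "\<And>p. Zn_periodic (\<lambda>y. H y p)"
    and coercive: "\<And>M. \<forall>\<^sub>F p in at_infinity. \<forall>y. M \<le> H y p"
    and convex: "\<And>y. convex_on UNIV (H y)"
begin

lemma shift: "coercive_Hamiltonian (\<lambda>y q. H y (p + q))"
proof
  show "continuous_on UNIV (\<lambda>(y, q). H y (p + q))"
    using continuous_on_compose2[OF continuous, of UNIV "\<lambda>(y, q). (y, p + q)"]
    by (simp add: case_prod_beta continuous_intros)
  show "Zn_periodic (\<lambda>y. H y (p + q))" for q by (rule periodic)
  show "\<forall>\<^sub>F q in at_infinity. \<forall>y. M \<le> H y (p + q)" for M
  proof -
    obtain b where b: "\<And>q y. b \<le> norm q \<Longrightarrow> M \<le> H y q"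
      using coercive[of M] by (auto simp: eventually_at_infinity)
    have "M \<le> H y (p + q)" if "b + norm p \<le> norm q" for y q
      by (rule b) (use that norm_diff_ineq[of q p] in \<open>simp add: add.commute\<close>)
    then show ?thesis by (auto simp: eventually_at_infinity)
  qed
  show "convex_on UNIV (\<lambda>q. H y (p + q))" for y
  proof (rule convex_onI)
    fix t :: real and x z assume t: "0 < t" "t < 1"
    have "p + ((1 - t) *\<^sub>R x + t *\<^sub>R z) = (1 - t) *\<^sub>R (p + x) + t *\<^sub>R (p + z)"
      by (simp add: algebra_simps)
    then show "H y (p + ((1 - t) *\<^sub>R x + t *\<^sub>R z)) \<le> (1 - t) * H y (p + x) + t * H y (p + z)"
      using convex_onD[OF convex, of t "p + x" "p + z"] t by simp
  qed simp
qed

lemma sublevel_bounded: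
  obtains R where "0 \<le> R" "\<And>y q. H y q \<le> C \<Longrightarrow> norm q \<le> R"
proof -
  obtain b where "\<And>q y. b \<le> norm q \<Longrightarrow> C + 1 \<le> H y q"
    using coercive[of "C + 1"] by (auto simp: eventually_at_infinity)
  then have "norm q \<le> max 0 b" if "H y q \<le> C" for y q
    using that by (smt (verit))
  then show thesis using that[of "max 0 b"] by simp
qed

lemma H_lattice: "(\<And>i. k $ i \<in> \<int>) \<Longrightarrow> H (y + k) q = H y q"
  using Zn_periodicD[OF periodic] by blast

lemma bounded_on_balls:
  obtains K where "\<And>y q. norm q \<le> B \<Longrightarrow> \<bar>H y q\<bar> \<le> K"
proof -
  let ?C = "cball 0 (real CARD('n)) \<times> cball 0 B :: ((real ^ 'n) \<times> (real ^ 'n)) set"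
  have "compact ((\<lambda>(y, q). H y q) ` ?C)"
    by (intro compact_continuous_image continuous_on_subset[OF continuous] compact_Times compact_cball) auto
  then obtain K where K: "\<And>y q. (y, q) \<in> ?C \<Longrightarrow> \<bar>H y q\<bar> \<le> K"
    using compact_imp_bounded[of "(\<lambda>(y, q). H y q) ` ?C"] unfolding bounded_iff by fastforce
  have "\<bar>H y q\<bar> \<le> K" if "norm q \<le> B" for y q
  proof -
    obtain k where "\<And>i. k $ i \<in> \<int>" "norm (y + k) \<le> CARD('n)" using lattice_point_near by blast
    then show ?thesis using K[of "y + k" q] H_lattice[of k y q] that by simp
  qed
  then show thesis by (rule that)
qed

lemma uniformly_continuous:
  "uniformly_continuous_on (UNIV \<times> cball 0 R) (\<lambda>(y, q). H y q)"
proof -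
  \<comment> \<open>One lattice vector must move both points. It brings the first within
    \<open>CARD('n)\<close> of the origin, and the second, less than 1 away, lands in the ball
    enlarged by 1.\<close>
  let ?C = "cball 0 (real CARD('n) + 1) \<times> cball 0 R :: ((real ^ 'n) \<times> (real ^ 'n)) set"
  have uc: "uniformly_continuous_on ?C (\<lambda>(y, q). H y q)"
    by (intro compact_uniformly_continuous continuous_on_subset[OF continuous] compact_Times compact_cball) auto
  show ?thesis unfolding uniformly_continuous_on_def
  proof (intro allI impI)
    fix e :: real assume "e > 0"
    then obtain d where d: "d > 0" "\<And>a b. a \<in> ?C \<Longrightarrow> b \<in> ?C \<Longrightarrow> dist b a < d \<Longrightarrow>
        dist (case b of (y, q) \<Rightarrow> H y q) (case a of (y, q) \<Rightarrow> H y q) < e"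
      using uc unfolding uniformly_continuous_on_def by metis
    show "\<exists>d>0. \<forall>a\<in>UNIV \<times> cball 0 R. \<forall>b\<in>UNIV \<times> cball 0 R. dist b a < d \<longrightarrow>
        dist (case b of (y, q) \<Rightarrow> H y q) (case a of (y, q) \<Rightarrow> H y q) < e"
    proof (intro exI conjI ballI impI)
      show "min d 1 > 0" using d by simp
      fix a b :: "(real ^ 'n) \<times> (real ^ 'n)"
      assume ab: "a \<in> UNIV \<times> cball 0 R" "b \<in> UNIV \<times> cball 0 R" "dist b a < min d 1"
      obtain x p where a: "a = (x, p)" by (cases a)
      obtain y q where b: "b = (y, q)" by (cases b)
      obtain k where k: "\<And>i. k $ i \<in> \<int>" "norm (x + k) \<le> CARD('n)" using lattice_point_near by blast
      have "dist (y, q) (x, p) < 1" using ab a b by simp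
      then have "dist y x < 1" using dist_fst_le[of "(y, q)" "(x, p)"] by simp
      then have "norm (y + k) \<le> CARD('n) + 1"
        using k norm_triangle_ineq[of "y - x" "x + k"] by (simp add: dist_norm)
      moreover have "dist (y + k, q) (x + k, p) < d"
        using ab by (simp add: a b dist_Pair_Pair)
      ultimately have "dist (H (y + k) q) (H (x + k) p) < e"
        using d(2)[of "(x + k, p)" "(y + k, q)"] k ab a b by simp
      then show "dist (case b of (y, q) \<Rightarrow> H y q) (case a of (y, q) \<Rightarrow> H y q) < e"
        using k by (simp add: a b H_lattice)
    qed
  qed
qed

lemma continuous_F:
  assumes "continuous_on UNIV f"
  shows "continuous_on (UNIV \<times> UNIV) (\<lambda>(y, q). H y q - f y)"
  unfolding case_prod_beta UNIV_Times_UNIV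
  by (intro continuous_intros continuous[unfolded case_prod_beta]
      continuous_on_compose2[OF assms] subset_UNIV)

lemma convex_sublevel: "convex {q. norm q \<le> M \<and> H y q - c \<le> 0}"
  using convex_bounded_sublevel[OF convex, of M y c] by simp

lemma closed_sublevel: "closed {q. norm q \<le> M \<and> H y q - c \<le> 0}"
proof -
  have "continuous_on UNIV (H y)"
    using continuous_on_compose2[OF continuous, of UNIV "\<lambda>q. (y, q)"] by (simp add: continuous_intros)
  then show ?thesis by (intro closed_Collect_conj closed_Collect_le continuous_intros)
qed

lemma cell_subsolution_lipschitz:
  assumes "cell_subsolution H c v" "0 \<le> R" "\<And>y q. H y q \<le> c \<Longrightarrow> norm q \<le> R"
  shows "R-lipschitz_on UNIV v"
  by (rule coercive_subsolution_lipschitz[where F = "\<lambda>y q. H y q - c"])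
     (use assms in \<open>auto simp: cell_subsolution_def\<close>)

lemma cell_subsolution_INF:
  assumes v: "\<And>i. i \<in> I \<Longrightarrow> cell_subsolution H c (v i)" and "I \<noteq> {}"
    and bdd: "\<And>z. bdd_below ((\<lambda>i. v i z) ` I)"
  shows "cell_subsolution H c (\<lambda>z. INF i\<in>I. v i z)"
proof -
  obtain R where R: "0 \<le> R" "\<And>y q. H y q \<le> c \<Longrightarrow> norm q \<le> R" using sublevel_bounded by blast
  have lip: "R-lipschitz_on UNIV (v i)" if "i \<in> I" for i
    using cell_subsolution_lipschitz[OF v[OF that] R] .
  have "viscosity_subsolution_on UNIV (\<lambda>y q. H y q - c) (\<lambda>z. INF i\<in>I. v i z)"
    by (rule subsolution_INF[OF open_UNIV continuous_F convex_sublevel lip _ \<open>I \<noteq> {}\<close>])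
       (use v bdd in \<open>auto simp: cell_subsolution_def\<close>)
  moreover have "continuous_on UNIV (\<lambda>z. INF i\<in>I. v i z)"
    using lipschitz_on_INF[OF lip \<open>I \<noteq> {}\<close> bdd] by (rule lipschitz_on_continuous_on)
  moreover have "Zn_periodic (\<lambda>z. INF i\<in>I. v i z)"
    using v by (auto simp: cell_subsolution_def Zn_periodic_def intro!: INF_cong)
  ultimately show ?thesis by (simp add: cell_subsolution_def)
qed

lemma cell_subsolution_SUP:
  assumes v: "\<And>i. i \<in> I \<Longrightarrow> cell_subsolution H c (v i)" and "I \<noteq> {}"
    and bdd: "\<And>z. bdd_above ((\<lambda>i. v i z) ` I)"
  shows "cell_subsolution H c (\<lambda>z. SUP i\<in>I. v i z)"
proof -
  obtain R where R: "0 \<le> R" "\<And>y q. H y q \<le> c \<Longrightarrow> norm q \<le> R" using sublevel_bounded by blast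
  have lip: "R-lipschitz_on UNIV (v i)" if "i \<in> I" for i
    using cell_subsolution_lipschitz[OF v[OF that] R] .
  have "viscosity_subsolution_on UNIV (\<lambda>y q. H y q - c) (\<lambda>z. SUP i\<in>I. v i z)"
    by (rule subsolution_SUP[OF open_UNIV continuous_F convex_sublevel lip _ \<open>I \<noteq> {}\<close>])
       (use v bdd in \<open>auto simp: cell_subsolution_def\<close>)
  moreover have "continuous_on UNIV (\<lambda>z. SUP i\<in>I. v i z)"
    using lipschitz_on_SUP[OF lip \<open>I \<noteq> {}\<close> bdd] by (rule lipschitz_on_continuous_on)
  moreover have "Zn_periodic (\<lambda>z. SUP i\<in>I. v i z)"
    using v by (auto simp: cell_subsolution_def Zn_periodic_def intro!: SUP_cong)
  ultimately show ?thesis by (simp add: cell_subsolution_def)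
qed

lemma cell_subsolution_mono:
  assumes "cell_subsolution H c v" "c \<le> c'"
  shows "cell_subsolution H c' v"
  using assms unfolding cell_subsolution_def by (auto intro: viscosity_subsolution_on_mono)

lemma cell_subsolution_add_const:
  assumes "cell_subsolution H c v"
  shows "cell_subsolution H c (\<lambda>z. v z + a)"
  using assms by (auto simp: cell_subsolution_def viscosity_subsolution_on_add_const Zn_periodic_def
      intro: continuous_intros)

section \<open>The critical value and a subsolution that attains it\<close>

lemma cell_subsolution_level:
  assumes "cell_subsolution H c v"
  obtains y where "H y 0 \<le> c"
proof -
  obtain y where "\<And>x. v x \<le> v y"
    using Zn_periodic_attains_sup assms unfolding cell_subsolution_def by blast
  then have "H y 0 - c \<le> 0"
    using assms viscosity_subsolution_onD[OF _ C1_with_gradient_on_const[of UNIV 0], of "\<lambda>y q. H y q - c" v y]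
    by (simp add: cell_subsolution_def)
  then show thesis using that by simp
qed

text \<open>Mane's critical value in weak KAM theory; it turns out to be the only level at which the
  cell problem of slope zero is solvable.\<close>

definition critical_value :: real where
  "critical_value = Inf {c. \<exists>v. cell_subsolution H c v}"

text \<open>Constants are subsolutions at the level of a bound for |H(y, 0)|. Conversely, a periodic
  subsolution attains its maximum, where a constant touches it, so its level is at least some H(y,
  0).\<close>

lemma subsolution_levels:
  "{c. \<exists>v. cell_subsolution H c v} \<noteq> {}" "bdd_below {c. \<exists>v. cell_subsolution H c v}"
proof -
  obtain K where K: "\<And>y q. norm q \<le> 0 \<Longrightarrow> \<bar>H y q\<bar> \<le> K" using bounded_on_balls by blast
  have "viscosity_subsolution_on UNIV (\<lambda>y q. H y q - K) (\<lambda>_. 0)"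
    unfolding viscosity_subsolution_on_def
  proof (intro allI impI)
    fix \<phi> D and z :: "real ^ 'n"
    assume *: "C1_with_gradient_on UNIV \<phi> D" "\<forall>\<^sub>F w in nhds z. 0 - \<phi> w \<le> 0 - \<phi> z"
    have "norm (D z) \<le> 0"
      by (rule lipschitz_touching_norm_le[of 0 UNIV "\<lambda>_. 0" z \<phi>])
         (use * in \<open>auto simp: lipschitz_on_def C1_with_gradient_on_def\<close>)
    then show "H z (D z) - K \<le> 0" using K[of "D z" z] by (simp add: abs_le_iff)
  qed
  then have "cell_subsolution H K (\<lambda>_. 0)" by (simp add: cell_subsolution_def Zn_periodic_def)
  then show "{c. \<exists>v. cell_subsolution H c v} \<noteq> {}" by blast
  show "bdd_below {c. \<exists>v. cell_subsolution H c v}"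
  proof (rule bdd_belowI)
    fix c assume "c \<in> {c. \<exists>v. cell_subsolution H c v}"
    then obtain y where "H y 0 \<le> c" using cell_subsolution_level by blast
    then show "- K \<le> c" using K[of 0 y] by simp
  qed
qed

lemma critical_value_le: "cell_subsolution H c v \<Longrightarrow> critical_value \<le> c"
  unfolding critical_value_def using subsolution_levels by (intro cInf_lower) auto

text \<open>A monotone limit replaces a compactness argument. As the level decreases to the critical
  one, the class of subsolutions vanishing at the origin shrinks, so its lower envelope
  \<open>V n\<close> increases. The supremum \<open>W\<close> can be taken over any tail; it is
  therefore a subsolution at every level \<open>c k\<close>, and hence at their limit. The sublevel
  set at \<open>c 0\<close> supplies one Lipschitz constant for all \<open>n\<close>, which keeps
  the envelopes finite.\<close>

lemma critical_subsolution_exists: "\<exists>v. cell_subsolution H critical_value v"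
proof -
  define c where "c n = critical_value + 1 / real (Suc n)" for n
  define \<V> where "\<V> n = {v. cell_subsolution H (c n) v \<and> v 0 = 0}" for n
  define V where "V n z = (INF v\<in>\<V> n. v z)" for n z
  have c_mono: "c n \<le> c m" if "m \<le> n" for m n
    using that by (simp add: c_def frac_le)
  have ne: "\<V> n \<noteq> {}" for n
  proof -
    have "Inf {c. \<exists>v. cell_subsolution H c v} < c n" by (simp add: c_def critical_value_def)
    then obtain b v where "cell_subsolution H b v" "b < c n"
      using cInf_lessD[OF subsolution_levels(1)] by blast
    then have "cell_subsolution H (c n) (\<lambda>z. v z + - v 0)"
      by (intro cell_subsolution_add_const) (auto intro: cell_subsolution_mono)
    then show ?thesis unfolding \<V>_def by force
  qed
  obtain R where R: "0 \<le> R" "\<And>y q. H y q \<le> c 0 \<Longrightarrow> norm q \<le> R" using sublevel_bounded by blast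
  have lip: "R-lipschitz_on UNIV v" if "v \<in> \<V> n" for v n
  proof (rule cell_subsolution_lipschitz[OF _ R])
    show "cell_subsolution H (c n) v" using that by (simp add: \<V>_def)
    show "H y q \<le> c 0" if "H y q \<le> c n" for y q using that c_mono[of 0 n] by simp
  qed
  have bd: "- (R * norm z) \<le> v z" "v z \<le> R * norm z" if "v \<in> \<V> n" for v n z
    using lipschitz_onD[OF lip[OF that], of z 0] that
    by (auto simp: \<V>_def dist_real_def abs_le_iff)
  have bddV: "bdd_below ((\<lambda>v. v z) ` \<V> n)" for n z
    using bd by (intro bdd_belowI2[where m = "- (R * norm z)"])
  have Vsub: "cell_subsolution H (c n) (V n)" for n
    unfolding V_def by (rule cell_subsolution_INF[OF _ ne bddV]) (simp add: \<V>_def)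
  have V_le: "V n z \<le> R * norm z" for n z
  proof -
    obtain v where v: "v \<in> \<V> n" using ne by blast
    then have "V n z \<le> v z" unfolding V_def by (intro cINF_lower bddV)
    then show ?thesis using bd(2)[OF v, of z] by simp
  qed
  have V_mono: "V m z \<le> V n z" if "m \<le> n" for m n z
    unfolding V_def
    by (rule cINF_superset_mono[OF ne bddV])
       (use c_mono[OF that] in \<open>auto simp: \<V>_def intro: cell_subsolution_mono\<close>)
  have bddS: "bdd_above ((\<lambda>n. V n z) ` I)" for I z
    using V_le by (intro bdd_aboveI2)
  define W where "W z = (SUP n. V n z)" for z
  have W_eq: "W z = (SUP n\<in>{k..}. V n z)" for z k
  proof (rule antisym)
    show "W z \<le> (SUP n\<in>{k..}. V n z)" unfolding W_def
    proof (rule cSUP_least)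
      fix n
      have "V n z \<le> V (max n k) z" by (rule V_mono) simp
      also have "\<dots> \<le> (SUP n\<in>{k..}. V n z)" by (intro cSUP_upper bddS) simp
      finally show "V n z \<le> (SUP n\<in>{k..}. V n z)" .
    qed simp
    show "(SUP n\<in>{k..}. V n z) \<le> W z" unfolding W_def
      by (rule cSUP_subset_mono[OF _ bddS]) auto
  qed
  have Wsub: "cell_subsolution H (c k) W" for k
  proof -
    have "cell_subsolution H (c k) (\<lambda>z. SUP n\<in>{k..}. V n z)"
      by (rule cell_subsolution_SUP[OF cell_subsolution_mono[OF Vsub c_mono] _ bddS]) auto
    then show ?thesis using W_eq[of _ k] by presburger
  qed
  have "viscosity_subsolution_on UNIV (\<lambda>y q. H y q - critical_value) W"
    unfolding viscosity_subsolution_on_def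
  proof (intro allI impI)
    fix \<phi> D and z :: "real ^ 'n"
    assume *: "C1_with_gradient_on UNIV \<phi> D" "z \<in> UNIV" "\<forall>\<^sub>F w in nhds z. W w - \<phi> w \<le> W z - \<phi> z"
    have "H z (D z) - critical_value \<le> 1 / real (Suc k)" for k
      using viscosity_subsolution_onD[OF _ *, of "\<lambda>y q. H y q - c k"] Wsub[of k]
      by (simp add: cell_subsolution_def c_def)
    then show "H z (D z) - critical_value \<le> 0"
      using LIMSEQ_inverse_real_of_nat
      by (intro LIMSEQ_le_const[of "\<lambda>k. 1 / real (Suc k)" 0]) (auto simp: inverse_eq_divide)
  qed
  then show ?thesis using Wsub[of 0] by (auto simp: cell_subsolution_def)
qed

end

section \<open>Solvability of the cell problem\<close>

text \<open>Selects the translate of \<open>z\<close> in the unit cube centred at \<open>z0\<close>,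
  so that a change made near \<open>z0\<close> can be periodised by an explicit formula. The choice
  made by \<open>round\<close> at ties is harmless, since the changes stay within distance 1/2 of
  \<open>z0\<close>.\<close>

definition lattice_rep :: "real ^ 'n \<Rightarrow> real ^ 'n \<Rightarrow> real ^ 'n" where
  "lattice_rep z0 z = z + (\<chi> i. - of_int (round ((z - z0) $ i)))"

lemma lattice_repE:
  obtains k where "\<And>i. k $ i \<in> \<int>" "lattice_rep z0 z = z + k"
  by (rule that[of "\<chi> i. - of_int (round ((z - z0) $ i))"]) (auto simp: lattice_rep_def)

lemma lattice_rep_unique:
  assumes k: "\<And>i. k $ i \<in> \<int>" and d: "dist (z + k) z0 < 1 / 2"
  shows "lattice_rep z0 z = z + k"
proof -
  have "- of_int (round ((z - z0) $ i)) = k $ i" for i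
  proof -
    obtain m where m: "k $ i = of_int m" using k[of i] by (auto elim: Ints_cases)
    have "\<bar>(z + k - z0) $ i\<bar> < 1 / 2"
      using component_le_norm_cart[of "z + k - z0" i] d by (simp add: dist_norm)
    then have "round ((z - z0) $ i) = - m"
      by (intro round_unique') (simp add: m algebra_simps)
    then show ?thesis by (simp add: m)
  qed
  then show ?thesis by (simp add: lattice_rep_def vec_eq_iff)
qed

lemma lattice_rep_periodic:
  assumes k: "\<And>i. k $ i \<in> \<int>"
  shows "lattice_rep z0 (z + k) = lattice_rep z0 z"
proof -
  have "of_int (round ((z + k - z0) $ i)) = of_int (round ((z - z0) $ i)) + k $ i" for i
  proof -
    obtain m where m: "k $ i = of_int m" using k[of i] by (auto elim: Ints_cases)
    have "(z + k - z0) $ i = (z - z0) $ i + of_int m" by (simp add: m)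
    then have "round ((z + k - z0) $ i) = round ((z - z0) $ i + of_int m)" by (rule arg_cong)
    also have "round ((z - z0) $ i + of_int m) = round ((z - z0) $ i) + m"
    proof -
      have "(z - z0) $ i + of_int m + 1 / 2 = ((z - z0) $ i + 1 / 2) + of_int m" by simp
      then show ?thesis unfolding round_def by (metis floor_add_int add.commute)
    qed
    finally show ?thesis by (simp add: m del: vector_minus_component vector_add_component)
  qed
  then show ?thesis by (simp add: lattice_rep_def vec_eq_iff)
qed

text \<open>A translate closer than 1/2 to \<open>z0\<close> can only be the chosen representative,
  so the distance to the whole orbit is governed by that one point.\<close>

lemma lattice_distance_pos:
  fixes y z0 :: "real ^ 'n"
  assumes "\<forall>k. (\<forall>i. k $ i \<in> \<int>) \<longrightarrow> y + k \<noteq> z0"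
  shows "\<exists>r>0. \<forall>k. (\<forall>i. k $ i \<in> \<int>) \<longrightarrow> r \<le> dist (y + k) z0"
proof (intro exI conjI allI impI)
  let ?r = "min (1 / 2) (dist (lattice_rep z0 y) z0)"
  show "?r > 0" using lattice_repE[of z0 y] assms by (metis half_gt_zero min_less_iff_conj zero_less_dist_iff zero_less_one)
  show "?r \<le> dist (y + k) z0" if "\<forall>i. k $ i \<in> \<int>" for k
    using lattice_rep_unique[OF that[rule_format], of y z0] by (cases "dist (y + k) z0 < 1 / 2") auto
qed

lemma gradient_eq_of_touching:
  assumes "GDERIV f z :> a" "GDERIV g z :> b" "\<forall>\<^sub>F w in nhds z. f w - g w \<le> f z - g z"
  shows "a = b"
proof -
  have "GDERIV (\<lambda>w. g w - f w) z :> b - a"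
    using assms(1,2) unfolding gderiv_def by (auto intro!: derivative_eq_intros simp: inner_diff_right)
  then have "norm (b - a) \<le> 0"
  proof (rule lipschitz_touching_norm_le[of 0 UNIV "\<lambda>_. 0", rotated -2])
    show "\<forall>\<^sub>F w in nhds z. 0 - (g w - f w) \<le> 0 - (g z - f z)"
      using assms(3) by eventually_elim simp
  qed (auto simp: lipschitz_on_def)
  then show ?thesis by simp
qed

section \<open>Perron bumps, strict subsolutions and solvability\<close>

context coercive_Hamiltonian
begin

text \<open>Where the supersolution test fails, the test function, lifted slightly, can be glued
  into \<open>v\<close>: the result is larger at \<open>z0\<close> and still a subsolution. The
  contact point and the gap \<eta> are fixed before the radius \<open>r\<close>, so that the caller
  can first locate \<open>z0\<close> and then keep the change away from a chosen orbit. The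
  tent-shaped term records, by a continuous function, that the new subsolution is strict near
  \<open>z0\<close>.\<close>

lemma perron_bump:
  assumes v: "cell_subsolution H c v"
    and not_super: "\<not> viscosity_supersolution_on UNIV (\<lambda>y q. H y q - c) v"
  shows "\<exists>z0 \<eta>. \<eta> > 0 \<and> (\<forall>r>0. \<exists>v' \<rho>. cell_subsolution H c v' \<and> v z0 < v' z0 \<and>
       (\<forall>x. (\<forall>k. (\<forall>i. k $ i \<in> \<int>) \<longrightarrow> r \<le> dist (x + k) z0) \<longrightarrow> v' x = v x) \<and> \<rho> > 0 \<and>
       viscosity_subsolution_on UNIV (\<lambda>y q. H y q - c + \<eta> * max 0 (1 - dist y z0 / \<rho>)) v')"
proof -
  from not_super obtain \<phi> D z0 where C1: "C1_with_gradient_on UNIV \<phi> D"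
    and min: "\<forall>\<^sub>F w in nhds z0. v w - \<phi> w \<ge> v z0 - \<phi> z0" and neg: "H z0 (D z0) - c < 0"
    unfolding viscosity_supersolution_on_def by (auto simp: not_le)
  have per: "Zn_periodic v" and cv: "continuous_on UNIV v"
    and sub: "viscosity_subsolution_on UNIV (\<lambda>y q. H y q - c) v"
    using v by (auto simp: cell_subsolution_def)
  define \<eta> where "\<eta> = (c - H z0 (D z0)) / 2"
  have \<eta>: "\<eta> > 0" using neg by (simp add: \<eta>_def)
  \<comment> \<open>Subtracting a quadratic makes the contact at \<open>z0\<close> strict, which
    leaves room to lift the function without crossing \<open>v\<close> away from
    \<open>z0\<close>.\<close>
  define \<phi>1 where "\<phi>1 z = \<phi> z - \<phi> z0 + v z0 - (z - z0) \<bullet> (z - z0)" for z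
  define D1 where "D1 z = D z - 2 *\<^sub>R (z - z0)" for z
  have G1: "GDERIV \<phi>1 z :> D1 z" for z
    unfolding gderiv_def \<phi>1_def D1_def
    apply (rule derivative_eq_intros refl C1[unfolded C1_with_gradient_on_def gderiv_def, THEN conjunct1, rule_format, OF UNIV_I])+
    apply (rule ext)
    by (simp add: inner_simps inner_commute)
  have cD: "continuous_on UNIV D1" unfolding D1_def
    using C1 by (auto simp: C1_with_gradient_on_def intro!: continuous_intros)
  have C11: "C1_with_gradient_on UNIV \<phi>1 D1" using G1 cD by (simp add: C1_with_gradient_on_def)
  have c\<phi>1: "continuous_on UNIV \<phi>1"
    using G1 has_derivative_continuous unfolding gderiv_def continuous_on_eq_continuous_within by blast
  have "continuous_on UNIV (\<lambda>z. H z (D1 z))"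
    using continuous_on_compose2[OF continuous, of UNIV "\<lambda>z. (z, D1 z)"] cD
    by (simp add: continuous_intros)
  then have "open {z. H z (D1 z) < c - \<eta>}" by (intro open_Collect_less continuous_intros)
  moreover have "H z0 (D1 z0) < c - \<eta>" using neg by (simp add: D1_def \<eta>_def field_simps)
  ultimately have "\<forall>\<^sub>F z in nhds z0. H z (D1 z) < c - \<eta>"
    using eventually_nhds_in_open[of "{z. H z (D1 z) < c - \<eta>}" z0] by simp
  then have "\<forall>\<^sub>F z in nhds z0. H z (D1 z) < c - \<eta> \<and> v z0 - \<phi> z0 \<le> v z - \<phi> z"
    using min by (rule eventually_conj)
  then obtain r1 where r1: "r1 > 0" "\<And>z. dist z z0 < r1 \<Longrightarrow> H z (D1 z) < c - \<eta>"
    "\<And>z. dist z z0 < r1 \<Longrightarrow> \<phi>1 z + (dist z z0)\<^sup>2 \<le> v z"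
    unfolding eventually_nhds_metric by (force simp: \<phi>1_def dist_norm power2_norm_eq_inner)
  show ?thesis
  proof (intro exI[of _ z0] exI[of _ \<eta>] conjI allI impI)
    show "\<eta> > 0" by (rule \<eta>)
    fix r :: real assume "r > 0"
    \<comment> \<open>The three bounds keep the change inside the required radius, inside the region
      where the test function is strict, and close enough to \<open>z0\<close> for the lattice
      representative to be unique.\<close>
    define r' where "r' = min (min r r1) (1 / 2)"
    have r': "r' > 0" "r' \<le> r" "r' \<le> r1" "r' \<le> 1 / 2" using \<open>r > 0\<close> r1 by (auto simp: r'_def)
    define \<kappa> where "\<kappa> = (r' / 2)\<^sup>2"
    have \<kappa>: "\<kappa> > 0" using r' by (simp add: \<kappa>_def)
    have out: "\<phi>1 z + \<kappa> \<le> v z" if "dist z z0 < r'" "r' / 2 \<le> dist z z0" for z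
    proof -
      have "\<kappa> \<le> (dist z z0)\<^sup>2" unfolding \<kappa>_def using that r' by (intro power_mono) auto
      then show ?thesis using r1(3)[of z] that r' by simp
    qed
    \<comment> \<open>For distances between r'/2 and r' the lifted function lies below
      \<open>v\<close> by the choice of \<kappa>, so the maximum equals \<open>v\<close> there and
      the two branches fit together continuously.\<close>
    define v' where "v' z = (if dist (lattice_rep z0 z) z0 < r'
      then max (v z) (\<phi>1 (lattice_rep z0 z) + \<kappa>) else v z)" for z
    have rep: "lattice_rep z0 z = z + k" if "\<And>i. k $ i \<in> \<int>" "dist (z + k) z0 < r'" for z k
      using lattice_rep_unique[OF that(1)] that(2) r' by fastforce
    have v'_ge: "v z \<le> v' z" for z by (simp add: v'_def)
    have v'_in: "v' z = max (v z) (\<phi>1 (z + k) + \<kappa>)" if "\<And>i. k $ i \<in> \<int>" "dist (z + k) z0 < r'" for z k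
      using rep[OF that] that by (simp add: v'_def)
    have v'_out: "v' z = v z" if "\<And>k. (\<And>i. k $ i \<in> \<int>) \<Longrightarrow> r' / 2 \<le> dist (z + k) z0" for z
    proof -
      obtain k where k: "\<And>i. k $ i \<in> \<int>" "lattice_rep z0 z = z + k" using lattice_repE[of z0 z] by blast
      then show ?thesis using that[OF k(1)] out[of "z + k"] Zn_periodicD[OF per k(1), of z] by (simp add: v'_def)
    qed
    have per': "Zn_periodic v'"
      unfolding Zn_periodic_def
    proof (intro allI impI)
      fix y k :: "real ^ 'n" assume "\<forall>i. k $ i \<in> \<int>"
      then have "lattice_rep z0 (y + k) = lattice_rep z0 y" "v (y + k) = v y"
        using lattice_rep_periodic[of k z0 y] Zn_periodicD[OF per, of k y] by auto
      then show "v' (y + k) = v' y" by (simp add: v'_def)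
    qed
    have near: "\<forall>\<^sub>F w in nhds z. dist (w + k) z0 < r'" if "dist (z + k) z0 < r'" for z k
    proof -
      have "open {w. dist (w + k) z0 < r'}" by (intro open_Collect_less continuous_intros)
      then show ?thesis using that eventually_nhds_in_open[of "{w. dist (w + k) z0 < r'}" z] by simp
    qed
    have "isCont v' z" for z
    proof (cases "\<exists>k. (\<forall>i. k $ i \<in> \<int>) \<and> dist (z + k) z0 < r'")
      case True
      then obtain k where k: "\<And>i. k $ i \<in> \<int>" "dist (z + k) z0 < r'" by blast
      have "continuous_on UNIV (\<lambda>w. \<phi>1 (w + k))"
        by (rule continuous_on_compose2[of UNIV \<phi>1 UNIV "\<lambda>w. w + k"]) (auto intro: continuous_intros c\<phi>1)
      then have "continuous_on UNIV (\<lambda>w. max (v w) (\<phi>1 (w + k) + \<kappa>))"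
        using cv by (intro continuous_intros)
      then have "isCont (\<lambda>w. max (v w) (\<phi>1 (w + k) + \<kappa>)) z"
        by (simp add: continuous_on_eq_continuous_at)
      moreover have "\<forall>\<^sub>F w in nhds z. v' w = max (v w) (\<phi>1 (w + k) + \<kappa>)"
        using near[OF k(2)] by eventually_elim (rule v'_in[OF k(1)])
      ultimately show ?thesis using isCont_cong[of v' "\<lambda>w. max (v w) (\<phi>1 (w + k) + \<kappa>)" z] by blast
    next
      case False
      have "\<forall>\<^sub>F w in nhds z. dist w z < r' / 2"
        unfolding eventually_nhds_metric using r'(1) by (intro exI[of _ "r' / 2"]) auto
      then have "\<forall>\<^sub>F w in nhds z. v' w = v w"
      proof eventually_elim
        case (elim w)
        show ?case
        proof (rule v'_out)
          fix k :: "real ^ 'n" assume "\<And>i. k $ i \<in> \<int>"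
          then have "r' \<le> dist (z + k) z0" using False by force
          moreover have "dist (z + k) z0 \<le> dist (w + k) z0 + dist (w + k) (z + k)"
            by (metis add.commute dist_commute dist_triangle)
          ultimately show "r' / 2 \<le> dist (w + k) z0" using elim by simp
        qed
      qed
      moreover have "isCont v z" using cv by (simp add: continuous_on_eq_continuous_at)
      ultimately show ?thesis using isCont_cong[of v' v z] by blast
    qed
    then have cont': "continuous_on UNIV v'" by (simp add: continuous_on_eq_continuous_at)
    have "open {z. v z < \<phi>1 z + \<kappa>}" by (intro open_Collect_less continuous_intros cv c\<phi>1)
    moreover have "z0 \<in> {z. v z < \<phi>1 z + \<kappa>}" using \<kappa> by (simp add: \<phi>1_def)
    ultimately obtain \<rho>0 where \<rho>0: "\<rho>0 > 0" "ball z0 \<rho>0 \<subseteq> {z. v z < \<phi>1 z + \<kappa>}"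
      by (meson open_contains_ball)
    \<comment> \<open>Within \<rho> of \<open>z0\<close> the bump strictly wins, so every test
      function touching there has the gradient of the bump. Where \<open>v'\<close> agrees with
      \<open>v\<close> the tent vanishes, and the old inequality suffices.\<close>
    define \<rho> where "\<rho> = min \<rho>0 r'"
    have \<rho>: "\<rho> > 0" "\<rho> \<le> r'" "\<And>z. dist z z0 < \<rho> \<Longrightarrow> v z < \<phi>1 z + \<kappa>"
      using \<rho>0 r' by (auto simp: \<rho>_def dist_commute subset_iff)
    have test_bump: "H z (E z) < c - \<eta>"
      if \<psi>: "C1_with_gradient_on UNIV \<psi> E" "\<forall>\<^sub>F w in nhds z. v' w - \<psi> w \<le> v' z - \<psi> z"
        and k: "\<And>i. k $ i \<in> \<int>" "dist (z + k) z0 < r'" and eq: "v' z = \<phi>1 (z + k) + \<kappa>" for \<psi> E z k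
    proof -
      have "D1 (z + k) = E z"
      proof (rule gradient_eq_of_touching)
        show "GDERIV (\<lambda>w. \<phi>1 (w + k)) z :> D1 (z + k)" "GDERIV \<psi> z :> E z"
          using C1_with_gradient_on_translate[OF C11, of k] \<psi>(1) by (auto simp: C1_with_gradient_on_def)
        show "\<forall>\<^sub>F w in nhds z. \<phi>1 (w + k) - \<psi> w \<le> \<phi>1 (z + k) - \<psi> z"
          using \<psi>(2) near[OF k(2)]
        proof eventually_elim
          case (elim w)
          have "\<phi>1 (w + k) + \<kappa> \<le> v' w" using v'_in[OF k(1) elim(2)] by simp
          then show ?case using elim eq by simp
        qed
      qed
      then show ?thesis using r1(2)[of "z + k"] k r' H_lattice[OF k(1)] by simp
    qed
    have test: "H z (E z) \<le> c - \<eta> * max 0 (1 - dist z z0 / \<rho>)"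
      if \<psi>: "C1_with_gradient_on UNIV \<psi> E" "\<forall>\<^sub>F w in nhds z. v' w - \<psi> w \<le> v' z - \<psi> z" for \<psi> E z
    proof -
      have "max 0 (1 - dist z z0 / \<rho>) \<le> 1" using \<rho> by simp
      then have le: "\<eta> * max 0 (1 - dist z z0 / \<rho>) \<le> \<eta>" using \<eta> by (simp add: mult_left_le)
      show ?thesis
      proof (cases "v' z = v z")
        case True
        have "\<forall>\<^sub>F w in nhds z. v w - \<psi> w \<le> v z - \<psi> z"
          using \<psi>(2)
        proof eventually_elim
          case (elim w)
          then show ?case using v'_ge[of w] True by simp
        qed
        then have "H z (E z) - c \<le> 0" using viscosity_subsolution_onD[OF sub \<psi>(1)] by simp
        moreover have "\<not> dist z z0 < \<rho>"
        proof
          assume "dist z z0 < \<rho>"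
          then show False using \<rho> v'_in[of 0 z] True by force
        qed
        then have "max 0 (1 - dist z z0 / \<rho>) = 0" using \<rho> by simp
        ultimately show ?thesis by simp
      next
        case False
        then have "dist (lattice_rep z0 z) z0 < r'" "v' z = \<phi>1 (lattice_rep z0 z) + \<kappa>"
          by (auto simp: v'_def split: if_splits)
        moreover obtain k where k: "\<And>i. k $ i \<in> \<int>" "lattice_rep z0 z = z + k" using lattice_repE[of z0 z] by blast
        ultimately have "H z (E z) < c - \<eta>" using test_bump[OF \<psi> k(1)] by simp
        then show ?thesis using le by simp
      qed
    qed
    have "cell_subsolution H c v'"
    proof -
      have "H z (E z) - c \<le> 0"
        if \<psi>: "C1_with_gradient_on UNIV \<psi> E" "\<forall>\<^sub>F w in nhds z. v' w - \<psi> w \<le> v' z - \<psi> z" for \<psi> E z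
      proof -
        have "0 \<le> \<eta> * max 0 (1 - dist z z0 / \<rho>)" using \<eta> by simp
        then show ?thesis using test[OF \<psi>] by simp
      qed
      then show ?thesis using per' cont' by (auto simp: cell_subsolution_def viscosity_subsolution_on_def)
    qed
    moreover have "v z0 < v' z0" using v'_in[of 0 z0] r' \<kappa> by (simp add: \<phi>1_def)
    moreover have "v' x = v x" if "\<forall>k. (\<forall>i. k $ i \<in> \<int>) \<longrightarrow> r \<le> dist (x + k) z0" for x
    proof (rule v'_out)
      fix k :: "real ^ 'n" assume "\<And>i. k $ i \<in> \<int>"
      then have "r \<le> dist (x + k) z0" using that by blast
      then show "r' / 2 \<le> dist (x + k) z0" using r' by simp
    qed
    moreover have "viscosity_subsolution_on UNIV (\<lambda>y q. H y q - c + \<eta> * max 0 (1 - dist y z0 / \<rho>)) v'"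
      using test by (auto simp: viscosity_subsolution_on_def algebra_simps)
    ultimately show "\<exists>v' \<rho>. cell_subsolution H c v' \<and> v z0 < v' z0 \<and>
       (\<forall>x. (\<forall>k. (\<forall>i. k $ i \<in> \<int>) \<longrightarrow> r \<le> dist (x + k) z0) \<longrightarrow> v' x = v x) \<and> \<rho> > 0 \<and>
       viscosity_subsolution_on UNIV (\<lambda>y q. H y q - c + \<eta> * max 0 (1 - dist y z0 / \<rho>)) v'"
      using \<rho>(1) by blast
  qed
qed

text \<open>Strictness is measured by a continuous nonnegative gap: gaps add up under averaging, and
  continuity is what the convex-combination lemma asks of the Hamiltonians.\<close>

definition strict_on :: "real \<Rightarrow> (real ^ 'n) set \<Rightarrow> bool" where
  "strict_on c S \<longleftrightarrow> (\<exists>v f. cell_subsolution H c v \<and> continuous_on UNIV f \<and> (\<forall>y. 0 \<le> f y) \<and>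
     (\<forall>y\<in>S. 0 < f y) \<and> viscosity_subsolution_on UNIV (\<lambda>y q. H y q - (c - f y)) v)"

text \<open>By convexity of \<open>H\<close> the average of two subsolutions has the average of
  their gaps, which is positive as soon as one of them is.\<close>

lemma strict_on_Un:
  assumes "strict_on c S" "strict_on c T"
  shows "strict_on c (S \<union> T)"
proof -
  obtain v f where v: "cell_subsolution H c v" and f: "continuous_on UNIV f" "\<And>y. 0 \<le> f y" "\<And>y. y \<in> S \<Longrightarrow> 0 < f y"
    and vf: "viscosity_subsolution_on UNIV (\<lambda>y q. H y q - (c - f y)) v"
    using assms(1) unfolding strict_on_def by blast
  obtain w g where w: "cell_subsolution H c w" and g: "continuous_on UNIV g" "\<And>y. 0 \<le> g y" "\<And>y. y \<in> T \<Longrightarrow> 0 < g y"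
    and wg: "viscosity_subsolution_on UNIV (\<lambda>y q. H y q - (c - g y)) w"
    using assms(2) unfolding strict_on_def by blast
  obtain R where R: "0 \<le> R" "\<And>y q. H y q \<le> c \<Longrightarrow> norm q \<le> R" using sublevel_bounded by blast
  note lip = cell_subsolution_lipschitz[OF _ R]
  define u where "u z = 1 / 2 * v z + (1 - 1 / 2) * w z" for z
  define h where "h y = (f y + g y) / 2" for y
  have comb: "viscosity_subsolution_on UNIV (\<lambda>y q. H y q - C y) u"
    if sv: "viscosity_subsolution_on UNIV (\<lambda>y q. H y q - A y) v"
      and sw: "viscosity_subsolution_on UNIV (\<lambda>y q. H y q - B y) w"
      and cA: "continuous_on UNIV A" and cB: "continuous_on UNIV B"
      and AB: "\<And>y. (A y + B y) / 2 = C y" for A B C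
    unfolding u_def
  proof (rule subsolution_convex_combination[OF open_UNIV continuous_F[OF cA] continuous_F[OF cB]
        convex_sublevel closed_sublevel lip[OF v] lip[OF w] sv sw])
    fix z p q assume "H z p - A z \<le> 0" "H z q - B z \<le> 0"
    moreover have "H z ((1 / 2) *\<^sub>R p + (1 - 1 / 2) *\<^sub>R q) \<le> 1 / 2 * H z p + (1 - 1 / 2) * H z q"
      using convex_onD[OF convex, of "1/2" q p z] by (simp add: add.commute)
    ultimately show "H z ((1 / 2) *\<^sub>R p + (1 - 1 / 2) *\<^sub>R q) - C z \<le> 0"
      using AB[of z] by simp
  qed auto
  have "cell_subsolution H c u"
    using v w comb[of "\<lambda>_. c" "\<lambda>_. c" "\<lambda>_. c"]
    by (auto simp: cell_subsolution_def u_def Zn_periodic_def intro!: continuous_intros)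
  moreover have "viscosity_subsolution_on UNIV (\<lambda>y q. H y q - (c - h y)) u"
    by (rule comb[OF vf wg]) (use f g in \<open>auto simp: h_def field_simps intro!: continuous_intros\<close>)
  moreover have "continuous_on UNIV h" unfolding h_def using f g by (intro continuous_intros) auto
  moreover have "0 \<le> h y" for y using f(2)[of y] g(2)[of y] by (simp add: h_def)
  moreover have "0 < h y" if "y \<in> S \<union> T" for y
    using that f(2)[of y] g(2)[of y] f(3)[of y] g(3)[of y] by (auto simp: h_def add_pos_nonneg add_nonneg_pos)
  ultimately show ?thesis unfolding strict_on_def by blast
qed

text \<open>On a compact set containing a representative of every orbit the gap has a positive
  minimum. Periodicity spreads that minimum over the whole space, and the critical level could be
  lowered by it.\<close>

lemma not_strict_on_cball:
  assumes "strict_on critical_value (cball 0 (real CARD('n)))"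
  shows False
proof -
  let ?c = critical_value and ?C = "cball 0 (real CARD('n)) :: (real ^ 'n) set"
  obtain v f where v: "cell_subsolution H ?c v" and f: "continuous_on UNIV f" "\<And>y. y \<in> ?C \<Longrightarrow> 0 < f y"
    and vf: "viscosity_subsolution_on UNIV (\<lambda>y q. H y q - (?c - f y)) v"
    using assms unfolding strict_on_def by blast
  have "?C \<noteq> {}" by simp
  then obtain y0 where y0: "y0 \<in> ?C" "\<And>y. y \<in> ?C \<Longrightarrow> f y0 \<le> f y"
    using continuous_attains_inf[OF compact_cball] continuous_on_subset[OF f(1) subset_UNIV] by blast
  have "viscosity_subsolution_on UNIV (\<lambda>y q. H y q - (?c - f y0)) v"
    unfolding viscosity_subsolution_on_def
  proof (intro allI impI)
    fix \<phi> D and z :: "real ^ 'n"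
    assume *: "C1_with_gradient_on UNIV \<phi> D" "z \<in> UNIV" "\<forall>\<^sub>F w in nhds z. v w - \<phi> w \<le> v z - \<phi> z"
    obtain k where k: "\<And>i. k $ i \<in> \<int>" "norm (z + k) \<le> CARD('n)" using lattice_point_near by blast
    have "(\<lambda>w. v (w + k)) = v"
      using v k(1) by (auto simp: cell_subsolution_def Zn_periodicD)
    then have "viscosity_subsolution_on UNIV (\<lambda>w q. H (w + k) q - (?c - f (w + k))) v"
      using viscosity_subsolution_on_translate[OF vf, of k] by simp
    then have "H (z + k) (D z) - (?c - f (z + k)) \<le> 0"
      using viscosity_subsolution_onD[OF _ *] by blast
    then show "H z (D z) - (?c - f y0) \<le> 0"
      using y0(2)[of "z + k"] k by (simp add: H_lattice)
  qed
  then have "cell_subsolution H (?c - f y0) v" using v by (simp add: cell_subsolution_def)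
  then show False using critical_value_le f(2)[OF y0(1)] by force
qed

text \<open>If no critical subsolution were a supersolution, then the bump on the Mane potential
  based at \<open>y\<close> could only sit at \<open>y\<close>, so there would be critical subsolutions that are
  strict near any prescribed point; averaging finitely many contradicts criticality.\<close>

theorem cell_problem_solvable:
  "\<exists>v. cell_subsolution H critical_value v \<and>
     viscosity_supersolution_on UNIV (\<lambda>y q. H y q - critical_value) v"
proof (rule ccontr)
  let ?c = critical_value
  assume none: "\<not> ?thesis"
  define \<V> where "\<V> = {v. cell_subsolution H ?c v}"
  have ne: "\<V> \<noteq> {}" using critical_subsolution_exists by (simp add: \<V>_def)
  obtain R where R: "0 \<le> R" "\<And>y q. H y q \<le> ?c \<Longrightarrow> norm q \<le> R" using sublevel_bounded by blast
  have lip: "R-lipschitz_on UNIV v" if "v \<in> \<V>" for v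
    by (rule cell_subsolution_lipschitz[OF _ R]) (use that in \<open>auto simp: \<V>_def\<close>)
  have point: "\<exists>U. open U \<and> y \<in> U \<and> strict_on ?c U" for y
  proof -
    \<comment> \<open>The Mane potential: the largest critical subsolution that vanishes at
      \<open>y\<close>.\<close>
    define A where "A x = (SUP v\<in>\<V>. v x + - v y)" for x
    have bdd: "bdd_above ((\<lambda>v. v x + - v y) ` \<V>)" for x
    proof (rule bdd_aboveI2)
      fix v assume "v \<in> \<V>"
      then show "v x + - v y \<le> R * dist x y"
        using lipschitz_onD[OF lip, of v x y] by (simp add: dist_real_def abs_le_iff)
    qed
    have A: "cell_subsolution H ?c A"
      unfolding A_def by (rule cell_subsolution_SUP[OF cell_subsolution_add_const ne bdd]) (simp add: \<V>_def)
    have Ay: "A y = 0" using ne by (simp add: A_def)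
    have "\<not> viscosity_supersolution_on UNIV (\<lambda>y q. H y q - ?c) A" using none A by blast
    from perron_bump[OF A this] obtain z0 \<eta> where "\<eta> > 0 \<and> (\<forall>r>0. \<exists>v' \<rho>. cell_subsolution H ?c v' \<and> A z0 < v' z0 \<and>
       (\<forall>x. (\<forall>k. (\<forall>i. k $ i \<in> \<int>) \<longrightarrow> r \<le> dist (x + k) z0) \<longrightarrow> v' x = A x) \<and> \<rho> > 0 \<and>
       viscosity_subsolution_on UNIV (\<lambda>y q. H y q - ?c + \<eta> * max 0 (1 - dist y z0 / \<rho>)) v')"
      by (elim exE) (rule that)
    note \<eta> = this[THEN conjunct1] and bump = this[THEN conjunct2, rule_format]
    show ?thesis
    proof (cases "\<exists>k. (\<forall>i. k $ i \<in> \<int>) \<and> y + k = z0")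
      case True
      then obtain k where k: "\<And>i. k $ i \<in> \<int>" "y + k = z0" by blast
      obtain v' \<rho> where v': "cell_subsolution H ?c v'" "\<rho> > 0"
        "viscosity_subsolution_on UNIV (\<lambda>y q. H y q - ?c + \<eta> * max 0 (1 - dist y z0 / \<rho>)) v'"
        using bump[of 1] by auto
      \<comment> \<open>Here \<open>z0\<close> is a translate of the base point, so maximality of
        \<open>A\<close> is not violated. The strictness near \<open>z0\<close> is carried back by
        the translation \<open>k\<close> to a neighbourhood of \<open>y\<close>.\<close>
      define f where "f z = \<eta> * max 0 (1 - dist (z + k) z0 / \<rho>)" for z
      have cf: "continuous_on UNIV f" unfolding f_def using v'(2) by (intro continuous_intros) auto
      have "(\<lambda>w. v' (w + k)) = v'"
        using v'(1) k(1) by (auto simp: cell_subsolution_def Zn_periodicD)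
      then have "viscosity_subsolution_on UNIV (\<lambda>z q. H z q - (?c - f z)) v'"
        using viscosity_subsolution_on_translate[OF v'(3), of k] by (simp add: f_def H_lattice[OF k(1)] algebra_simps)
      then have "strict_on ?c {z. 0 < f z}"
        using v' cf \<eta> unfolding strict_on_def by (intro exI[of _ v'] exI[of _ f]) (auto simp: f_def)
      moreover have "open {z. 0 < f z}" by (intro open_Collect_less continuous_intros cf)
      moreover have "y \<in> {z. 0 < f z}" using k \<eta> by (simp add: f_def)
      ultimately show ?thesis by blast
    next
      case False
      then have "\<forall>k. (\<forall>i. k $ i \<in> \<int>) \<longrightarrow> y + k \<noteq> z0" by blast
      from lattice_distance_pos[OF this]
      obtain r where r: "r > 0" and away: "\<forall>k. (\<forall>i. k $ i \<in> \<int>) \<longrightarrow> r \<le> dist (y + k) z0"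
        by (elim exE conjE) (rule that)
      from bump[OF r] obtain v' where v': "cell_subsolution H ?c v'" "A z0 < v' z0"
        "\<forall>x. (\<forall>k. (\<forall>i. k $ i \<in> \<int>) \<longrightarrow> r \<le> dist (x + k) z0) \<longrightarrow> v' x = A x"
        by (elim exE conjE) (rule that)
      have "v' y = A y" by (rule v'(3)[THEN spec, THEN mp, OF away])
      \<comment> \<open>The bump leaves the value at \<open>y\<close> unchanged, so
        \<open>v'\<close> competes in the supremum that defines \<open>A\<close>, yet it exceeds
        \<open>A\<close> at \<open>z0\<close>.\<close>
      have "v' z0 + - v' y \<le> A z0" unfolding A_def using v'(1) by (intro cSUP_upper bdd) (simp add: \<V>_def)
      then show ?thesis using v'(2) \<open>v' y = A y\<close> Ay by simp
    qed
  qed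
  then obtain U where U: "\<And>y. open (U y)" "\<And>y. y \<in> U y" "\<And>y. strict_on ?c (U y)" by metis
  have "cball 0 (real CARD('n)) \<subseteq> (\<Union>y\<in>UNIV. U y)" using U(2) by blast
  then obtain T where T: "finite T" "cball 0 (real CARD('n)) \<subseteq> (\<Union>y\<in>T. U y)"
    by (rule compactE_image[OF compact_cball U(1)])
  have "strict_on ?c (\<Union>y\<in>T. U y)"
    using T(1)
  proof induction
    case empty
    obtain v where "cell_subsolution H ?c v" using critical_subsolution_exists by blast
    then show ?case unfolding strict_on_def
      by (intro exI[of _ v] exI[of _ "\<lambda>_. 0"]) (auto simp: cell_subsolution_def)
  next
    case (insert y T)
    then show ?case using strict_on_Un[OF U(3)] by simp
  qed
  then have "strict_on ?c (cball 0 (real CARD('n)))"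
    using T(2) unfolding strict_on_def by blast
  then show False by (rule not_strict_on_cball)
qed

end

section \<open>The effective Hamiltonian and the convergence rate\<close>

lemma uniformly_continuous_on_subset:
  fixes f :: "'a::metric_space \<Rightarrow> 'b::metric_space"
  assumes "uniformly_continuous_on S f" "T \<subseteq> S"
  shows "uniformly_continuous_on T f"
  using assms unfolding uniformly_continuous_on_def by (meson subsetD)

lemma C1_with_gradient_on_uminus:
  assumes "C1_with_gradient_on \<Omega> \<phi> D"
  shows "C1_with_gradient_on \<Omega> (\<lambda>z. - \<phi> z) (\<lambda>z. - D z)"
  using assms unfolding C1_with_gradient_on_def gderiv_def
  by (auto intro!: derivative_eq_intros continuous_intros)

text \<open>This reflection lets the supersolution property of corrected planes, and of the zero
  corrector, be read off from the argument for subsolutions.\<close>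

lemma viscosity_supersolution_iff_subsolution:
  "viscosity_supersolution_on \<Omega> F u \<longleftrightarrow> viscosity_subsolution_on \<Omega> (\<lambda>z q. - F z (- q)) (\<lambda>z. - u z)"
proof
  assume super: "viscosity_supersolution_on \<Omega> F u"
  show "viscosity_subsolution_on \<Omega> (\<lambda>z q. - F z (- q)) (\<lambda>z. - u z)"
    unfolding viscosity_subsolution_on_def
  proof (intro allI impI)
    fix \<phi> D z
    assume *: "C1_with_gradient_on \<Omega> \<phi> D" "z \<in> \<Omega>" "\<forall>\<^sub>F w in nhds z. - u w - \<phi> w \<le> - u z - \<phi> z"
    from *(3) have "\<forall>\<^sub>F w in nhds z. u w - - \<phi> w \<ge> u z - - \<phi> z" by eventually_elim simp
    then show "- F z (- D z) \<le> 0"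
      using viscosity_supersolution_onD[OF super C1_with_gradient_on_uminus[OF *(1)] *(2)] by simp
  qed
next
  assume sub: "viscosity_subsolution_on \<Omega> (\<lambda>z q. - F z (- q)) (\<lambda>z. - u z)"
  show "viscosity_supersolution_on \<Omega> F u"
    unfolding viscosity_supersolution_on_def
  proof (intro allI impI)
    fix \<phi> D z
    assume *: "C1_with_gradient_on \<Omega> \<phi> D" "z \<in> \<Omega>" "\<forall>\<^sub>F w in nhds z. u w - \<phi> w \<ge> u z - \<phi> z"
    from *(3) have "\<forall>\<^sub>F w in nhds z. - u w - - \<phi> w \<le> - u z - - \<phi> z" by eventually_elim simp
    then show "F z (D z) \<ge> 0"
      using viscosity_subsolution_onD[OF sub C1_with_gradient_on_uminus[OF *(1)] *(2)] by simp
  qed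
qed

lemma viscosity_supersolution_on_add_const:
  "viscosity_supersolution_on \<Omega> F (\<lambda>z. u z + c) \<longleftrightarrow> viscosity_supersolution_on \<Omega> F u"
  unfolding viscosity_supersolution_on_def by (simp add: algebra_simps)

text \<open>The two-scale ansatz with corrector \<open>v\<close>. With the zero corrector it is a
  plane solution of the effective equation; with \<open>p = 0\<close> and \<epsilon> = 1 it turns a
  solution of the cell problem into one of the Cauchy problem.\<close>

definition corrected_plane ::
  "real \<Rightarrow> 'a::euclidean_space \<Rightarrow> real \<Rightarrow> real \<Rightarrow> ('a \<Rightarrow> real) \<Rightarrow> 'a \<times> real \<Rightarrow> real" where
  "corrected_plane a p c \<epsilon> v = (\<lambda>(x, t). a + p \<bullet> x - c * t + \<epsilon> * v (x /\<^sub>R \<epsilon>))"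

text \<open>Time and space separate. In time the function is affine, so a touching test function has
  time derivative exactly \<open>- c\<close>; a slice at fixed time, rescaled, is a test function
  for the corrector.\<close>

lemma corrected_plane_subsolution:
  fixes v :: "'a::euclidean_space \<Rightarrow> real"
  assumes sub: "viscosity_subsolution_on UNIV (\<lambda>y q. H y (p + q) - c) v" and "\<epsilon> > 0"
  shows "viscosity_subsolution_on (UNIV \<times> {0<..}) (\<lambda>(x, t) (q, \<tau>). \<tau> + H (x /\<^sub>R \<epsilon>) q)
    (corrected_plane a p c \<epsilon> v)"
  unfolding viscosity_subsolution_on_def
proof (intro allI impI)
  let ?W = "corrected_plane a p c \<epsilon> v"
  fix \<phi> :: "'a \<times> real \<Rightarrow> real" and D and z :: "'a \<times> real"
  assume C1: "C1_with_gradient_on (UNIV \<times> {0<..}) \<phi> D" and z: "z \<in> UNIV \<times> {0<..}"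
    and touch: "\<forall>\<^sub>F w in nhds z. ?W w - \<phi> w \<le> ?W z - \<phi> z"
  obtain x t where zxt: "z = (x, t)" by (cases z)
  then have t: "t > 0" using z by simp
  have der: "(\<phi> has_derivative (\<lambda>h. h \<bullet> D w)) (at w)" if "snd w > 0" for w
    using C1 that by (cases w) (simp add: C1_with_gradient_on_def gderiv_def)
  have contD: "continuous_on (UNIV \<times> {0<..}) D" using C1 by (simp add: C1_with_gradient_on_def)
  obtain q \<tau> where D: "D (x, t) = (q, \<tau>)" by (cases "D (x, t)")
  have "\<tau> = - c"
  proof -
    have 1: "((\<lambda>s. (x, s)) has_derivative (\<lambda>h. (0, h))) (at t)" by (auto intro!: derivative_eq_intros)
    have "((\<lambda>s. \<phi> (x, s)) has_derivative (\<lambda>h. (0, h) \<bullet> D (x, t))) (at t)"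
      using diff_chain_at[OF 1 der[of "(x, t)"]] t by (simp add: o_def)
    then have "DERIV (\<lambda>s. \<phi> (x, s)) t :> \<tau>"
      by (simp add: D has_field_derivative_def mult.commute[of _ \<tau>])
    then have d: "DERIV (\<lambda>s. - c * s - \<phi> (x, s)) t :> - c - \<tau>"
      by (auto intro!: derivative_eq_intros)
    have "filterlim (\<lambda>s. (x, s)) (nhds (x, t)) (nhds t)" by (intro tendsto_intros filterlim_ident)
    then have "\<forall>\<^sub>F s in nhds t. ?W (x, s) - \<phi> (x, s) \<le> ?W (x, t) - \<phi> (x, t)"
      using touch unfolding zxt filterlim_iff by blast
    then have "\<forall>\<^sub>F s in nhds t. - c * s - \<phi> (x, s) \<le> - c * t - \<phi> (x, t)"
      by eventually_elim (simp add: corrected_plane_def)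
    then obtain e where e: "e > 0" "\<And>s. dist s t < e \<Longrightarrow> - c * s - \<phi> (x, s) \<le> - c * t - \<phi> (x, t)"
      unfolding eventually_nhds_metric by blast
    have "- c - \<tau> = 0"
      by (rule DERIV_local_max[OF d e(1)]) (use e(2) in \<open>auto simp: dist_real_def abs_minus_commute\<close>)
    then show ?thesis by simp
  qed
  moreover have "H (x /\<^sub>R \<epsilon>) q \<le> c"
  proof -
    \<comment> \<open>Undoing the scaling and removing the affine part, so that \<psi> touches
      \<open>v\<close> at \<open>x /\<^sub>R \<epsilon>\<close>; its gradient is the spatial
      gradient of \<phi> minus \<open>p\<close>.\<close>
    define \<psi> where "\<psi> y = (\<phi> (\<epsilon> *\<^sub>R y, t) - p \<bullet> (\<epsilon> *\<^sub>R y)) / \<epsilon>" for y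
    define E where "E y = fst (D (\<epsilon> *\<^sub>R y, t)) - p" for y
    have "GDERIV \<psi> y :> E y" for y
    proof -
      have 1: "((\<lambda>y. (\<epsilon> *\<^sub>R y, t)) has_derivative (\<lambda>h. (\<epsilon> *\<^sub>R h, 0))) (at y)"
        by (auto intro!: derivative_eq_intros)
      have "((\<lambda>y. \<phi> (\<epsilon> *\<^sub>R y, t)) has_derivative (\<lambda>h. (\<epsilon> *\<^sub>R h, 0) \<bullet> D (\<epsilon> *\<^sub>R y, t))) (at y)"
        using diff_chain_at[OF 1 der[of "(\<epsilon> *\<^sub>R y, t)"]] t by (simp add: o_def)
      then have "((\<lambda>y. (\<phi> (\<epsilon> *\<^sub>R y, t) - p \<bullet> (\<epsilon> *\<^sub>R y)) * (1 / \<epsilon>)) has_derivative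
          (\<lambda>h. ((\<epsilon> *\<^sub>R h, 0) \<bullet> D (\<epsilon> *\<^sub>R y, t) - p \<bullet> (\<epsilon> *\<^sub>R h)) * (1 / \<epsilon>))) (at y)"
        using \<open>\<epsilon> > 0\<close> by (auto intro!: derivative_eq_intros)
      also have "(\<lambda>h. ((\<epsilon> *\<^sub>R h, 0) \<bullet> D (\<epsilon> *\<^sub>R y, t) - p \<bullet> (\<epsilon> *\<^sub>R h)) * (1 / \<epsilon>)) = (\<lambda>h. h \<bullet> E y)"
        using \<open>\<epsilon> > 0\<close>
        by (intro ext) (simp add: E_def inner_prod_def inner_diff_right inner_commute right_diff_distrib diff_divide_distrib)
      finally show ?thesis by (simp add: gderiv_def \<psi>_def[abs_def])
    qed
    moreover have "continuous_on UNIV E"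
    proof -
      have "continuous_on UNIV (\<lambda>y. D (\<epsilon> *\<^sub>R y, t))"
        by (rule continuous_on_compose2[OF contD, of UNIV "\<lambda>y. (\<epsilon> *\<^sub>R y, t)"])
           (use t in \<open>auto intro!: continuous_intros\<close>)
      then show ?thesis unfolding E_def by (intro continuous_intros)
    qed
    ultimately have C1': "C1_with_gradient_on UNIV \<psi> E" by (simp add: C1_with_gradient_on_def)
    have "filterlim (\<lambda>y. (\<epsilon> *\<^sub>R y, t)) (nhds (\<epsilon> *\<^sub>R (x /\<^sub>R \<epsilon>), t)) (nhds (x /\<^sub>R \<epsilon>))"
      by (intro tendsto_intros filterlim_ident)
    then have "filterlim (\<lambda>y. (\<epsilon> *\<^sub>R y, t)) (nhds (x, t)) (nhds (x /\<^sub>R \<epsilon>))"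
      using \<open>\<epsilon> > 0\<close> by simp
    then have "\<forall>\<^sub>F y in nhds (x /\<^sub>R \<epsilon>). ?W (\<epsilon> *\<^sub>R y, t) - \<phi> (\<epsilon> *\<^sub>R y, t) \<le> ?W (x, t) - \<phi> (x, t)"
      using touch unfolding zxt filterlim_iff by blast
    then have "\<forall>\<^sub>F y in nhds (x /\<^sub>R \<epsilon>). v y - \<psi> y \<le> v (x /\<^sub>R \<epsilon>) - \<psi> (x /\<^sub>R \<epsilon>)"
    proof eventually_elim
      case (elim y)
      have \<epsilon>\<psi>: "\<epsilon> * \<psi> y = \<phi> (\<epsilon> *\<^sub>R y, t) - p \<bullet> (\<epsilon> *\<^sub>R y)" for y
        using \<open>\<epsilon> > 0\<close> by (simp add: \<psi>_def)
      have "\<epsilon> * (v y - \<psi> y) \<le> \<epsilon> * (v (x /\<^sub>R \<epsilon>) - \<psi> (x /\<^sub>R \<epsilon>))"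
        using elim \<open>\<epsilon> > 0\<close> by (simp add: corrected_plane_def right_diff_distrib \<epsilon>\<psi> del: inner_scaleR_right)
      then show ?case using \<open>\<epsilon> > 0\<close> by simp
    qed
    from viscosity_subsolution_onD[OF sub C1' UNIV_I this]
    show ?thesis using \<open>\<epsilon> > 0\<close> by (simp add: E_def D)
  qed
  ultimately show "(case z of (x, t) \<Rightarrow> \<lambda>(q, \<tau>). \<tau> + H (x /\<^sub>R \<epsilon>) q) (D z) \<le> 0"
    by (simp add: zxt D)
qed

lemma corrected_plane_supersolution:
  fixes v :: "'a::euclidean_space \<Rightarrow> real"
  assumes super: "viscosity_supersolution_on UNIV (\<lambda>y q. H y (p + q) - c) v" and "\<epsilon> > 0"
  shows "viscosity_supersolution_on (UNIV \<times> {0<..}) (\<lambda>(x, t) (q, \<tau>). \<tau> + H (x /\<^sub>R \<epsilon>) q)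
    (corrected_plane a p c \<epsilon> v)"
proof -
  have "viscosity_subsolution_on UNIV (\<lambda>y q. - H y (- (- p + q)) - - c) (\<lambda>z. - v z)"
    using super unfolding viscosity_supersolution_iff_subsolution by simp
  note sub = corrected_plane_subsolution[where H = "\<lambda>y q. - H y (- q)", OF this \<open>\<epsilon> > 0\<close>, of "- a"]
  have neg: "corrected_plane (- a) (- p) (- c) \<epsilon> (\<lambda>z. - v z) = (\<lambda>z. - corrected_plane a p c \<epsilon> v z)"
    by (auto simp: corrected_plane_def)
  have dual: "(\<lambda>(x, t) (q, \<tau>). \<tau> + - H (x /\<^sub>R \<epsilon>) (- q)) =
      (\<lambda>z q. - (case z of (x, t) \<Rightarrow> \<lambda>(q, \<tau>). \<tau> + H (x /\<^sub>R \<epsilon>) q) (- q))"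
    by (auto simp: fun_eq_iff)
  show ?thesis
    unfolding viscosity_supersolution_iff_subsolution using sub unfolding neg dual .
qed

lemma corrected_plane_lipschitz:
  assumes "M-lipschitz_on UNIV v" "norm p \<le> P" "\<bar>c\<bar> \<le> K" "\<epsilon> > 0"
  shows "(P + K + M)-lipschitz_on UNIV (corrected_plane a p c \<epsilon> v)"
proof (rule lipschitz_onI)
  have M: "M \<ge> 0" using assms(1) by (simp add: lipschitz_on_def)
  have P: "P \<ge> 0" using assms(2) norm_ge_zero order_trans by blast
  then show "0 \<le> P + K + M" using M assms(3) by simp
  fix z w :: "'a \<times> real"
  obtain x t y s where z: "z = (x, t)" and w: "w = (y, s)" by (metis surj_pair)
  have dx: "dist x y \<le> dist z w" and dt: "dist t s \<le> dist z w"
    using dist_fst_le[of z w] dist_snd_le[of z w] by (auto simp: z w)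
  have "\<bar>p \<bullet> x - p \<bullet> y\<bar> \<le> norm p * norm (x - y)"
    using Cauchy_Schwarz_ineq2[of p "x - y"] by (simp add: inner_diff_right)
  also have "\<dots> \<le> P * dist z w"
    using assms(2) dx P by (intro mult_mono) (auto simp: dist_norm)
  finally have 1: "\<bar>p \<bullet> x - p \<bullet> y\<bar> \<le> P * dist z w" .
  have "\<bar>c * t - c * s\<bar> = \<bar>c\<bar> * dist t s" by (simp add: dist_real_def flip: abs_mult right_diff_distrib)
  also have "\<dots> \<le> K * dist z w" using assms(3) dt by (intro mult_mono) auto
  finally have 2: "\<bar>c * t - c * s\<bar> \<le> K * dist z w" .
  have "\<bar>\<epsilon> * v (x /\<^sub>R \<epsilon>) - \<epsilon> * v (y /\<^sub>R \<epsilon>)\<bar> = \<epsilon> * dist (v (x /\<^sub>R \<epsilon>)) (v (y /\<^sub>R \<epsilon>))"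
    using \<open>\<epsilon> > 0\<close> by (simp add: dist_real_def abs_mult flip: right_diff_distrib)
  also have "\<dots> \<le> \<epsilon> * (M * dist (x /\<^sub>R \<epsilon>) (y /\<^sub>R \<epsilon>))"
    using \<open>\<epsilon> > 0\<close> by (intro mult_left_mono lipschitz_onD[OF assms(1)]) auto
  also have "\<dots> = M * dist x y"
    using \<open>\<epsilon> > 0\<close> by (simp add: dist_norm flip: scaleR_diff_right)
  also have "\<dots> \<le> M * dist z w" using dx M by (rule mult_left_mono)
  finally have 3: "\<bar>\<epsilon> * v (x /\<^sub>R \<epsilon>) - \<epsilon> * v (y /\<^sub>R \<epsilon>)\<bar> \<le> M * dist z w" .
  show "dist (corrected_plane a p c \<epsilon> v z) (corrected_plane a p c \<epsilon> v w) \<le> (P + K + M) * dist z w"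
    using 1 2 3 by (simp add: corrected_plane_def z w dist_real_def distrib_right)
qed

text \<open>The effective equation has no oscillation, so its corrector is trivial and both
  equations can be handled with \<open>corrected_plane\<close>.\<close>

lemma zero_solves_constant_cell_problem:
  fixes G :: "'a::euclidean_space \<Rightarrow> real"
  shows "viscosity_subsolution_on UNIV (\<lambda>y q. G (p + q) - G p) (\<lambda>_::'a. 0)"
    and "viscosity_supersolution_on UNIV (\<lambda>y q. G (p + q) - G p) (\<lambda>_::'a. 0)"
proof -
  have *: "D z = 0"
    if "C1_with_gradient_on UNIV \<phi> D" "\<forall>\<^sub>F w in nhds z. 0 - \<phi> w \<le> 0 - \<phi> z" for \<phi> D and z :: 'a
  proof -
    have "norm (D z) \<le> 0"
      by (rule lipschitz_touching_norm_le[of 0 UNIV "\<lambda>_. 0" z \<phi>])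
         (use that in \<open>auto simp: lipschitz_on_def C1_with_gradient_on_def\<close>)
    then show ?thesis by simp
  qed
  show "viscosity_subsolution_on UNIV (\<lambda>y q. G (p + q) - G p) (\<lambda>_::'a. 0)"
    unfolding viscosity_subsolution_on_def using * by fastforce
  show "viscosity_supersolution_on UNIV (\<lambda>y q. G (p + q) - G p) (\<lambda>_::'a. 0)"
    unfolding viscosity_supersolution_iff_subsolution viscosity_subsolution_on_def using * by fastforce
qed

section \<open>Concave data as infima of planes, and the squeeze by comparison\<close>

lemma concave_affine_majorant:
  fixes g :: "'a::euclidean_space \<Rightarrow> real"
  assumes conc: "concave_on UNIV g" and cont: "continuous_on UNIV g" and "\<eta> > 0"
  shows "\<exists>a p. (\<forall>y. g y \<le> a + p \<bullet> y) \<and> a + p \<bullet> x < g x + \<eta>"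
proof -
  \<comment> \<open>Separating a point strictly above the graph from the closed hypograph gives a
    majorant that is within \<eta> at \<open>x\<close>, which is enough for an infimum; exact
    contact is never asked for.\<close>
  let ?S = "{z. snd z \<le> g (fst z)}"
  have "convex ?S"
  proof (rule convexI, clarsimp)
    fix x y :: 'a and r s u v :: real
    assume *: "r \<le> g x" "s \<le> g y" "0 \<le> u" "0 \<le> v" "u + v = 1"
    then have "u * r + v * s \<le> u * g x + v * g y" by (intro add_mono mult_left_mono)
    also have "\<dots> \<le> g (u *\<^sub>R x + v *\<^sub>R y)"
      using conc * unfolding concave_on_iff by simp
    finally show "u * r + v * s \<le> g (u *\<^sub>R x + v *\<^sub>R y)" .
  qed
  moreover have "closed ?S"
  proof -
    have "continuous_on UNIV (\<lambda>z :: 'a \<times> real. g (fst z))"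
      by (rule continuous_on_compose2[OF cont]) (auto intro: continuous_intros)
    then show ?thesis by (intro closed_Collect_le continuous_intros)
  qed
  moreover have "(x, g x + \<eta>) \<notin> ?S" using \<open>\<eta> > 0\<close> by simp
  ultimately have "\<exists>n b. n \<bullet> (x, g x + \<eta>) < b \<and> (\<forall>z\<in>?S. b < n \<bullet> z)"
    by (rule separating_hyperplane_closed_point)
  then obtain n b where nb: "n \<bullet> (x, g x + \<eta>) < b" "\<forall>z\<in>?S. b < n \<bullet> z" by (elim exE conjE) (rule that)
  obtain \<alpha> \<beta> where n: "n = (\<alpha>, \<beta>)" by (cases n)
  have at: "b < \<alpha> \<bullet> y + \<beta> * g y" for y using nb(2)[THEN bspec, of "(y, g y)"] by (simp add: n)
  have x: "\<alpha> \<bullet> x + \<beta> * (g x + \<eta>) < b" using nb(1) by (simp add: n)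
  \<comment> \<open>Two points above the same \<open>x\<close> lie on opposite sides, so the
    hyperplane is not vertical and can be solved for the last coordinate.\<close>
  have "\<beta> * \<eta> < 0" using at[of x] x by (simp add: algebra_simps)
  then have \<beta>: "\<beta> < 0" using \<open>\<eta> > 0\<close> by (simp add: mult_less_0_iff)
  show ?thesis
  proof (intro exI[of _ "b / \<beta>"] exI[of _ "(- 1 / \<beta>) *\<^sub>R \<alpha>"] conjI allI)
    show "g y \<le> b / \<beta> + (- 1 / \<beta>) *\<^sub>R \<alpha> \<bullet> y" for y
      using at[of y] \<beta> by (simp add: field_simps)
    show "b / \<beta> + (- 1 / \<beta>) *\<^sub>R \<alpha> \<bullet> x < g x + \<eta>"
      using x \<beta> by (simp add: field_simps)
  qed
qed

text \<open>Along \<open>- p\<close> the plane falls at rate |p|^2 while \<open>g\<close> falls at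
  rate at most L |p|; a steeper plane would eventually cross \<open>g\<close>. The slopes therefore
  stay in a ball depending on \<open>L\<close> alone.\<close>

lemma affine_majorant_slope:
  fixes g :: "'a::euclidean_space \<Rightarrow> real"
  assumes lip: "L-lipschitz_on UNIV g" and maj: "\<And>y. g y \<le> a + p \<bullet> y"
  shows "norm p \<le> L"
proof (rule ccontr)
  assume "\<not> norm p \<le> L"
  then have pos: "norm p * (norm p - L) > 0"
    using lip by (auto simp: lipschitz_on_def intro!: mult_pos_pos)
  define X where "X = norm p * (norm p - L)"
  have X: "X > 0" using pos by (simp add: X_def)
  define s where "s = (\<bar>a - g 0\<bar> + 1) / X"
  have s: "s > 0" using X by (simp add: s_def add_nonneg_pos)
  have "g 0 - L * (s * norm p) \<le> g (- (s *\<^sub>R p))"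
    using lipschitz_onD[OF lip, of 0 "- (s *\<^sub>R p)"] s by (simp add: dist_real_def abs_le_iff)
  also have "\<dots> \<le> a - s * (norm p)\<^sup>2"
    using maj[of "- (s *\<^sub>R p)"] by (simp add: power2_norm_eq_inner)
  finally have "s * X \<le> a - g 0"
    by (simp add: X_def power2_eq_square algebra_simps)
  moreover have "s * X = \<bar>a - g 0\<bar> + 1" using X by (simp add: s_def)
  ultimately show False by linarith
qed

text \<open>The two inequalities use different objects: each \<open>w i\<close> separately as a
  supersolution above \<open>u\<close>, and the infimum, lowered by \<kappa>, as one subsolution
  below \<open>u\<close>. The second is where convexity enters, since \<tau> + G(x, q) is convex
  jointly in (q, \<tau>).\<close>

lemma Cauchy_solution_INF_bounds:
  fixes w :: "'i \<Rightarrow> (real ^ 'n) \<times> real \<Rightarrow> real"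
  assumes conv: "\<And>x. convex_on UNIV (G x)"
    and contG: "continuous_on UNIV (\<lambda>(x, q). G x q)"
    and unif: "\<And>R. uniformly_continuous_on (UNIV \<times> cball 0 R) (\<lambda>(x, q). G x q)"
    and u: "Cauchy_viscosity_solution G g u"
    and "I \<noteq> {}"
    and lip: "\<And>i. i \<in> I \<Longrightarrow> M-lipschitz_on UNIV (w i)"
    and sub: "\<And>i. i \<in> I \<Longrightarrow> viscosity_subsolution_on (UNIV \<times> {0<..}) (\<lambda>(x, t) (q, \<tau>). \<tau> + G x q) (w i)"
    and super: "\<And>i. i \<in> I \<Longrightarrow> viscosity_supersolution_on (UNIV \<times> {0<..}) (\<lambda>(x, t) (q, \<tau>). \<tau> + G x q) (w i)"
    and bdd: "\<And>z. bdd_below ((\<lambda>i. w i z) ` I)"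
    and above: "\<And>i x. i \<in> I \<Longrightarrow> g x \<le> w i (x, 0)"
    and below: "\<And>x. (INF i\<in>I. w i (x, 0)) \<le> g x + \<kappa>"
    and "0 \<le> t"
  shows "u (x, t) \<le> (INF i\<in>I. w i (x, t)) \<and> (INF i\<in>I. w i (x, t)) \<le> u (x, t) + \<kappa>"
proof
  let ?\<Omega> = "UNIV \<times> {0<..} :: ((real ^ 'n) \<times> real) set"
  let ?S = "UNIV \<times> {0..} :: ((real ^ 'n) \<times> real) set"
  let ?F = "\<lambda>(x :: real ^ 'n, t :: real) (q :: real ^ 'n, \<tau> :: real). \<tau> + G x q"
  obtain N where N: "N-lipschitz_on ?S u" using u by (auto simp: Cauchy_viscosity_solution_def)
  have usub: "viscosity_subsolution_on ?\<Omega> ?F u" and usuper: "viscosity_supersolution_on ?\<Omega> ?F u"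
    and u0: "\<And>x. u (x, 0) = g x"
    using u by (auto simp: Cauchy_viscosity_solution_def viscosity_solution_on_def)
  have lipu: "(max M N)-lipschitz_on ?S u" using N by (rule lipschitz_on_le) simp
  have lipw: "(max M N)-lipschitz_on ?S f" if "M-lipschitz_on UNIV f" for f :: "_ \<Rightarrow> real"
    by (rule lipschitz_on_le[OF lipschitz_on_subset[OF that]]) auto
  show "u (x, t) \<le> (INF i\<in>I. w i (x, t))"
  proof (rule cINF_greatest[OF \<open>I \<noteq> {}\<close>])
    fix i assume i: "i \<in> I"
    show "u (x, t) \<le> w i (x, t)"
      by (rule Cauchy_comparison[OF unif lipu lipw[OF lip[OF i]] usub super[OF i] _ \<open>0 \<le> t\<close>])
         (simp add: u0 above[OF i])
  qed
  define W where "W z = (INF i\<in>I. w i z)" for z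
  have "viscosity_subsolution_on ?\<Omega> ?F W"
    unfolding W_def
  proof (rule subsolution_INF[OF _ _ _ lipschitz_on_subset[OF lip] sub \<open>I \<noteq> {}\<close> bdd])
    show "open ?\<Omega>" by (intro open_Times) auto
    have "(\<lambda>(z, q). ?F z q) = (\<lambda>z. snd (snd z) + (\<lambda>(x, q). G x q) (fst (fst z), fst (snd z)))"
      by (auto simp: fun_eq_iff)
    then show "continuous_on (?\<Omega> \<times> UNIV) (\<lambda>(z, q). ?F z q)"
      by (simp only:) (intro continuous_intros continuous_on_compose2[OF contG] subset_UNIV)
    fix z :: "(real ^ 'n) \<times> real"
    obtain x t where z: "z = (x, t)" by (cases z)
    have "convex_on UNIV (\<lambda>(q, \<tau>). \<tau> + G x q)"
    proof (rule convex_onI)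
      fix s :: real and a b :: "(real ^ 'n) \<times> real" assume s: "0 < s" "s < 1"
      then show "(case (1 - s) *\<^sub>R a + s *\<^sub>R b of (q, \<tau>) \<Rightarrow> \<tau> + G x q) \<le>
          (1 - s) * (case a of (q, \<tau>) \<Rightarrow> \<tau> + G x q) + s * (case b of (q, \<tau>) \<Rightarrow> \<tau> + G x q)"
        using convex_onD[OF conv[of x], of s "fst a" "fst b"]
        by (cases a; cases b) (simp add: algebra_simps)
    qed simp
    from convex_bounded_sublevel[OF this, of M 0] show "convex {q. norm q \<le> M \<and> ?F z q \<le> 0}" by (simp add: z)
  qed auto
  then have Wsub: "viscosity_subsolution_on ?\<Omega> ?F (\<lambda>z. W z + - \<kappa>)"
    by (simp only: viscosity_subsolution_on_add_const)
  have "M-lipschitz_on UNIV W" unfolding W_def by (rule lipschitz_on_INF[OF lip \<open>I \<noteq> {}\<close> bdd])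
  then have "M-lipschitz_on UNIV (\<lambda>z. W z + - \<kappa>)" by (simp add: lipschitz_on_def dist_real_def)
  moreover have "W (y, 0) + - \<kappa> \<le> u (y, 0)" for y using below[of y] by (simp add: u0 W_def)
  ultimately have "W (x, t) + - \<kappa> \<le> u (x, t)"
    by (intro Cauchy_comparison[OF unif lipw lipu Wsub usuper _ \<open>0 \<le> t\<close>])
  then show "(INF i\<in>I. w i (x, t)) \<le> u (x, t) + \<kappa>" by (simp add: W_def)
qed

section \<open>The effective Hamiltonian: uniqueness, bounds, convexity, correctors\<close>

lemma cell_problem_solution_iff:
  "cell_problem_solution H p c v \<longleftrightarrow> cell_subsolution (\<lambda>y q. H y (p + q)) c v \<and>
     viscosity_supersolution_on UNIV (\<lambda>y q. H y (p + q) - c) v"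
  by (auto simp: cell_problem_solution_def viscosity_solution_on_def cell_subsolution_def)

context coercive_Hamiltonian
begin

text \<open>The level is a speed: \<open>v - c t\<close> and \<open>w - d t\<close> solve the same
  evolution equation, so once a constant orders them at time zero they stay ordered. If
  \<open>d\<close> exceeded \<open>c\<close>, the upper one would fall below the lower one in finite
  time.\<close>

lemma cell_level_le:
  assumes v: "cell_subsolution H c v" and w: "cell_subsolution H d w"
    and super: "viscosity_supersolution_on UNIV (\<lambda>y q. H y q - d) w"
  shows "d \<le> c"
proof (rule ccontr)
  assume "\<not> d \<le> c"
  obtain R where R: "0 \<le> R" "\<And>y q. H y q \<le> max c d \<Longrightarrow> norm q \<le> R" using sublevel_bounded by blast
  have lv: "R-lipschitz_on UNIV v" by (rule cell_subsolution_lipschitz[OF v R(1)]) (rule R(2), erule max.coboundedI1)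
  have lw: "R-lipschitz_on UNIV w" by (rule cell_subsolution_lipschitz[OF w R(1)]) (rule R(2), erule max.coboundedI2)
  obtain y1 where y1: "\<And>x. v x \<le> v y1" using Zn_periodic_attains_sup v unfolding cell_subsolution_def by blast
  obtain y2 where y2: "\<And>x. w y2 \<le> w x" using Zn_periodic_attains_inf w unfolding cell_subsolution_def by blast
  let ?K = "v y1 - w y2"
  have le: "v x \<le> ?K + w x" for x using y1[of x] y2[of x] by linarith
  have sub': "viscosity_subsolution_on UNIV (\<lambda>y q. H y (0 + q) - c) v"
    using v by (simp add: cell_subsolution_def)
  have super': "viscosity_supersolution_on UNIV (\<lambda>y q. H y (0 + q) - d) w" using super by simp
  let ?M = "0 + max \<bar>c\<bar> \<bar>d\<bar> + R"
  have cmp: "corrected_plane 0 0 c 1 v (x, t) \<le> corrected_plane ?K 0 d 1 w (x, t)" if "0 \<le> t" for x t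
  proof (rule Cauchy_comparison[OF _ _ _ corrected_plane_subsolution[OF sub'] corrected_plane_supersolution[OF super'] _ that])
    show "uniformly_continuous_on (UNIV \<times> cball 0 R) (\<lambda>(x, q). H (x /\<^sub>R 1) q)" for R
      using uniformly_continuous by simp
    show "?M-lipschitz_on (UNIV \<times> {0..}) (corrected_plane 0 0 c 1 v)"
      by (rule lipschitz_on_subset[OF corrected_plane_lipschitz[OF lv]]) auto
    show "?M-lipschitz_on (UNIV \<times> {0..}) (corrected_plane ?K 0 d 1 w)"
      by (rule lipschitz_on_subset[OF corrected_plane_lipschitz[OF lw]]) auto
  qed (use le in \<open>auto simp: corrected_plane_def\<close>)
  define t where "t = (\<bar>?K + w 0 - v 0\<bar> + 1) / (d - c)"
  have "t \<ge> 0" using \<open>\<not> d \<le> c\<close> by (simp add: t_def)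
  then have "(d - c) * t \<le> ?K + w 0 - v 0" using cmp[of t 0] by (simp add: corrected_plane_def algebra_simps)
  moreover have "(d - c) * t = \<bar>?K + w 0 - v 0\<bar> + 1" using \<open>\<not> d \<le> c\<close> by (simp add: t_def)
  ultimately show False by linarith
qed

text \<open>Discharges the definite description: existence comes from the critical value of the
  shifted Hamiltonian, uniqueness from \<open>cell_level_le\<close> applied both ways.\<close>

lemma effective_Hamiltonian_solution: "\<exists>v. cell_problem_solution H p (effective_Hamiltonian H p) v"
proof -
  interpret S: coercive_Hamiltonian "\<lambda>y q. H y (p + q)" by (rule shift)
  have "\<exists>!c. \<exists>v. cell_problem_solution H p c v"
  proof (rule ex_ex1I)
    show "\<exists>c v. cell_problem_solution H p c v"
      using S.cell_problem_solvable unfolding cell_problem_solution_iff by blast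
    show "c = d" if "\<exists>v. cell_problem_solution H p c v" "\<exists>v. cell_problem_solution H p d v" for c d
      using that S.cell_level_le unfolding cell_problem_solution_iff by (blast intro: antisym)
  qed
  then show ?thesis unfolding effective_Hamiltonian_def by (rule theI')
qed

lemma effective_Hamiltonian_le:
  assumes "cell_subsolution (\<lambda>y q. H y (p + q)) c v"
  shows "effective_Hamiltonian H p \<le> c"
proof -
  interpret S: coercive_Hamiltonian "\<lambda>y q. H y (p + q)" by (rule shift)
  show ?thesis
    using effective_Hamiltonian_solution[of p] S.cell_level_le[OF assms] unfolding cell_problem_solution_iff by blast
qed

text \<open>Constants touch the corrector at its maximum and at its minimum, which places the level
  between two values of \<open>H\<close> at slope \<open>p\<close>.\<close>

lemma effective_Hamiltonian_bounded:
  assumes "\<And>y. \<bar>H y p\<bar> \<le> K"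
  shows "\<bar>effective_Hamiltonian H p\<bar> \<le> K"
proof -
  interpret S: coercive_Hamiltonian "\<lambda>y q. H y (p + q)" by (rule shift)
  obtain v where v: "cell_subsolution (\<lambda>y q. H y (p + q)) (effective_Hamiltonian H p) v"
    and super: "viscosity_supersolution_on UNIV (\<lambda>y q. H y (p + q) - effective_Hamiltonian H p) v"
    using effective_Hamiltonian_solution[of p] unfolding cell_problem_solution_iff by blast
  obtain y where "H y (p + 0) \<le> effective_Hamiltonian H p" using S.cell_subsolution_level[OF v] by blast
  moreover obtain z where "\<And>x. v z \<le> v x"
    using Zn_periodic_attains_inf v unfolding cell_subsolution_def by blast
  then have "H z (p + 0) - effective_Hamiltonian H p \<ge> 0"
    by (intro viscosity_supersolution_onD[OF super C1_with_gradient_on_const[of UNIV 0]]) auto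
  ultimately show ?thesis using assms[of y] assms[of z] by (simp add: abs_le_iff)
qed

text \<open>Averaging two correctors gives a subsolution at the averaged slope and level, and the
  effective level lies below every subsolution level. Convexity is needed for the infimum of planes
  in the effective equation, and it also yields continuity.\<close>

lemma effective_Hamiltonian_convex: "convex_on UNIV (effective_Hamiltonian H)"
proof (rule convex_onI)
  fix s :: real and p1 p2 :: "real ^ 'n"
  assume s: "0 < s" "s < 1"
  let ?H = "effective_Hamiltonian H" and ?p = "(1 - s) *\<^sub>R p1 + s *\<^sub>R p2"
  interpret S1: coercive_Hamiltonian "\<lambda>y q. H y (p1 + q)" by (rule shift)
  interpret S2: coercive_Hamiltonian "\<lambda>y q. H y (p2 + q)" by (rule shift)
  interpret S: coercive_Hamiltonian "\<lambda>y q. H y (?p + q)" by (rule shift)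
  obtain v where v: "cell_subsolution (\<lambda>y q. H y (p1 + q)) (?H p1) v"
    using effective_Hamiltonian_solution[of p1] unfolding cell_problem_solution_iff by blast
  obtain w where w: "cell_subsolution (\<lambda>y q. H y (p2 + q)) (?H p2) w"
    using effective_Hamiltonian_solution[of p2] unfolding cell_problem_solution_iff by blast
  obtain R1 where R1: "0 \<le> R1" "\<And>y q. H y (p1 + q) \<le> ?H p1 \<Longrightarrow> norm q \<le> R1"
    using S1.sublevel_bounded by blast
  obtain R2 where R2: "0 \<le> R2" "\<And>y q. H y (p2 + q) \<le> ?H p2 \<Longrightarrow> norm q \<le> R2"
    using S2.sublevel_bounded by blast
  let ?R = "max R1 R2"
  have lv: "?R-lipschitz_on UNIV v"
    by (rule lipschitz_on_le[OF S1.cell_subsolution_lipschitz[OF v R1(1)] max.cobounded1]) (erule R1(2))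
  have lw: "?R-lipschitz_on UNIV w"
    by (rule lipschitz_on_le[OF S2.cell_subsolution_lipschitz[OF w R2(1)] max.cobounded2]) (erule R2(2))
  define u where "u z = (1 - s) * v z + (1 - (1 - s)) * w z" for z
  let ?c = "(1 - s) * ?H p1 + s * ?H p2"
  have "viscosity_subsolution_on UNIV (\<lambda>y q. H y (?p + q) - ?c) u"
    unfolding u_def
  proof (rule subsolution_convex_combination[OF open_UNIV S1.continuous_F S2.continuous_F
        S.convex_sublevel S.closed_sublevel lv lw])
    show "viscosity_subsolution_on UNIV (\<lambda>y q. H y (p1 + q) - ?H p1) v"
      "viscosity_subsolution_on UNIV (\<lambda>y q. H y (p2 + q) - ?H p2) w"
      using v w by (auto simp: cell_subsolution_def)
    fix z p q assume "H z (p1 + p) - ?H p1 \<le> 0" "H z (p2 + q) - ?H p2 \<le> 0"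
    then have "(1 - s) * H z (p1 + p) + s * H z (p2 + q) \<le> ?c"
      using s by (intro add_mono mult_left_mono) auto
    moreover have "H z ((1 - s) *\<^sub>R (p1 + p) + s *\<^sub>R (p2 + q)) \<le> (1 - s) * H z (p1 + p) + s * H z (p2 + q)"
      using convex_onD[OF convex[of z], of s "p1 + p" "p2 + q"] s by simp
    moreover have "(1 - s) *\<^sub>R (p1 + p) + s *\<^sub>R (p2 + q) = ?p + ((1 - s) *\<^sub>R p + (1 - (1 - s)) *\<^sub>R q)"
      by (simp add: algebra_simps)
    ultimately show "H z (?p + ((1 - s) *\<^sub>R p + (1 - (1 - s)) *\<^sub>R q)) - ?c \<le> 0" by simp
  qed (use s in auto)
  then have "cell_subsolution (\<lambda>y q. H y (?p + q)) ?c u"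
    using v w by (auto simp: cell_subsolution_def u_def Zn_periodic_def intro!: continuous_intros)
  then show "?H ?p \<le> ?c" by (rule effective_Hamiltonian_le)
qed simp

lemma effective_Hamiltonian_continuous: "continuous_on UNIV (effective_Hamiltonian H)"
  by (rule convex_on_continuous[OF open_UNIV effective_Hamiltonian_convex])

text \<open>For slopes of norm at most \<open>L\<close> the level is at most \<open>K\<close>, so p
  + q stays in a fixed ball and \<open>q\<close> has norm at most R + |L|. Periodicity turns this
  Lipschitz bound into a bound on the oscillation. The absolute value keeps the constant nonnegative
  for negative \<open>L\<close>, where no slope qualifies.\<close>

lemma bounded_correctors:
  shows "\<exists>K M C. \<forall>p. norm p \<le> L \<longrightarrow> \<bar>effective_Hamiltonian H p\<bar> \<le> K \<and>
    (\<exists>v. M-lipschitz_on UNIV v \<and> (\<forall>y. 0 \<le> v y \<and> v y \<le> C) \<and>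
        viscosity_subsolution_on UNIV (\<lambda>y q. H y (p + q) - effective_Hamiltonian H p) v \<and>
        viscosity_supersolution_on UNIV (\<lambda>y q. H y (p + q) - effective_Hamiltonian H p) v)"
proof -
  obtain K where K: "\<And>y q. norm q \<le> L \<Longrightarrow> \<bar>H y q\<bar> \<le> K" using bounded_on_balls by blast
  obtain R where R: "0 \<le> R" "\<And>y q. H y q \<le> K \<Longrightarrow> norm q \<le> R" using sublevel_bounded by blast
  let ?M = "R + \<bar>L\<bar>"
  have bound: "\<bar>effective_Hamiltonian H p\<bar> \<le> K" if "norm p \<le> L" for p
    by (rule effective_Hamiltonian_bounded[OF K[OF that]])
  have corr: "\<exists>v. ?M-lipschitz_on UNIV v \<and> (\<forall>y. 0 \<le> v y \<and> v y \<le> ?M * CARD('n)) \<and>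
        viscosity_subsolution_on UNIV (\<lambda>y q. H y (p + q) - effective_Hamiltonian H p) v \<and>
        viscosity_supersolution_on UNIV (\<lambda>y q. H y (p + q) - effective_Hamiltonian H p) v"
    if p: "norm p \<le> L" for p
  proof -
    let ?c = "effective_Hamiltonian H p"
    interpret S: coercive_Hamiltonian "\<lambda>y q. H y (p + q)" by (rule shift)
    obtain v0 where v0: "cell_subsolution (\<lambda>y q. H y (p + q)) ?c v0"
      and super0: "viscosity_supersolution_on UNIV (\<lambda>y q. H y (p + q) - ?c) v0"
      using effective_Hamiltonian_solution[of p] unfolding cell_problem_solution_iff by blast
    obtain y0 where y0: "\<And>x. v0 y0 \<le> v0 x"
      using Zn_periodic_attains_inf v0 unfolding cell_subsolution_def by blast
    \<comment> \<open>Minimum zero makes the correction nonnegative, so corrected planes lie above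
      the planes themselves and hence above \<open>g\<close> at time zero.\<close>
    define v where "v z = v0 z + - v0 y0" for z
    have v: "cell_subsolution (\<lambda>y q. H y (p + q)) ?c v"
      unfolding v_def by (rule S.cell_subsolution_add_const[OF v0])
    have super: "viscosity_supersolution_on UNIV (\<lambda>y q. H y (p + q) - ?c) v"
      unfolding v_def viscosity_supersolution_on_add_const by (rule super0)
    have lip: "?M-lipschitz_on UNIV v"
    proof (rule S.cell_subsolution_lipschitz[OF v])
      fix y q assume "H y (p + q) \<le> ?c"
      then have "norm (p + q) \<le> R" using R bound[OF p] by (meson abs_le_D1 order_trans)
      moreover have "norm q \<le> norm (p + q) + norm p"
        using norm_triangle_ineq4[of "p + q" p] by simp
      ultimately show "norm q \<le> ?M" using p by linarith
    qed (use R in auto)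
    have "v y \<le> ?M * CARD('n)" for y
      using Zn_periodic_lipschitz_osc[OF _ lip, of y y0] v by (simp add: cell_subsolution_def v_def)
    moreover have "0 \<le> v y" for y using y0[of y] by (simp add: v_def)
    ultimately show ?thesis using lip super v by (auto simp: cell_subsolution_def)
  qed
  show ?thesis
    by (rule exI[of _ K], rule exI[of _ ?M], rule exI[of _ "?M * CARD('n)"], intro allI impI conjI)
       (erule bound, erule corr)
qed

section \<open>The rate of convergence\<close>

lemma homogenization_rate:
  "\<exists>C. \<forall>g u_eff u \<epsilon> x t.
    L-lipschitz_on UNIV g \<longrightarrow> concave_on UNIV g \<longrightarrow>
    Cauchy_viscosity_solution (\<lambda>x q. effective_Hamiltonian H q) g u_eff \<longrightarrow>
    0 < \<epsilon> \<longrightarrow>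
    Cauchy_viscosity_solution (\<lambda>x q. H (x /\<^sub>R \<epsilon>) q) g u \<longrightarrow>
    0 \<le> t \<longrightarrow>
    \<bar>u (x, t) - u_eff (x, t)\<bar> \<le> C * \<epsilon>"
proof -
  let ?H = "effective_Hamiltonian H"
  obtain K M C where KMC: "\<forall>p. norm p \<le> L \<longrightarrow> \<bar>?H p\<bar> \<le> K \<and>
    (\<exists>v. M-lipschitz_on UNIV v \<and> (\<forall>y. 0 \<le> v y \<and> v y \<le> C) \<and>
        viscosity_subsolution_on UNIV (\<lambda>y q. H y (p + q) - ?H p) v \<and>
        viscosity_supersolution_on UNIV (\<lambda>y q. H y (p + q) - ?H p) v)"
    using bounded_correctors[of L] by (elim exE) (rule that)
  have K: "\<bar>?H p\<bar> \<le> K" if "norm p \<le> L" for p using KMC that by simp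
  obtain V where V: "\<And>p. norm p \<le> L \<Longrightarrow> M-lipschitz_on UNIV (V p) \<and> (\<forall>y. 0 \<le> V p y \<and> V p y \<le> C) \<and>
        viscosity_subsolution_on UNIV (\<lambda>y q. H y (p + q) - ?H p) (V p) \<and>
        viscosity_supersolution_on UNIV (\<lambda>y q. H y (p + q) - ?H p) (V p)"
    using KMC by metis
  show ?thesis
  proof (intro exI[of _ C] allI impI)
    fix g u_eff u :: "_ \<Rightarrow> real" and \<epsilon> t :: real and x :: "real ^ 'n"
    assume lip: "L-lipschitz_on UNIV g" and conc: "concave_on UNIV g"
      and ueff: "Cauchy_viscosity_solution (\<lambda>x q. ?H q) g u_eff" and \<epsilon>: "0 < \<epsilon>"
      and u: "Cauchy_viscosity_solution (\<lambda>x q. H (x /\<^sub>R \<epsilon>) q) g u" and t: "0 \<le> t"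
    have contg: "continuous_on UNIV g" using lip by (rule lipschitz_on_continuous_on)
    \<comment> \<open>The same index set serves both equations, so the two infima can be compared
      member by member.\<close>
    define I where "I = {(a, p). \<forall>y. g y \<le> a + p \<bullet> y}"
    have slope: "norm p \<le> L" if "(a, p) \<in> I" for a p
      using affine_majorant_slope[OF lip] that by (auto simp: I_def)
    have maj: "\<exists>(a, p)\<in>I. a + p \<bullet> y < g y + \<eta>" if pos: "\<eta> > 0" for y \<eta>
      using concave_affine_majorant[OF conc contg pos, of y] by (auto simp: I_def)
    have ne: "I \<noteq> {}" using maj[of 1] by auto
    define w where "w i = (case i of (a, p) \<Rightarrow> corrected_plane a p (?H p) \<epsilon> (V p))" for i
    define h where "h i = (case i of (a, p) \<Rightarrow> corrected_plane a p (?H p) 1 (\<lambda>_. 0))" for i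
    have hw: "h i z \<le> w i z" "w i z \<le> h i z + C * \<epsilon>" if i: "i \<in> I" for i z
    proof -
      obtain a p where ap: "i = (a, p)" by (cases i)
      have "0 \<le> V p y \<and> V p y \<le> C" for y using V slope i ap by blast
      then have "0 \<le> \<epsilon> * V p y \<and> \<epsilon> * V p y \<le> C * \<epsilon>" for y
        using \<epsilon> by (simp add: mult.commute[of C])
      then show "h i z \<le> w i z" "w i z \<le> h i z + C * \<epsilon>"
        by (auto simp: ap h_def w_def corrected_plane_def split: prod.split)
    qed
    \<comment> \<open>The absolute value of \<open>s\<close> appears because finiteness of the
      infima is required at all points of space-time, negative times included.\<close>
    have hlow: "g y - K * \<bar>s\<bar> \<le> h i (y, s)" if i: "i \<in> I" for i y s
    proof -
      obtain a p where ap: "i = (a, p)" by (cases i)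
      have "g y \<le> a + p \<bullet> y" using i ap by (simp add: I_def)
      moreover have "?H p * s \<le> K * \<bar>s\<bar>"
      proof -
        have "?H p * s \<le> \<bar>?H p\<bar> * \<bar>s\<bar>" by (metis abs_ge_self abs_mult)
        also have "\<dots> \<le> K * \<bar>s\<bar>" using K[OF slope] i ap by (intro mult_right_mono) auto
        finally show ?thesis .
      qed
      ultimately show ?thesis by (simp add: ap h_def corrected_plane_def)
    qed
    have bddh: "bdd_below ((\<lambda>i. h i z) ` I)" for z
    proof (cases z)
      case (Pair y s)
      show ?thesis unfolding Pair by (rule bdd_belowI2[OF hlow])
    qed
    have bddw: "bdd_below ((\<lambda>i. w i z) ` I)" for z
    proof (cases z)
      case (Pair y s)
      show ?thesis unfolding Pair by (rule bdd_belowI2[OF order_trans[OF hlow hw(1)]])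
    qed
    have h0: "(INF i\<in>I. h i (y, 0)) \<le> g y" for y
    proof (rule field_le_epsilon)
      fix e :: real assume "e > 0"
      then obtain a p where ap: "(a, p) \<in> I" "a + p \<bullet> y < g y + e" using maj[of e y] by auto
      have "(INF i\<in>I. h i (y, 0)) \<le> h (a, p) (y, 0)" by (rule cINF_lower[OF bddh ap(1)])
      then show "(INF i\<in>I. h i (y, 0)) \<le> g y + e" using ap(2) by (simp add: h_def corrected_plane_def)
    qed
    have INF_le: "(INF i\<in>I. w i z) \<le> (INF i\<in>I. h i z) + C * \<epsilon>" for z
    proof -
      have "(INF i\<in>I. w i z) - C * \<epsilon> \<le> (INF i\<in>I. h i z)"
      proof (rule cINF_greatest[OF ne])
        fix i assume i: "i \<in> I"
        have "(INF i\<in>I. w i z) \<le> w i z" by (rule cINF_lower[OF bddw i])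
        then show "(INF i\<in>I. w i z) - C * \<epsilon> \<le> h i z" using hw(2)[OF i, of z] by simp
      qed
      then show ?thesis by simp
    qed
    have INF_ge: "(INF i\<in>I. h i z) \<le> (INF i\<in>I. w i z)" for z
      by (rule cINF_mono[OF ne bddh]) (use hw(1) in blast)
    have above: "g y \<le> h i (y, 0)" if "i \<in> I" for i y using hlow[OF that, of y 0] by simp
    have u_bounds: "u (x, t) \<le> (INF i\<in>I. w i (x, t)) \<and> (INF i\<in>I. w i (x, t)) \<le> u (x, t) + C * \<epsilon>"
    proof (rule Cauchy_solution_INF_bounds[where w = w and M = "L + K + M", OF _ _ _ u ne])
      show "convex_on UNIV (H (x /\<^sub>R \<epsilon>))" for x by (rule convex)
      have "continuous_on UNIV (\<lambda>z :: (real ^ 'n) \<times> (real ^ 'n). (fst z /\<^sub>R \<epsilon>, snd z))"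
        by (intro continuous_intros)
      from continuous_on_compose2[OF continuous this]
      show "continuous_on UNIV (\<lambda>(x, q). H (x /\<^sub>R \<epsilon>) q)" by (simp add: case_prod_beta)
      show "uniformly_continuous_on (UNIV \<times> cball 0 R) (\<lambda>(x, q). H (x /\<^sub>R \<epsilon>) q)" for R
      proof -
        let ?S = "UNIV \<times> cball 0 R :: ((real ^ 'n) \<times> (real ^ 'n)) set"
        let ?f = "\<lambda>z :: (real ^ 'n) \<times> (real ^ 'n). (fst z /\<^sub>R \<epsilon>, snd z)"
        have "bounded_linear ?f"
          by (rule bounded_linear_Pair[OF bounded_linear_compose[OF bounded_linear_scaleR_right bounded_linear_fst]
                bounded_linear_snd])
        from bounded_linear.uniformly_continuous_on[OF this uniformly_continuous_on_id]
        have "uniformly_continuous_on ?S ?f" .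
        moreover have "uniformly_continuous_on (?f ` ?S) (\<lambda>(y, q). H y q)"
          by (rule uniformly_continuous_on_subset[OF uniformly_continuous[of R]]) auto
        ultimately have "uniformly_continuous_on ?S (\<lambda>z. (\<lambda>(y, q). H y q) (?f z))"
          by (rule uniformly_continuous_on_compose)
        then show ?thesis by (simp add: case_prod_unfold)
      qed
      fix i assume i: "i \<in> I"
      obtain a p where ap: "i = (a, p)" by (cases i)
      then have p: "norm p \<le> L" using slope i by blast
      show "(L + K + M)-lipschitz_on UNIV (w i)"
        using corrected_plane_lipschitz[OF _ p K[OF p] \<epsilon>] V[OF p] by (simp add: w_def ap)
      show "viscosity_subsolution_on (UNIV \<times> {0<..}) (\<lambda>(x, t) (q, \<tau>). \<tau> + H (x /\<^sub>R \<epsilon>) q) (w i)"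
        unfolding w_def ap prod.case
        by (rule corrected_plane_subsolution[where H = H, OF _ \<epsilon>]) (use V[OF p] in simp)
      show "viscosity_supersolution_on (UNIV \<times> {0<..}) (\<lambda>(x, t) (q, \<tau>). \<tau> + H (x /\<^sub>R \<epsilon>) q) (w i)"
        unfolding w_def ap prod.case
        by (rule corrected_plane_supersolution[where H = H, OF _ \<epsilon>]) (use V[OF p] in simp)
      show "g y \<le> w i (y, 0)" for y using above[OF i] hw(1)[OF i] by (rule order_trans)
    next
      show "(INF i\<in>I. w i (y, 0)) \<le> g y + C * \<epsilon>" for y using INF_le[of "(y, 0)"] h0[of y] by simp
    qed (use bddw t in auto)
    \<comment> \<open>With gap zero this identifies \<open>u_eff\<close> with the infimum of the
      planes, a Hopf formula for concave data.\<close>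
    have eff_bounds: "u_eff (x, t) \<le> (INF i\<in>I. h i (x, t)) \<and> (INF i\<in>I. h i (x, t)) \<le> u_eff (x, t) + 0"
    proof (rule Cauchy_solution_INF_bounds[where w = h and M = "L + K + 0", OF _ _ _ ueff ne])
      show "convex_on UNIV ?H" for x :: "real ^ 'n" by (rule effective_Hamiltonian_convex)
      show "continuous_on UNIV (\<lambda>(x :: real ^ 'n, q). ?H q)"
        unfolding case_prod_beta
        by (rule continuous_on_compose2[OF effective_Hamiltonian_continuous]) (auto intro: continuous_intros)
      show "uniformly_continuous_on (UNIV \<times> cball 0 R) (\<lambda>(x :: real ^ 'n, q). ?H q)" for R
      proof -
        let ?S = "UNIV \<times> cball 0 R :: ((real ^ 'n) \<times> (real ^ 'n)) set"
        have "uniformly_continuous_on (cball 0 R) ?H"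
          by (intro compact_uniformly_continuous compact_cball
              continuous_on_subset[OF effective_Hamiltonian_continuous] subset_UNIV)
        then have "uniformly_continuous_on (snd ` ?S) ?H" by (rule uniformly_continuous_on_subset) auto
        with bounded_linear.uniformly_continuous_on[OF bounded_linear_snd uniformly_continuous_on_id]
        have "uniformly_continuous_on ?S (\<lambda>z. ?H (snd z))" by (rule uniformly_continuous_on_compose)
        then show ?thesis by (simp add: case_prod_unfold)
      qed
      fix i assume i: "i \<in> I"
      obtain a p where ap: "i = (a, p)" by (cases i)
      then have p: "norm p \<le> L" using slope i by blast
      note zero = zero_solves_constant_cell_problem[of ?H p]
      show "(L + K + 0)-lipschitz_on UNIV (h i)"
        unfolding h_def ap prod.case
        by (rule corrected_plane_lipschitz[OF _ p K[OF p]]) (auto simp: lipschitz_on_def)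
      show "viscosity_subsolution_on (UNIV \<times> {0<..}) (\<lambda>(x, t) (q, \<tau>). \<tau> + ?H q) (h i)"
        using corrected_plane_subsolution[where H = "\<lambda>y. ?H", OF zero(1)] by (simp add: h_def ap)
      show "viscosity_supersolution_on (UNIV \<times> {0<..}) (\<lambda>(x, t) (q, \<tau>). \<tau> + ?H q) (h i)"
        using corrected_plane_supersolution[where H = "\<lambda>y. ?H", OF zero(2)] by (simp add: h_def ap)
      show "g y \<le> h i (y, 0)" for y by (rule above[OF i])
    next
      show "(INF i\<in>I. h i (y, 0)) \<le> g y + 0" for y using h0[of y] by simp
    qed (use bddh t in auto)
    \<comment> \<open>Upward: \<open>u\<close> is below the corrected infimum, which is at most
      \<open>C * \<epsilon>\<close> above \<open>u_eff\<close>. Downward: \<open>u_eff\<close> is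
      below the corrected infimum, which is at most \<open>C * \<epsilon>\<close> above
      \<open>u\<close>.\<close>
    show "\<bar>u (x, t) - u_eff (x, t)\<bar> \<le> C * \<epsilon>"
      using u_bounds eff_bounds INF_le[of "(x, t)"] INF_ge[of "(x, t)"] by linarith
  qed
qed

end

theorem theorem2p5:
  fixes H :: "real ^ 'n \<Rightarrow> real ^ 'n \<Rightarrow> real"
  assumes "continuous_on UNIV (\<lambda>(y, p). H y p)"
    and "\<And>p. Zn_periodic (\<lambda>y. H y p)"
    and "\<And>M. \<forall>\<^sub>F p in at_infinity. \<forall>y. M \<le> H y p"
    and "\<And>y. convex_on UNIV (H y)"
  shows "\<forall>L. \<exists>C. \<forall>g u_eff u \<epsilon> x t.
    L-lipschitz_on UNIV g \<longrightarrow> concave_on UNIV g \<longrightarrow>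
    Cauchy_viscosity_solution (\<lambda>x q. effective_Hamiltonian H q) g u_eff \<longrightarrow>
    0 < \<epsilon> \<longrightarrow>
    Cauchy_viscosity_solution (\<lambda>x q. H (x /\<^sub>R \<epsilon>) q) g u \<longrightarrow>
    0 \<le> t \<longrightarrow>
    \<bar>u (x, t) - u_eff (x, t)\<bar> \<le> C * \<epsilon>"
proof -
  interpret coercive_Hamiltonian H by unfold_locales (use assms in auto)
  show ?thesis by (intro allI homogenization_rate)
qed

end
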